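(* Let $1\le p<\infty$, let $H$ be an infinite-dimensional Hilbert space, and let $\mathcal{S}_p(H)$ be the ideal of Schatten $p$-class operators on $H$, regarded as a Banach algebra under composition with the Schatten $p$-norm. Then $\mathcal{S}_p(H)$ is not approximately amenable.
   Context: The Schatten $p$-norm is $\|T\|_p=(\operatorname{trace}|T|^p)^{1/p}$. A continuous derivation $D$ from a Banach algebra $\mathcal{A}$ into a Banach $\mathcal{A}$-bimodule $Y$ is approximately inner if there is a net $(y_i)$ in $Y$ such that $D(a)=\lim_i (a\cdot y_i-y_i\cdot a)$ in norm for every $a\in\mathcal{A}$. The Banach algebra $\mathcal{A}$ is approximately amenable if, for every Banach $\mathcal{A}$-bimodule $X$, every continuous derivation from $\mathcal{A}$ into the dual bimodule $X^*$ is approximately inner. *)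

theory Defs
  imports "HOL-Analysis.Analysis" "HOL-Computational_Algebra.Polynomial"
begin

section \<open>Complex Hilbert spaces and bounded operators\<close>

text \<open>The inner product is linear in the first argument. Positive definiteness of
  \<open>cinner\<close> follows from \<open>norm_eq_sqrt_cinner\<close> and the norm axioms, because \<open>sqrt\<close> is
  negative on negative reals; completeness is part of the class \<open>banach\<close>.\<close>

class complex_hilbert_space = banach +
  fixes scaleC :: "complex \<Rightarrow> 'a \<Rightarrow> 'a" (infixr "*\<^sub>C" 75)
    and cinner :: "'a \<Rightarrow> 'a \<Rightarrow> complex"
  assumes scaleC_add_right: "c *\<^sub>C (x + y) = c *\<^sub>C x + c *\<^sub>C y"
    and scaleC_add_left: "(c + d) *\<^sub>C x = c *\<^sub>C x + d *\<^sub>C x"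
    and scaleC_scaleC: "c *\<^sub>C (d *\<^sub>C x) = (c * d) *\<^sub>C x"
    and scaleR_scaleC: "r *\<^sub>R x = complex_of_real r *\<^sub>C x"
    and cinner_commute: "cinner x y = cnj (cinner y x)"
    and cinner_add_left: "cinner (x + y) z = cinner x z + cinner y z"
    and cinner_scaleC_left: "cinner (c *\<^sub>C x) y = c * cinner x y"
    and norm_eq_sqrt_cinner: "norm x = sqrt (Re (cinner x x))"

definition bounded_clinear :: "('h::complex_hilbert_space \<Rightarrow> 'h) \<Rightarrow> bool" where
  "bounded_clinear T \<longleftrightarrow> bounded_linear T \<and> (\<forall>c x. T (c *\<^sub>C x) = c *\<^sub>C T x)"

definition positive_op :: "('h::complex_hilbert_space \<Rightarrow> 'h) \<Rightarrow> bool" where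
  "positive_op T \<longleftrightarrow> bounded_clinear T \<and> (\<forall>x. cinner (T x) x \<in> \<real>\<^sub>\<ge>\<^sub>0)"

definition cadjoint :: "('h::complex_hilbert_space \<Rightarrow> 'h) \<Rightarrow> ('h \<Rightarrow> 'h)" where
  "cadjoint T = (THE S. \<forall>x y. cinner (T x) y = cinner x (S y))"

definition orthonormal_basis :: "'h::complex_hilbert_space set \<Rightarrow> bool" where
  "orthonormal_basis E \<longleftrightarrow>
     (\<forall>e\<in>E. \<forall>f\<in>E. cinner e f = (if e = f then 1 else 0)) \<and>
     closure (module.span (*\<^sub>C) E) = UNIV"


section \<open>Powers of positive operators, trace, and Schatten classes\<close>

definition poly_op :: "real poly \<Rightarrow> ('h::complex_hilbert_space \<Rightarrow> 'h) \<Rightarrow> ('h \<Rightarrow> 'h)" where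
  "poly_op q T = (\<lambda>x. \<Sum>i\<le>degree q. coeff q i *\<^sub>R (T ^^ i) x)"

text \<open>\<open>op_powr A s\<close> (for positive \<open>A\<close> and \<open>s > 0\<close>) is the continuous functional calculus of
  \<open>A\<close> at \<open>t \<mapsto> t\<^sup>s\<close>, that is, the operator-norm limit of \<open>q\<^sub>n(A)\<close> for any real
  polynomials \<open>q\<^sub>n\<close> converging to \<open>t\<^sup>s\<close> uniformly on \<open>[0, \<parallel>A\<parallel>]\<close>, an interval that contains
  the spectrum of \<open>A\<close>. Recall \<open>0 powr s = 0\<close>.\<close>

definition op_powr :: "('h::complex_hilbert_space \<Rightarrow> 'h) \<Rightarrow> real \<Rightarrow> ('h \<Rightarrow> 'h)" where
  "op_powr A s = (THE B. bounded_clinear B \<and>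
     (\<forall>q :: nat \<Rightarrow> real poly.
        uniform_limit {0..onorm A} (\<lambda>n t. poly (q n) t) (\<lambda>t. t powr s) sequentially \<longrightarrow>
        (\<lambda>n. onorm (\<lambda>x. poly_op (q n) A x - B x)) \<longlonglongrightarrow> 0))"

definition op_abs :: "('h::complex_hilbert_space \<Rightarrow> 'h) \<Rightarrow> ('h \<Rightarrow> 'h)" where
  "op_abs T = op_powr (cadjoint T \<circ> T) (1 / 2)"

text \<open>The trace of a positive operator, with values in \<open>[0, \<infinity>]\<close>; it does not depend on the
  orthonormal basis.\<close>

definition pos_trace :: "('h::complex_hilbert_space \<Rightarrow> 'h) \<Rightarrow> ennreal" where
  "pos_trace A =
     (\<Sum>\<^sub>\<infinity>e\<in>(SOME E. orthonormal_basis E). ennreal (Re (cinner (A e) e)))"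

definition schatten_class :: "real \<Rightarrow> ('h::complex_hilbert_space \<Rightarrow> 'h) set" where
  "schatten_class p = {T. bounded_clinear T \<and> pos_trace (op_powr (op_abs T) p) < \<infinity>}"

definition schatten_norm :: "real \<Rightarrow> ('h::complex_hilbert_space \<Rightarrow> 'h) \<Rightarrow> real" where
  "schatten_norm p T = enn2real (pos_trace (op_powr (op_abs T) p)) powr (1 / p)"


section \<open>Banach spaces, algebras and bimodules on carrier sets\<close>

record 'v normed_structure =
  vcarrier :: "'v set"
  vadd :: "'v \<Rightarrow> 'v \<Rightarrow> 'v"
  vzero :: 'v
  vscale :: "complex \<Rightarrow> 'v \<Rightarrow> 'v"
  vnorm :: "'v \<Rightarrow> real"

record 'a algebra_structure = "'a normed_structure" +
  amult :: "'a \<Rightarrow> 'a \<Rightarrow> 'a"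

record ('a, 'x) bimodule_structure = "'x normed_structure" +
  lact :: "'a \<Rightarrow> 'x \<Rightarrow> 'x"
  ract :: "'x \<Rightarrow> 'a \<Rightarrow> 'x"

definition vdiff :: "('v, 'm) normed_structure_scheme \<Rightarrow> 'v \<Rightarrow> 'v \<Rightarrow> 'v" where
  "vdiff V x y = vadd V x (vscale V (- 1) y)"

locale complex_banach_space =
  fixes V :: "('v, 'm) normed_structure_scheme"
  assumes zero_closed: "vzero V \<in> vcarrier V"
    and add_closed: "\<lbrakk>x \<in> vcarrier V; y \<in> vcarrier V\<rbrakk> \<Longrightarrow> vadd V x y \<in> vcarrier V"
    and scale_closed: "x \<in> vcarrier V \<Longrightarrow> vscale V c x \<in> vcarrier V"
    and add_assoc: "\<lbrakk>x \<in> vcarrier V; y \<in> vcarrier V; z \<in> vcarrier V\<rbrakk>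
      \<Longrightarrow> vadd V (vadd V x y) z = vadd V x (vadd V y z)"
    and add_commute: "\<lbrakk>x \<in> vcarrier V; y \<in> vcarrier V\<rbrakk> \<Longrightarrow> vadd V x y = vadd V y x"
    and add_zero: "x \<in> vcarrier V \<Longrightarrow> vadd V x (vzero V) = x"
    and add_inverse: "x \<in> vcarrier V \<Longrightarrow> vadd V x (vscale V (- 1) x) = vzero V"
    and scale_add_right: "\<lbrakk>x \<in> vcarrier V; y \<in> vcarrier V\<rbrakk>
      \<Longrightarrow> vscale V c (vadd V x y) = vadd V (vscale V c x) (vscale V c y)"
    and scale_add_left: "x \<in> vcarrier V
      \<Longrightarrow> vscale V (c + d) x = vadd V (vscale V c x) (vscale V d x)"
    and scale_scale: "x \<in> vcarrier V \<Longrightarrow> vscale V c (vscale V d x) = vscale V (c * d) x"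
    and scale_one: "x \<in> vcarrier V \<Longrightarrow> vscale V 1 x = x"
    and norm_nonneg: "x \<in> vcarrier V \<Longrightarrow> 0 \<le> vnorm V x"
    and norm_eq_zero: "x \<in> vcarrier V \<Longrightarrow> vnorm V x = 0 \<longleftrightarrow> x = vzero V"
    and norm_triangle: "\<lbrakk>x \<in> vcarrier V; y \<in> vcarrier V\<rbrakk>
      \<Longrightarrow> vnorm V (vadd V x y) \<le> vnorm V x + vnorm V y"
    and norm_scale: "x \<in> vcarrier V \<Longrightarrow> vnorm V (vscale V c x) = cmod c * vnorm V x"
    and complete: "\<lbrakk>\<And>n::nat. \<sigma> n \<in> vcarrier V;
        \<And>e::real. e > 0 \<Longrightarrow> \<exists>N. \<forall>m\<ge>N. \<forall>n\<ge>N. vnorm V (vdiff V (\<sigma> m) (\<sigma> n)) < e\<rbrakk>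
      \<Longrightarrow> \<exists>x\<in>vcarrier V. (\<lambda>n. vnorm V (vdiff V (\<sigma> n) x)) \<longlonglongrightarrow> 0"

definition linear_between ::
  "('v, 'm) normed_structure_scheme \<Rightarrow> ('w, 'n) normed_structure_scheme \<Rightarrow> ('v \<Rightarrow> 'w) \<Rightarrow> bool"
where
  "linear_between V W f \<longleftrightarrow>
     (\<forall>x\<in>vcarrier V. f x \<in> vcarrier W) \<and>
     (\<forall>x\<in>vcarrier V. \<forall>y\<in>vcarrier V. f (vadd V x y) = vadd W (f x) (f y)) \<and>
     (\<forall>c. \<forall>x\<in>vcarrier V. f (vscale V c x) = vscale W c (f x))"

definition continuous_linear_between ::
  "('v, 'm) normed_structure_scheme \<Rightarrow> ('w, 'n) normed_structure_scheme \<Rightarrow> ('v \<Rightarrow> 'w) \<Rightarrow> bool"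
where
  "continuous_linear_between V W f \<longleftrightarrow>
     linear_between V W f \<and> (\<exists>C. \<forall>x\<in>vcarrier V. vnorm W (f x) \<le> C * vnorm V x)"

locale banach_bimodule = complex_banach_space X
  for A :: "('a, 'm) algebra_structure_scheme"
    and X :: "('a, 'x, 'n) bimodule_structure_scheme" +
  assumes lact_linear: "a \<in> vcarrier A \<Longrightarrow> linear_between X X (lact X a)"
    and lact_linear_algebra: "x \<in> vcarrier X \<Longrightarrow> linear_between A X (\<lambda>a. lact X a x)"
    and ract_linear: "a \<in> vcarrier A \<Longrightarrow> linear_between X X (\<lambda>x. ract X x a)"
    and ract_linear_algebra: "x \<in> vcarrier X \<Longrightarrow> linear_between A X (ract X x)"
    and lact_lact: "\<lbrakk>a \<in> vcarrier A; b \<in> vcarrier A; x \<in> vcarrier X\<rbrakk>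
      \<Longrightarrow> lact X a (lact X b x) = lact X (amult A a b) x"
    and ract_ract: "\<lbrakk>a \<in> vcarrier A; b \<in> vcarrier A; x \<in> vcarrier X\<rbrakk>
      \<Longrightarrow> ract X (ract X x a) b = ract X x (amult A a b)"
    and lact_ract: "\<lbrakk>a \<in> vcarrier A; b \<in> vcarrier A; x \<in> vcarrier X\<rbrakk>
      \<Longrightarrow> lact X a (ract X x b) = ract X (lact X a x) b"
    and lact_bounded: "\<exists>C. \<forall>a\<in>vcarrier A. \<forall>x\<in>vcarrier X.
      vnorm X (lact X a x) \<le> C * vnorm A a * vnorm X x"
    and ract_bounded: "\<exists>C. \<forall>a\<in>vcarrier A. \<forall>x\<in>vcarrier X.
      vnorm X (ract X x a) \<le> C * vnorm A a * vnorm X x"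

definition complex_numbers :: "complex normed_structure" where
  "complex_numbers =
     \<lparr>vcarrier = UNIV, vadd = (+), vzero = 0, vscale = (*), vnorm = cmod\<rparr>"

text \<open>The dual bimodule, with \<open>(a\<cdot>f)(x) = f(x\<cdot>a)\<close> and \<open>(f\<cdot>a)(x) = f(a\<cdot>x)\<close>. Functionals are
  extended by \<open>0\<close> outside the carrier of \<open>X\<close> so that each is represented by one function.\<close>

definition dual_bimodule ::
  "('a, 'x, 'n) bimodule_structure_scheme \<Rightarrow> ('a, 'x \<Rightarrow> complex) bimodule_structure" where
  "dual_bimodule X =
     \<lparr>vcarrier = {f. continuous_linear_between X complex_numbers f \<and>
                     (\<forall>x. x \<notin> vcarrier X \<longrightarrow> f x = 0)},
      vadd = (\<lambda>f g x. f x + g x),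
      vzero = (\<lambda>x. 0),
      vscale = (\<lambda>c f x. c * f x),
      vnorm = (\<lambda>f. SUP x\<in>{x \<in> vcarrier X. vnorm X x \<le> 1}. cmod (f x)),
      lact = (\<lambda>a f x. if x \<in> vcarrier X then f (ract X x a) else 0),
      ract = (\<lambda>f a x. if x \<in> vcarrier X then f (lact X a x) else 0)\<rparr>"


section \<open>Approximate amenability\<close>

definition continuous_derivation ::
  "('a, 'm) algebra_structure_scheme \<Rightarrow> ('a, 'y, 'n) bimodule_structure_scheme
    \<Rightarrow> ('a \<Rightarrow> 'y) \<Rightarrow> bool" where
  "continuous_derivation A Y D \<longleftrightarrow>
     continuous_linear_between A Y D \<and>
     (\<forall>a\<in>vcarrier A. \<forall>b\<in>vcarrier A.
        D (amult A a b) = vadd Y (lact Y a (D b)) (ract Y (D a) b))"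

text \<open>A net in \<open>Y\<close> is represented, as usual in Isabelle/HOL, by a proper filter that
  eventually lies in the carrier: the filter of tails of the net. Conversely, a proper filter
  on the carrier is the tail filter of a net indexed by pointed members of the filter.\<close>

definition approximately_inner ::
  "('a, 'm) algebra_structure_scheme \<Rightarrow> ('a, 'y, 'n) bimodule_structure_scheme
    \<Rightarrow> ('a \<Rightarrow> 'y) \<Rightarrow> bool" where
  "approximately_inner A Y D \<longleftrightarrow>
     (\<exists>F :: 'y filter. F \<noteq> bot \<and> (\<forall>\<^sub>F y in F. y \<in> vcarrier Y) \<and>
        (\<forall>a\<in>vcarrier A.
           ((\<lambda>y. vnorm Y (vdiff Y (D a) (vdiff Y (lact Y a y) (ract Y y a)))) \<longlongrightarrow> 0) F))"

text \<open>HOL cannot quantify over all types inside a formula, so the type \<open>'x\<close> from which the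
  bimodules \<open>X\<close> take their elements is a parameter; all Banach bimodules whose carrier is a
  subset of \<open>'x\<close> are considered. Failure of the property for one type \<open>'x\<close> exhibits an actual
  bimodule and derivation, hence is failure of approximate amenability without any restriction
  on \<open>X\<close>. Conversely, nothing is lost once \<open>'x\<close> has at least the cardinality of a (nonzero)
  Banach algebra \<open>A\<close>: if approximate innerness fails for some \<open>X\<close>, then it fails for some
  closed subbimodule of density character at most that of \<open>A\<close>, up to countable factors, and
  such a bimodule has an isomorphic copy with carrier in \<open>'x\<close>.\<close>

definition approximately_amenable ::
  "'x itself \<Rightarrow> ('a, 'm) algebra_structure_scheme \<Rightarrow> bool" where
  "approximately_amenable _ A \<longleftrightarrow>
     (\<forall>(X :: ('a, 'x) bimodule_structure) D.
        banach_bimodule A X \<longrightarrow> continuous_derivation A (dual_bimodule X) D \<longrightarrow>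
        approximately_inner A (dual_bimodule X) D)"

definition schatten_algebra ::
  "real \<Rightarrow> ('h::complex_hilbert_space \<Rightarrow> 'h) algebra_structure" where
  "schatten_algebra p =
     \<lparr>vcarrier = schatten_class p,
      vadd = (\<lambda>S T x. S x + T x),
      vzero = (\<lambda>x. 0),
      vscale = (\<lambda>c T x. c *\<^sub>C T x),
      vnorm = schatten_norm p,
      amult = (\<circ>)\<rparr>"

end

theory Submission
  imports Defs "HOL-Computational_Algebra.Fundamental_Theorem_Algebra"
begin

text \<open>Let \<open>\<phi>\<^sub>k(S) = n\<^sub>k\<^bsup>1-p\<^esup> tr(P\<^sub>k S)\<close>, where the \<open>P\<^sub>k\<close> are diagonal projections onto pairwise orthogonal
  blocks of rank \<open>n\<^sub>k\<^bsup>p\<^esup>\<close> with \<open>n\<^sub>k = L\<^bsup>k\<^esup>\<close>. The functionals \<open>\<phi>\<^sub>k\<close> have norm at most \<open>1\<close> on \<open>\<S>\<^sub>p\<close>, while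
  formally \<open>\<phi>\<^sub>k(id) = n\<^sub>k\<close> is unbounded.
  Take \<open>D a = a \<otimes> id - id \<otimes> a\<close>, viewed as a functional on bilinear forms on \<open>\<S>\<^sub>p\<close> with an adjoined
  unit, where \<open>id \<otimes> id\<close> is removed so that \<open>D\<close> is not obviously inner. Suppose that \<open>y\<close>
  implements \<open>D\<close> up to \<open>\<epsilon>\<close> on two diagonal operators. If such an operator has the eigenvalue \<open>d\<close> on the blocks
  \<open>k\<close> and \<open>l\<close>, then testing against \<open>\<phi>\<^sub>k \<otimes> \<phi>\<^sub>l\<close> shows that \<open>U\<^sub>k = y(g\<^sub>k) / n\<^sub>k\<close> and
  \<open>V\<^sub>l = y(h\<^sub>l) / n\<^sub>l\<close>, with the forms \<open>g\<^sub>k : (S, id) \<mapsto> \<phi>\<^sub>k(S)\<close> and \<open>h\<^sub>l : (id, T) \<mapsto> \<phi>\<^sub>l(T)\<close>, differ by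
  at most \<open>\<epsilon> / (d n\<^sub>k n\<^sub>l)\<close>. One operator is constant on the pairs of blocks
  \<open>{2j, 2j+1}\<close> and the other on \<open>{2j-1, 2j}\<close>, with eigenvalues that are \<open>p\<close>-summable although
  \<open>1 / (d n\<^sub>k n\<^sub>k\<^sub>+\<^sub>1)\<close> is summable. Hence \<open>U\<^sub>0, V\<^sub>1, U\<^sub>2, V\<^sub>3, \<dots>\<close> stays close to \<open>U\<^sub>0 \<approx> 1\<close>, which
  contradicts that it tends to \<open>0\<close> because \<open>y\<close> is bounded.\<close>

section \<open>Hilbert space preliminaries\<close>

text \<open>Had the pair (id, id) been kept, evaluation at it would implement \<open>D\<close>
  exactly and would formally give U_k = V_l = 1. A \<open>y\<close> that almost implements
  \<open>D\<close> has to imitate this missing point, and what prevents it is the bound |U_k| \<le>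
  M / n_k for a bounded \<open>y\<close>. The work lies in carrying the value U_0 \<approx> 1 to a
  block where this bound is small. For a diagonal operator with eigenvalue d_k on block k,
  membership in S_p forces n_k d_k to tend to 0, so no operator has one nonzero eigenvalue on all
  blocks. But an eigenvalue shared by the blocks k and k+1 only may be d = (2 L)^-(k+1), and then d
  n_k n_(k+1) = (L/2)^k / 2 still grows. Two operators with shifted pairings link every block to the
  next, so a single \<open>y\<close>, chosen from the net for these two operators, already leads to
  the contradiction.\<close>

lemma scaleC_one [simp]: "1 *\<^sub>C x = (x :: 'h::complex_hilbert_space)"
  using scaleR_scaleC[of 1 x] by simp

interpretation scaleC: vector_space "(*\<^sub>C) :: complex \<Rightarrow> 'h \<Rightarrow> 'h::complex_hilbert_space"
  by unfold_locales
    (simp_all add: scaleC_add_right scaleC_add_left scaleC_scaleC)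

lemma cinner_add_right:
  "cinner (x :: 'h::complex_hilbert_space) (y + z) = cinner x y + cinner x z"
  by (metis cinner_add_left cinner_commute complex_cnj_add)

lemma cinner_scaleC_right:
  "cinner (x :: 'h::complex_hilbert_space) (c *\<^sub>C y) = cnj c * cinner x y"
  by (metis cinner_scaleC_left cinner_commute complex_cnj_mult)

lemma Re_cinner_self: "Re (cinner x x) = (norm (x :: 'h::complex_hilbert_space))\<^sup>2"
proof -
  have "0 \<le> sqrt (Re (cinner x x))" using norm_eq_sqrt_cinner[of x] norm_ge_zero[of x] by linarith
  then show ?thesis by (simp add: norm_eq_sqrt_cinner)
qed

lemma cinner_self: "cinner x x = of_real ((norm (x :: 'h::complex_hilbert_space))\<^sup>2)"
proof -
  have "Im (cinner x x) = 0"
    using cinner_commute[of x x] by (metis Reals_cnj_iff complex_is_Real_iff)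
  then show ?thesis by (simp add: complex_eq_iff Re_cinner_self)
qed

lemma norm_scaleC: "norm (c *\<^sub>C x) = cmod c * norm (x :: 'h::complex_hilbert_space)"
proof -
  have "cinner (c *\<^sub>C x) (c *\<^sub>C x) = of_real ((cmod c)\<^sup>2 * (norm x)\<^sup>2)"
    by (simp only: cinner_scaleC_left cinner_scaleC_right cinner_self[of x] of_real_mult complex_norm_square mult_ac)
  then have "(norm (c *\<^sub>C x))\<^sup>2 = (cmod c * norm x)\<^sup>2"
    unfolding cinner_self of_real_eq_iff by (simp add: power_mult_distrib)
  then show ?thesis by (simp add: power2_eq_iff_nonneg)
qed

lemma cinner_scaleR_left: "cinner (r *\<^sub>R x) (y :: 'h::complex_hilbert_space) = r *\<^sub>R cinner x y"
  by (simp add: scaleR_scaleC cinner_scaleC_left scaleR_conv_of_real)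

lemma cinner_scaleR_right: "cinner x (r *\<^sub>R (y :: 'h::complex_hilbert_space)) = r *\<^sub>R cinner x y"
  by (simp add: scaleR_scaleC cinner_scaleC_right scaleR_conv_of_real)

lemma cinner_zero_left [simp]: "cinner 0 (y :: 'h::complex_hilbert_space) = 0"
  using cinner_scaleR_left[of 0 0 y] by simp

lemma cinner_zero_right [simp]: "cinner (y :: 'h::complex_hilbert_space) 0 = 0"
  using cinner_scaleR_right[of y 0 0] by simp

lemma norm_add_sq:
  "(norm (x + y :: 'h::complex_hilbert_space))\<^sup>2 = (norm x)\<^sup>2 + (norm y)\<^sup>2 + 2 * Re (cinner x y)"
proof -
  have "Re (cinner y x) = Re (cinner x y)" by (metis cinner_commute complex_cnj(1) cnj.simps(1))
  then show ?thesis
    by (simp add: Re_cinner_self[symmetric] cinner_add_left cinner_add_right)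
qed

lemma norm_cinner_le: "cmod (cinner x y) \<le> norm x * norm (y :: 'h::complex_hilbert_space)"
proof (cases "y = 0")
  case False
  \<comment> \<open>With this coefficient \<open>x + t *\<^sub>C y\<close> is the component of
    \<open>x\<close> orthogonal to \<open>y\<close>.\<close>
  define t where "t = - cinner x y / of_real ((norm y)\<^sup>2)"
  have ny: "norm y > 0" using False by simp
  have 1: "0 \<le> (norm (x + t *\<^sub>C y))\<^sup>2" by simp
  have "cinner x (t *\<^sub>C y) = - of_real ((cmod (cinner x y))\<^sup>2 / (norm y)\<^sup>2)"
    unfolding cinner_scaleC_right t_def of_real_divide complex_norm_square[of "cinner x y"]
    by (simp add: mult.commute)
  then have "Re (cinner x (t *\<^sub>C y)) = - ((cmod (cinner x y))\<^sup>2 / (norm y)\<^sup>2)"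
    by (metis Re_complex_of_real of_real_minus)
  moreover have "(norm (t *\<^sub>C y))\<^sup>2 = (cmod (cinner x y))\<^sup>2 / (norm y)\<^sup>2"
    using ny by (simp add: norm_scaleC t_def norm_divide norm_power power_mult_distrib power_divide field_simps power2_eq_square norm_mult)
  ultimately have "0 \<le> (norm x)\<^sup>2 - (cmod (cinner x y))\<^sup>2 / (norm y)\<^sup>2"
    using 1 unfolding norm_add_sq by simp
  then have "(cmod (cinner x y))\<^sup>2 \<le> (norm x * norm y)\<^sup>2"
    using ny by (simp add: field_simps power_mult_distrib)
  then show ?thesis by (rule power2_le_imp_le) simp
qed simp

interpretation cinner: bounded_bilinear "cinner :: 'h::complex_hilbert_space \<Rightarrow> 'h \<Rightarrow> complex"
proof qed (auto simp: cinner_add_left cinner_add_right cinner_scaleR_left cinner_scaleR_right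
    intro!: exI[of _ 1] norm_cinner_le)

interpretation scaleC: bounded_bilinear "(*\<^sub>C) :: complex \<Rightarrow> 'h \<Rightarrow> 'h::complex_hilbert_space"
proof
  show "(r *\<^sub>R a) *\<^sub>C b = r *\<^sub>R a *\<^sub>C b" for r a and b :: 'h
    by (simp add: scaleR_scaleC scaleC_scaleC scaleR_conv_of_real)
  show "a *\<^sub>C r *\<^sub>R b = r *\<^sub>R a *\<^sub>C b" for r a and b :: 'h
    by (simp add: scaleR_scaleC scaleC_scaleC mult.commute)
  show "\<exists>K. \<forall>a (b :: 'h). norm (a *\<^sub>C b) \<le> norm a * norm b * K"
    by (rule exI[of _ 1]) (simp add: norm_scaleC)
qed (auto simp: scaleC_add_left scaleC_add_right)

section \<open>Bounded complex-linear operators\<close>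

lemma bounded_clinearD:
  assumes "bounded_clinear T"
  shows "bounded_linear T" "T (c *\<^sub>C x) = c *\<^sub>C T x" "T (x + y) = T x + T y" "T (x - y) = T x - T y"
    "T 0 = 0" "T (- x) = - T x" "T (r *\<^sub>R x) = r *\<^sub>R T x" "norm (T x) \<le> onorm T * norm x"
proof -
  show bl: "bounded_linear T" using assms unfolding bounded_clinear_def by blast
  interpret bounded_linear T by fact
  show "T (c *\<^sub>C x) = c *\<^sub>C T x" using assms unfolding bounded_clinear_def by blast
  show "T (x + y) = T x + T y" "T (x - y) = T x - T y" "T 0 = 0" "T (- x) = - T x"
    "T (r *\<^sub>R x) = r *\<^sub>R T x"
    by (fact add diff zero neg scaleR)+
  show "norm (T x) \<le> onorm T * norm x" by (rule onorm[OF bl])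
qed

lemma bounded_clinearI:
  assumes "\<And>x y. T (x + y) = T x + T y" "\<And>c x. T (c *\<^sub>C x) = c *\<^sub>C T x"
    "\<And>x. norm (T x) \<le> K * norm x"
  shows "bounded_clinear T"
  unfolding bounded_clinear_def
  using assms by (auto intro!: bounded_linear_intro[where K = K] simp: scaleR_scaleC mult.commute)

lemma bounded_clinear_id: "bounded_clinear id" "bounded_clinear (\<lambda>x. x)"
  by (rule bounded_clinearI[where K = 1]; simp)+

lemma bounded_clinear_zero: "bounded_clinear (\<lambda>x. 0)"
  by (rule bounded_clinearI[where K = 1]) auto

lemma bounded_clinear_comp: "bounded_clinear S \<Longrightarrow> bounded_clinear T \<Longrightarrow> bounded_clinear (S \<circ> T)"
  unfolding bounded_clinear_def using bounded_linear_compose[of S T] by (auto simp: o_def)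

lemma bounded_clinear_add: "bounded_clinear S \<Longrightarrow> bounded_clinear T \<Longrightarrow> bounded_clinear (\<lambda>x. S x + T x)"
  unfolding bounded_clinear_def by (auto intro: bounded_linear_add simp: scaleC_add_right)

lemma bounded_clinear_scaleC: "bounded_clinear T \<Longrightarrow> bounded_clinear (\<lambda>x. c *\<^sub>C T x)"
  unfolding bounded_clinear_def
  by (auto intro!: bounded_linear_compose[OF scaleC.bounded_linear_right] simp: scaleC_scaleC mult.commute)

lemma bounded_clinear_diff: "bounded_clinear S \<Longrightarrow> bounded_clinear T \<Longrightarrow> bounded_clinear (\<lambda>x. S x - T x)"
  unfolding bounded_clinear_def by (auto intro: bounded_linear_sub simp: scaleC.diff_right)

lemma bounded_clinear_sum:
  "(\<And>i. i \<in> I \<Longrightarrow> bounded_clinear (T i)) \<Longrightarrow> bounded_clinear (\<lambda>x. \<Sum>i\<in>I. T i x)"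
  by (induction I rule: infinite_finite_induct)
    (auto intro: bounded_clinear_zero bounded_clinear_add)

lemma bounded_clinear_rank1: "bounded_clinear (\<lambda>x. cinner x e *\<^sub>C f)"
  by (rule bounded_clinearI[where K = "norm e * norm f"])
    (auto simp: cinner_add_left scaleC_add_left cinner_scaleC_left scaleC_scaleC norm_scaleC
      intro!: order_trans[OF mult_right_mono[OF norm_cinner_le]])

lemma onorm_nonneg: "bounded_clinear T \<Longrightarrow> 0 \<le> onorm T"
  by (simp add: bounded_clinearD(1) onorm_pos_le)

text \<open>A minimising sequence for the distance from x to M is Cauchy by the parallelogram law,
  because midpoints of approximants lie in M again; completeness gives a nearest point. If the
  residual had a component along some n in M, moving the nearest point by that component would
  shorten the residual.\<close>

lemma ex_orthogonal_projection:
  fixes M :: "'h::complex_hilbert_space set"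
  assumes "scaleC.subspace M" "closed M"
  shows "\<exists>m\<in>M. \<forall>n\<in>M. cinner (x - m) n = 0"
proof -
  define d where "d = (INF m\<in>M. (norm (x - m))\<^sup>2)"
  have M0: "M \<noteq> {}" using scaleC.subspace_0[OF assms(1)] by auto
  have bdd: "bdd_below ((\<lambda>m. (norm (x - m))\<^sup>2) ` M)" by (rule bdd_belowI[of _ 0]) auto
  have dle: "d \<le> (norm (x - m))\<^sup>2" if "m \<in> M" for m
    unfolding d_def by (rule cINF_lower[OF bdd that])
  have "\<exists>m\<in>M. (norm (x - m))\<^sup>2 < d + inverse (Suc n)" for n
  proof (rule ccontr)
    assume "\<not> ?thesis"
    then have "d + inverse (Suc n) \<le> d" unfolding d_def
      by (intro cINF_greatest[OF M0]) (auto simp: not_less d_def)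
    then show False by (simp add: not_less)
  qed
  then obtain m where m: "\<And>n. m n \<in> M" "\<And>n. (norm (x - m n))\<^sup>2 < d + inverse (Suc n)" by metis
  have par: "(norm (m i - m j))\<^sup>2 \<le> 2 * inverse (Suc i) + 2 * inverse (Suc j)" for i j
  proof -
    let ?a = "x - m i" and ?b = "x - m j"
    have "(1/2 :: complex) *\<^sub>C (m i + m j) \<in> M"
      using assms(1) m(1) by (simp add: scaleC.subspace_add scaleC.subspace_scale)
    moreover have "?a + ?b = 2 *\<^sub>R (x - (1/2 :: complex) *\<^sub>C (m i + m j))"
      using scaleR_scaleC[of "1/2" "m i + m j", symmetric]
      by (simp add: algebra_simps scaleR_2)
    ultimately have 1: "4 * d \<le> (norm (?a + ?b))\<^sup>2"
      using dle by (simp add: power_mult_distrib)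
    have "(norm (?a + ?b))\<^sup>2 + (norm (?a + (- ?b)))\<^sup>2 = 2 * (norm ?a)\<^sup>2 + 2 * (norm ?b)\<^sup>2"
      unfolding norm_add_sq[of ?a ?b] norm_add_sq[of ?a "- ?b"] cinner.minus_right norm_minus_cancel by simp
    moreover have "norm (?a + (- ?b)) = norm (m i - m j)"
      using norm_minus_cancel[of "?a + (- ?b)"] by simp
    ultimately show ?thesis using 1 m(2)[of i] m(2)[of j] by simp
  qed
  have "Cauchy m"
  proof (rule metric_CauchyI)
    fix e :: real assume e: "e > 0"
    obtain N where N: "inverse (real (Suc N)) < e\<^sup>2 / 4" using e reals_Archimedean[of "e\<^sup>2/4"] by auto
    have "dist (m i) (m j) < e" if "i \<ge> N" "j \<ge> N" for i j
    proof -
      have "inverse (real (Suc i)) \<le> inverse (Suc N)" "inverse (real (Suc j)) \<le> inverse (Suc N)"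
        using that by (auto intro!: le_imp_inverse_le)
      then have "(norm (m i - m j))\<^sup>2 < e\<^sup>2" using par[of i j] N by linarith
      then show ?thesis using e by (simp add: dist_norm power2_less_imp_less)
    qed
    then show "\<exists>M. \<forall>i\<ge>M. \<forall>j\<ge>M. dist (m i) (m j) < e" by blast
  qed
  then obtain l where l: "m \<longlonglongrightarrow> l" using Cauchy_convergent convergent_def by blast
  have lM: "l \<in> M" using closed_sequentially[OF assms(2) m(1) l] .
  have "(norm (x - l))\<^sup>2 \<le> d + 0"
  proof (rule LIMSEQ_le)
    show "(\<lambda>n. (norm (x - m n))\<^sup>2) \<longlonglongrightarrow> (norm (x - l))\<^sup>2" by (intro tendsto_intros l)
    show "(\<lambda>n. d + inverse (real (Suc n))) \<longlonglongrightarrow> d + 0" by (intro tendsto_intros LIMSEQ_inverse_real_of_nat)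
    show "\<exists>N. \<forall>n\<ge>N. (norm (x - m n))\<^sup>2 \<le> d + inverse (real (Suc n))" using m(2) less_imp_le by blast
  qed
  then have ld: "(norm (x - l))\<^sup>2 \<le> d" by simp
  have "cinner (x - l) n = 0" if n: "n \<in> M" for n
  proof (rule ccontr)
    assume a: "cinner (x - l) n \<noteq> 0"
    then have ny: "norm n > 0" by auto
    define t where "t = cinner (x - l) n / of_real ((norm n)\<^sup>2)"
    have "l + t *\<^sub>C n \<in> M" using lM n assms(1) by (simp add: scaleC.subspace_add scaleC.subspace_scale)
    then have "(norm (x - l))\<^sup>2 \<le> (norm ((x - l) + (- t) *\<^sub>C n))\<^sup>2" using ld dle[of "l + t *\<^sub>C n"]
      by (simp add: scaleC.minus_left diff_diff_eq del: power_mono_iff)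
    also have "\<dots> = (norm (x - l))\<^sup>2 + (norm ((- t) *\<^sub>C n))\<^sup>2 + 2 * Re (cinner (x - l) ((- t) *\<^sub>C n))"
      by (rule norm_add_sq)
    also have "(norm ((- t) *\<^sub>C n))\<^sup>2 = (cmod (cinner (x - l) n))\<^sup>2 / (norm n)\<^sup>2"
      using ny by (simp add: norm_scaleC t_def norm_divide norm_power power_mult_distrib power_divide field_simps power2_eq_square norm_mult)
    also have "cinner (x - l) ((- t) *\<^sub>C n) = - of_real ((cmod (cinner (x - l) n))\<^sup>2 / (norm n)\<^sup>2)"
      unfolding cinner_scaleC_right t_def of_real_divide complex_norm_square[of "cinner (x - l) n"]
      by (simp add: mult.commute)
    finally have "(cmod (cinner (x - l) n))\<^sup>2 / (norm n)\<^sup>2 \<le> 0" by simp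
    then show False using a ny by (simp add: divide_le_0_iff)
  qed
  then show ?thesis using lM by blast
qed

text \<open>The kernel of f is closed; let \<open>z\<close> be the residual of a point outside it.
  Then \<open>f w *\<^sub>C z - f z *\<^sub>C w\<close> lies in the kernel and is therefore
  orthogonal to \<open>z\<close>, and this equation can be solved for \<open>f w\<close>.\<close>

lemma riesz_representation:
  fixes f :: "'h::complex_hilbert_space \<Rightarrow> complex"
  assumes "bounded_linear f" "\<And>c x. f (c *\<^sub>C x) = c * f x"
  shows "\<exists>z. \<forall>x. f x = cinner x z"
proof (cases "\<forall>x. f x = 0")
  case False
  interpret f: bounded_linear f by fact
  obtain x where x: "f x \<noteq> 0" using False by auto
  define M where "M = {x. f x = 0}"
  have "scaleC.subspace M" unfolding scaleC.subspace_def M_def by (auto simp: f.add assms(2) f.zero)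
  moreover have "closed M" unfolding M_def
    by (intro closed_Collect_eq continuous_intros f.continuous_on)
  ultimately obtain m where m: "m \<in> M" "\<And>n. n \<in> M \<Longrightarrow> cinner (x - m) n = 0"
    using ex_orthogonal_projection by blast
  define z where "z = x - m"
  have fz: "f z = f x" using m(1) by (simp add: z_def f.diff M_def)
  then have z0: "norm z \<noteq> 0" using x f.zero by auto
  have "f w = cinner w ((cnj (f z) / of_real ((norm z)\<^sup>2)) *\<^sub>C z)" for w
  proof -
    have "f w *\<^sub>C z - f z *\<^sub>C w \<in> M" by (simp add: M_def f.diff assms(2) mult.commute)
    then have "cinner z (f w *\<^sub>C z - f z *\<^sub>C w) = 0" using m(2) z_def by blast
    then have "cnj (f w) * of_real ((norm z)\<^sup>2) = cnj (f z) * cinner z w"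
      by (simp add: cinner.diff_right cinner_scaleC_right cinner_self)
    then have "f w * of_real ((norm z)\<^sup>2) = f z * cinner w z"
      by (metis cinner_commute complex_cnj_cnj complex_cnj_complex_of_real complex_cnj_mult)
    then show ?thesis using z0 by (simp add: cinner_scaleC_right field_simps)
  qed
  then show ?thesis by blast
qed (auto intro: exI[of _ 0])

section \<open>Adjoints\<close>

lemma cinner_eqI: "(\<And>y. cinner y x = cinner y x') \<Longrightarrow> x = (x' :: 'h::complex_hilbert_space)"
proof -
  assume "\<And>y. cinner y x = cinner y x'"
  then have "cinner (x - x') (x - x') = 0" by (simp add: cinner.diff_right)
  then show "x = x'" by (simp add: cinner_self)
qed

lemma ex1_adjoint:
  fixes T :: "'h::complex_hilbert_space \<Rightarrow> 'h"
  assumes "bounded_clinear T"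
  shows "\<exists>!S. \<forall>x y. cinner (T x) y = cinner x (S y)"
proof -
  have "\<exists>z. \<forall>x. cinner (T x) y = cinner x z" for y
    by (rule riesz_representation)
      (auto intro!: bounded_linear_compose[OF cinner.bounded_linear_left]
        simp: bounded_clinearD[OF assms] cinner_scaleC_left)
  then obtain S where "\<And>y x. cinner (T x) y = cinner x (S y)" by metis
  then have S: "\<forall>x y. cinner (T x) y = cinner x (S y)" by blast
  show ?thesis
  proof (rule ex1I)
    show "\<forall>x y. cinner (T x) y = cinner x (S y)" by (fact S)
  next
    fix S' assume "\<forall>x y. cinner (T x) y = cinner x (S' y)"
    then have "cinner x (S' y) = cinner x (S y)" for x y using S by metis
    then show "S' = S" by (intro ext cinner_eqI)
  qed
qed

lemma cinner_cadjoint: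
  "bounded_clinear T \<Longrightarrow> cinner (T x) y = cinner x (cadjoint T y)"
  using theI'[OF ex1_adjoint[of T]] unfolding cadjoint_def by blast

lemma cadjoint_unique:
  "bounded_clinear T \<Longrightarrow> (\<And>x y. cinner (T x) y = cinner x (S y)) \<Longrightarrow> cadjoint T = S"
  unfolding cadjoint_def by (rule the1_equality[OF ex1_adjoint]) auto

lemma bounded_clinear_cadjoint:
  fixes T :: "'h::complex_hilbert_space \<Rightarrow> 'h"
  assumes T: "bounded_clinear T" and le: "\<And>x. norm (T x) \<le> K * norm x"
  shows "bounded_clinear (cadjoint T)" "norm (cadjoint T x) \<le> K * norm x"
proof -
  note adj = cinner_cadjoint[OF T, symmetric]
  have n: "norm (cadjoint T x) \<le> K * norm x" for x
  proof -
    let ?y = "cadjoint T x"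
    have "(norm ?y)\<^sup>2 = Re (cinner (T ?y) x)" by (simp add: Re_cinner_self[symmetric] adj)
    also have "\<dots> \<le> norm (T ?y) * norm x"
      using norm_cinner_le complex_Re_le_cmod order_trans by blast
    also have "\<dots> \<le> (K * norm ?y) * norm x" by (rule mult_right_mono[OF le]) simp
    finally have "norm ?y * norm ?y \<le> norm ?y * (K * norm x)" by (simp add: power2_eq_square mult_ac)
    \<comment> \<open>\<open>K\<close> is not assumed nonnegative; the sign of the product is read
      off from the bound on \<open>T x\<close>.\<close>
    moreover have "0 \<le> K * norm x"
    proof (cases "x = 0")
      case False
      then have "0 \<le> K * norm x" using le[of x] norm_ge_zero order_trans by blast
      then show ?thesis .
    qed simp
    ultimately show ?thesis by (cases "?y = 0") auto
  qed
  show "norm (cadjoint T x) \<le> K * norm x" by (rule n)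
  show "bounded_clinear (cadjoint T)"
  proof (rule bounded_clinearI[OF _ _ n])
    show "cadjoint T (x + y) = cadjoint T x + cadjoint T y" for x y
      by (rule cinner_eqI) (simp add: adj cinner_add_right)
    show "cadjoint T (c *\<^sub>C x) = c *\<^sub>C cadjoint T x" for c x
      by (rule cinner_eqI) (simp add: adj cinner_scaleC_right)
  qed
qed

subsection \<open>Orthonormal bases\<close>

definition orthonormal :: "'h::complex_hilbert_space set \<Rightarrow> bool" where
  "orthonormal E \<longleftrightarrow> (\<forall>e\<in>E. \<forall>f\<in>E. cinner e f = (if e = f then 1 else 0))"

text \<open>Zorn's lemma yields a maximal orthonormal set. Were some x outside its closed span, the
  normalised residual from the nearest point of that span would be orthogonal to the set and could
  be added to it.\<close>

lemma ex_orthonormal_basis: "\<exists>E :: 'h::complex_hilbert_space set. orthonormal_basis E"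
proof -
  have "\<exists>E\<in>Collect orthonormal. \<forall>X\<in>Collect orthonormal. E \<subseteq> X \<longrightarrow> X = (E :: 'h set)"
  proof (rule subset_Zorn)
    fix C :: "'h set set" assume C: "subset.chain (Collect orthonormal) C"
    have "orthonormal (\<Union>C)" unfolding orthonormal_def
    proof (intro ballI)
      fix e f assume "e \<in> \<Union>C" "f \<in> \<Union>C"
      then obtain X Y where XY: "X \<in> C" "e \<in> X" "Y \<in> C" "f \<in> Y" by blast
      then have "X \<subseteq> Y \<or> Y \<subseteq> X" using C unfolding subset_chain_def by blast
      then obtain X where "X \<in> C" "e \<in> X" "f \<in> X" using XY by blast
      then show "cinner e f = (if e = f then 1 else 0)"
        using C unfolding subset_chain_def orthonormal_def by blast
    qed
    then show "\<exists>U\<in>Collect orthonormal. \<forall>X\<in>C. X \<subseteq> U" by blast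
  qed
  then obtain E :: "'h set" where E: "orthonormal E" "\<And>X. orthonormal X \<Longrightarrow> E \<subseteq> X \<Longrightarrow> X = E" by auto
  have "x \<in> closure (scaleC.span E)" for x
  proof -
    let ?M = "closure (scaleC.span E)"
    have sub: "scaleC.subspace ?M"
    proof (rule scaleC.subspaceI)
      show "0 \<in> ?M" using closure_subset scaleC.span_zero by blast
      fix x y assume "x \<in> ?M" "y \<in> ?M"
      then obtain a b where "\<And>n. a n \<in> scaleC.span E" "a \<longlonglongrightarrow> x" "\<And>n. b n \<in> scaleC.span E" "b \<longlonglongrightarrow> y"
        unfolding closure_sequential by auto
      then show "x + y \<in> ?M" unfolding closure_sequential
        by (intro exI[of _ "\<lambda>n. a n + b n"]) (auto intro: tendsto_add scaleC.span_add)
    next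
      fix c x assume "x \<in> ?M"
      then obtain a where "\<And>n. a n \<in> scaleC.span E" "a \<longlonglongrightarrow> x"
        unfolding closure_sequential by auto
      then show "c *\<^sub>C x \<in> ?M" unfolding closure_sequential
        by (intro exI[of _ "\<lambda>n. c *\<^sub>C a n"]) (auto intro!: scaleC.tendsto scaleC.span_scale)
    qed
    then obtain m where m: "m \<in> ?M" "\<And>n. n \<in> ?M \<Longrightarrow> cinner (x - m) n = 0"
      using ex_orthogonal_projection[OF sub closed_closure, of x] by blast
    have "x = m"
    proof (rule ccontr)
      assume ne: "x \<noteq> m"
      define f where "f = inverse (norm (x - m)) *\<^sub>R (x - m)"
      have f1: "cinner f f = 1" using ne by (simp add: cinner_self f_def)
      have f0: "cinner f e = 0" if "e \<in> E" for e
        using m(2)[of e] that closure_subset scaleC.span_base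
        unfolding f_def cinner_scaleR_left by (metis scaleR_zero_right subsetD)
      then have f0': "cinner e f = 0" if "e \<in> E" for e using that
        by (metis cinner_commute complex_cnj_zero)
      have "orthonormal (insert f E)" using E(1) f0 f0' f1 unfolding orthonormal_def by auto
      then have "f \<in> E" using E(2) by blast
      then show False using f0 f1 by force
    qed
    then show ?thesis using m by simp
  qed
  then show ?thesis using E(1) unfolding orthonormal_basis_def orthonormal_def by (intro exI[of _ E]) auto
qed

text \<open>The same choice as inside \<open>pos_trace\<close>, so that the trace is literally a sum
  over \<open>onb\<close>.\<close>

definition onb :: "'h::complex_hilbert_space set" where
  "onb = (SOME E. orthonormal_basis E)"

lemma orthonormal_basis_onb: "orthonormal_basis onb"
  unfolding onb_def by (rule someI_ex[OF ex_orthonormal_basis])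

lemma onb_cinner: "e \<in> onb \<Longrightarrow> f \<in> onb \<Longrightarrow> cinner e f = (if e = f then 1 else 0)"
  using orthonormal_basis_onb unfolding orthonormal_basis_def by blast

lemma closure_span_onb: "closure (scaleC.span onb) = UNIV"
  using orthonormal_basis_onb unfolding orthonormal_basis_def by blast

lemma norm_onb: "e \<in> onb \<Longrightarrow> norm e = 1"
  using onb_cinner[of e e] by (simp add: norm_eq_sqrt_cinner)

definition onb_proj :: "'h set \<Rightarrow> 'h \<Rightarrow> 'h::complex_hilbert_space" where
  "onb_proj B x = (\<Sum>e\<in>B. cinner x e *\<^sub>C e)"

lemma bounded_clinear_onb_proj: "bounded_clinear (onb_proj B)"
  unfolding onb_proj_def by (intro bounded_clinear_sum bounded_clinear_rank1)

lemma cinner_onb_proj: "B \<subseteq> onb \<Longrightarrow> finite B \<Longrightarrow> e \<in> onb \<Longrightarrow>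
    cinner (onb_proj B x) e = (if e \<in> B then cinner x e else 0)"
proof -
  assume a: "B \<subseteq> onb" "finite B" "e \<in> onb"
  have "cinner (onb_proj B x) e = (\<Sum>f\<in>B. cinner x f * (if f = e then 1 else 0))"
    unfolding onb_proj_def cinner.sum_left cinner_scaleC_left
    by (rule sum.cong) (use a in \<open>auto simp: onb_cinner subsetD\<close>)
  then show ?thesis using a by (simp add: sum.delta if_distrib cong: if_cong)
qed

lemma norm_onb_proj:
  assumes "B \<subseteq> onb" "finite B"
  shows "cinner (onb_proj B x) (onb_proj B x) = of_real (\<Sum>e\<in>B. (cmod (cinner x e))\<^sup>2)"
    "cinner (onb_proj B x) x = of_real (\<Sum>e\<in>B. (cmod (cinner x e))\<^sup>2)"
    "(norm (x - onb_proj B x))\<^sup>2 = (norm x)\<^sup>2 - (\<Sum>e\<in>B. (cmod (cinner x e))\<^sup>2)"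
proof -
  let ?P = "onb_proj B x" and ?s = "\<Sum>e\<in>B. (cmod (cinner x e))\<^sup>2"
  have "cinner ?P ?P = (\<Sum>e\<in>B. cnj (cinner x e) * cinner ?P e)"
    by (subst (2) onb_proj_def) (simp add: cinner.sum_right cinner_scaleC_right)
  also have "\<dots> = of_real ?s" unfolding of_real_sum
    by (rule sum.cong) (use assms in \<open>auto simp only: cinner_onb_proj complex_norm_square subsetD mult.commute if_True\<close>)
  finally show 1: "cinner ?P ?P = of_real ?s" .
  show 2: "cinner ?P x = of_real ?s"
    unfolding onb_proj_def cinner.sum_left cinner_scaleC_left of_real_sum
    by (rule sum.cong) (use cinner_commute[of _ x] in \<open>auto simp only: complex_norm_square\<close>)
  have "cinner x ?P = of_real ?s" using 2 by (metis cinner_commute complex_cnj_complex_of_real)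
  moreover have "(norm ?P)\<^sup>2 = ?s" using 1 unfolding cinner_self of_real_eq_iff .
  ultimately show "(norm (x - ?P))\<^sup>2 = (norm x)\<^sup>2 - ?s"
    using norm_add_sq[of x "- ?P"] by (simp only: cinner.minus_right norm_minus_cancel) simp
qed

lemma bessel: "B \<subseteq> onb \<Longrightarrow> finite B \<Longrightarrow> (\<Sum>e\<in>B. (cmod (cinner x e))\<^sup>2) \<le> (norm x)\<^sup>2"
  using norm_onb_proj(3)[of B x] zero_le_power2[of "norm (x - onb_proj B x)"] by linarith

lemma norm_onb_proj_le: "B \<subseteq> onb \<Longrightarrow> finite B \<Longrightarrow> norm (onb_proj B x) \<le> norm x"
proof -
  assume a: "B \<subseteq> onb" "finite B"
  have "(norm (onb_proj B x))\<^sup>2 \<le> (norm x)\<^sup>2"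
    using norm_onb_proj(1)[OF a, of x] bessel[OF a] unfolding cinner_self of_real_eq_iff by simp
  then show ?thesis by (rule power2_le_imp_le) simp
qed

lemma span_onb_proj: "finite B \<Longrightarrow> B \<subseteq> onb \<Longrightarrow> x \<in> scaleC.span B \<Longrightarrow> onb_proj B x = x"
proof -
  assume a: "finite B" "B \<subseteq> onb" "x \<in> scaleC.span B"
  have "scaleC.span B \<subseteq> {x. onb_proj B x = x}"
  proof (rule scaleC.span_minimal)
    show "B \<subseteq> {x. onb_proj B x = x}"
    proof
      fix f assume "f \<in> B"
      then have "onb_proj B f = (\<Sum>e\<in>B. (if e = f then 1 else 0) *\<^sub>C e)"
        unfolding onb_proj_def by (intro sum.cong) (use a \<open>f \<in> B\<close> in \<open>auto simp: onb_cinner subsetD\<close>)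
      also have "\<dots> = (\<Sum>e\<in>B. if e = f then f else 0)" by (rule sum.cong) (auto)
      also have "\<dots> = f" using a \<open>f \<in> B\<close> by simp
      finally show "f \<in> {x. onb_proj B x = x}" by simp
    qed
    show "scaleC.subspace {x. onb_proj B x = x}"
      using bounded_clinearD[OF bounded_clinear_onb_proj[of B]] by (auto simp: scaleC.subspace_def)
  qed
  then show ?thesis using a by blast
qed

text \<open>A vector of the span close to x lies in the span of a finite F, hence is fixed by the
  projection onto any larger G. Asserting the bound for every finite G above F lets finitely many
  vectors share one index set later.\<close>

lemma parseval_approx:
  assumes "\<epsilon> > 0"
  shows "\<exists>F. finite F \<and> F \<subseteq> onb \<and> (\<forall>G. finite G \<longrightarrow> F \<subseteq> G \<longrightarrow> G \<subseteq> onb \<longrightarrow>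
    (norm x)\<^sup>2 - \<epsilon> \<le> (\<Sum>e\<in>G. (cmod (cinner x e))\<^sup>2))"
proof -
  have "x \<in> closure (scaleC.span onb)" using closure_span_onb by blast
  then obtain y where y: "y \<in> scaleC.span onb" "dist y x < sqrt \<epsilon> / 2"
    using assms unfolding closure_approachable by (meson half_gt_zero real_sqrt_gt_zero)
  obtain F where F: "finite F" "F \<subseteq> onb" "y \<in> scaleC.span F"
    using y(1) unfolding scaleC.span_explicit[of onb]
    by (auto intro!: that scaleC.span_sum scaleC.span_scale intro: scaleC.span_base)
  have "(norm x)\<^sup>2 - \<epsilon> \<le> (\<Sum>e\<in>G. (cmod (cinner x e))\<^sup>2)" if G: "finite G" "F \<subseteq> G" "G \<subseteq> onb" for G
  proof -
    have yP: "onb_proj G y = y" using G F scaleC.span_mono[OF G(2)] by (intro span_onb_proj) auto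
    have "norm (x - onb_proj G x) = norm ((x - y) - onb_proj G (x - y))"
      by (simp add: bounded_clinearD(4)[OF bounded_clinear_onb_proj] yP)
    also have "\<dots> \<le> norm (x - y) + norm (x - y)"
      using norm_triangle_ineq4[of "x - y" "onb_proj G (x - y)"] norm_onb_proj_le[OF G(3,1), of "x - y"] by linarith
    finally have "norm (x - onb_proj G x) \<le> norm (x - y) + norm (x - y)" .
    also have "\<dots> \<le> sqrt \<epsilon>" using y(2) by (simp add: dist_norm norm_minus_commute)
    finally have "(norm (x - onb_proj G x))\<^sup>2 \<le> \<epsilon>" using assms
      by (metis norm_ge_zero power_mono real_sqrt_pow2 less_imp_le)
    then show ?thesis using norm_onb_proj(3)[OF G(3,1), of x] by simp
  qed
  then show ?thesis using F by blast
qed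

lemma infinite_onb:
  assumes "\<nexists>B :: 'h::complex_hilbert_space set. finite B \<and> scaleC.span B = UNIV"
  shows "infinite (onb :: 'h set)"
proof
  assume fin: "finite (onb :: 'h set)"
  have "x \<in> scaleC.span onb" for x :: 'h
  proof -
    have "(norm x)\<^sup>2 - \<epsilon> \<le> (\<Sum>e\<in>onb. (cmod (cinner x e))\<^sup>2)" if "\<epsilon> > 0" for \<epsilon>
      using parseval_approx[OF that, of x] fin by blast
    then have "(norm x)\<^sup>2 \<le> (\<Sum>e\<in>onb. (cmod (cinner x e))\<^sup>2)"
      by (meson field_le_epsilon diff_le_eq)
    then have "(norm (x - onb_proj onb x))\<^sup>2 \<le> 0" using norm_onb_proj(3)[of onb x] fin by simp
    then have "x = onb_proj onb x" by simp
    then show ?thesis unfolding onb_proj_def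
      by (metis (no_types, lifting) scaleC.span_base scaleC.span_scale scaleC.span_sum)
  qed
  then show False using assms fin by blast
qed

section \<open>Functional calculus of positive operators\<close>

text \<open>Complex coefficients make it possible to split off linear factors;
  \<open>poly_op\<close> is treated as the case of real coefficients.\<close>

definition cpoly_op :: "complex poly \<Rightarrow> ('h::complex_hilbert_space \<Rightarrow> 'h) \<Rightarrow> ('h \<Rightarrow> 'h)" where
  "cpoly_op q T = (\<lambda>x. \<Sum>i\<le>degree q. coeff q i *\<^sub>C (T ^^ i) x)"

lemma cpoly_op_eq:
  "degree q \<le> n \<Longrightarrow> cpoly_op q T x = (\<Sum>i\<le>n. coeff q i *\<^sub>C (T ^^ i) x)"
  unfolding cpoly_op_def by (rule sum.mono_neutral_left) (auto simp: coeff_eq_0)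

lemma cpoly_op_0 [simp]: "cpoly_op 0 T x = 0"
  by (simp add: cpoly_op_def)

lemma cpoly_op_pCons: "cpoly_op (pCons a q) T x = a *\<^sub>C x + cpoly_op q T (T x)"
proof -
  have "cpoly_op (pCons a q) T x = (\<Sum>i\<le>Suc (degree q). coeff (pCons a q) i *\<^sub>C (T ^^ i) x)"
    by (rule cpoly_op_eq) (rule degree_pCons_le)
  also have "\<dots> = a *\<^sub>C x + (\<Sum>i\<le>degree q. coeff q i *\<^sub>C (T ^^ i) (T x))"
    by (subst sum.atMost_Suc_shift) (simp add: funpow_swap1)
  finally show ?thesis by (simp add: cpoly_op_def)
qed

lemma cpoly_op_add: "cpoly_op (p + q) T x = cpoly_op p T x + cpoly_op q T x"
proof -
  let ?n = "max (degree p) (degree q)"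
  have "degree (p + q) \<le> ?n" by (rule degree_add_le) auto
  then show ?thesis
    by (simp add: cpoly_op_eq[of _ ?n] scaleC_add_left sum.distrib)
qed

lemma cpoly_op_smult: "cpoly_op (smult c q) T x = c *\<^sub>C cpoly_op q T x"
  by (simp add: cpoly_op_eq[of _ "degree q"] degree_smult_le scaleC.scale_sum_right)

lemma bounded_clinear_funpow: "bounded_clinear T \<Longrightarrow> bounded_clinear (T ^^ n)"
  by (induction n) (auto intro: bounded_clinear_id bounded_clinear_comp)

lemma bounded_clinear_cpoly_op: "bounded_clinear T \<Longrightarrow> bounded_clinear (cpoly_op q T)"
  unfolding cpoly_op_def
  by (intro bounded_clinear_sum bounded_clinear_scaleC bounded_clinear_funpow)

lemma cpoly_op_commute: "bounded_clinear T \<Longrightarrow> cpoly_op q T (T x) = T (cpoly_op q T x)"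
  by (induction q arbitrary: x) (simp_all add: cpoly_op_pCons bounded_clinearD)

lemma cpoly_op_mult:
  "bounded_clinear T \<Longrightarrow> cpoly_op (p * q) T x = cpoly_op p T (cpoly_op q T x)"
  by (induction p arbitrary: x)
    (simp_all add: cpoly_op_pCons cpoly_op_add cpoly_op_smult cpoly_op_commute)

lemma degree_map_poly_of_real: "degree (map_poly complex_of_real q) = degree q"
  by (rule degree_map_poly) simp

lemma poly_op_eq_cpoly_op: "poly_op q T = cpoly_op (map_poly complex_of_real q) T"
  by (simp add: poly_op_def cpoly_op_def degree_map_poly_of_real coeff_map_poly scaleR_scaleC)

lemma map_poly_of_real_hom:
  "map_poly complex_of_real (p + q) = map_poly complex_of_real p + map_poly complex_of_real q"
  "map_poly complex_of_real (p - q) = map_poly complex_of_real p - map_poly complex_of_real q"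
  "map_poly complex_of_real (p * q) = map_poly complex_of_real p * map_poly complex_of_real q"
  "map_poly complex_of_real (smult c q) = smult (complex_of_real c) (map_poly complex_of_real q)"
  by (rule poly_eqI; simp add: coeff_map_poly coeff_mult)+

lemma poly_map_poly_of_real:
  "poly (map_poly complex_of_real q) (complex_of_real t) = complex_of_real (poly q t)"
  by (induction q) (simp_all add: map_poly_pCons)

lemma poly_op_pCons: "poly_op (pCons a q) T x = a *\<^sub>R x + poly_op q T (T x)"
  by (simp add: poly_op_eq_cpoly_op map_poly_pCons cpoly_op_pCons scaleR_scaleC)

lemma poly_op_0 [simp]: "poly_op 0 T x = 0"
  by (simp add: poly_op_eq_cpoly_op)

lemma poly_op_add: "poly_op (p + q) T x = poly_op p T x + poly_op q T x"
  by (simp add: poly_op_eq_cpoly_op map_poly_of_real_hom cpoly_op_add)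

lemma poly_op_smult: "poly_op (smult c q) T x = c *\<^sub>R poly_op q T x"
  by (simp add: poly_op_eq_cpoly_op map_poly_of_real_hom cpoly_op_smult scaleR_scaleC)

lemma poly_op_diff: "poly_op (p - q) T x = poly_op p T x - poly_op q T x"
  using poly_op_add[of p "smult (-1) q" T x] poly_op_smult[of "-1" q T x] by simp

lemma bounded_clinear_poly_op: "bounded_clinear T \<Longrightarrow> bounded_clinear (poly_op q T)"
  by (simp add: poly_op_eq_cpoly_op bounded_clinear_cpoly_op)

lemma poly_op_mult: "bounded_clinear T \<Longrightarrow> poly_op (p * q) T x = poly_op p T (poly_op q T x)"
  by (simp add: poly_op_eq_cpoly_op map_poly_of_real_hom cpoly_op_mult)

lemma poly_op_eigenvector:
  "bounded_clinear T \<Longrightarrow> T e = d *\<^sub>R e \<Longrightarrow> poly_op q T e = poly q d *\<^sub>R e"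
  by (induction q) (simp_all add: poly_op_pCons bounded_clinearD(7)[OF bounded_clinear_poly_op]
    scaleR_add_left mult.commute)

section \<open>Positive operators and their spectral bounds\<close>

lemma positive_opD:
  assumes "positive_op A"
  shows "bounded_clinear A" "0 \<le> Re (cinner (A x) x)" "Im (cinner (A x) x) = 0"
  using assms unfolding positive_op_def by (auto simp: complex_nonneg_Reals_iff)

lemma positive_opI:
  "bounded_clinear A \<Longrightarrow> (\<And>x. 0 \<le> Re (cinner (A x) x)) \<Longrightarrow> (\<And>x. Im (cinner (A x) x) = 0) \<Longrightarrow> positive_op A"
  unfolding positive_op_def by (auto simp: complex_nonneg_Reals_iff)

text \<open>Polarisation: the quadratic form is real at x + y and at x + i y, which settles the
  imaginary and the real part.\<close>

lemma positive_op_symmetric: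
  assumes "positive_op A"
  shows "cinner (A x) y = cinner x (A y)"
proof -
  note A = bounded_clinearD[OF positive_opD(1)[OF assms]]
  have 1: "Im (cinner (A x) y) + Im (cinner (A y) x) = 0"
    using positive_opD(3)[OF assms, of "x + y"] positive_opD(3)[OF assms, of x] positive_opD(3)[OF assms, of y]
    by (simp add: A cinner_add_left cinner_add_right)
  have 2: "Re (cinner (A y) x) = Re (cinner (A x) y)"
    using positive_opD(3)[OF assms, of "x + \<i> *\<^sub>C y"] positive_opD(3)[OF assms, of x] positive_opD(3)[OF assms, of y]
    by (simp add: A cinner_add_left cinner_add_right cinner_scaleC_left cinner_scaleC_right)
  have "cinner (A x) y = cnj (cinner (A y) x)" using 1 2 by (simp add: complex_eq_iff)
  then show ?thesis using cinner_commute[of x "A y"] by simp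
qed

lemma symmetric_Im: "(\<And>x y. cinner (A x) y = cinner x (A y)) \<Longrightarrow> Im (cinner (A x) (x :: 'h::complex_hilbert_space)) = 0"
  by (metis Reals_cnj_iff cinner_commute complex_is_Real_iff)

lemma poly_op_symmetric:
  assumes "positive_op A"
  shows "cinner (poly_op q A x) y = cinner x (poly_op q A y)"
proof (induction q arbitrary: x y)
  case (pCons a q)
  have "poly_op q A (A y) = A (poly_op q A y)"
    using cpoly_op_commute[OF positive_opD(1)[OF assms]] by (simp add: poly_op_eq_cpoly_op)
  then show ?case
    by (simp add: poly_op_pCons cinner_add_left cinner_add_right cinner_scaleR_left
        cinner_scaleR_right pCons positive_op_symmetric[OF assms])
qed simp

text \<open>A scalar with nonzero imaginary part or negative real part has positive distance from
  the numerical range of \<open>A\<close>, and a real scalar above the norm is handled by the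
  triangle inequality. The lower bound stands in for the statement that r is not in the
  spectrum.\<close>

lemma positive_op_minus_scalar_bounded_below:
  assumes A: "positive_op A" and r: "r \<notin> complex_of_real ` {0..onorm A}"
  shows "\<exists>\<delta>>0. \<forall>x. \<delta> * norm x \<le> norm (A x - r *\<^sub>C x)"
proof -
  have ge: "c * norm x \<le> norm (A x - r *\<^sub>C x)" if "c * (norm x)\<^sup>2 \<le> cmod (cinner (A x - r *\<^sub>C x) x)" for c x
  proof (cases "x = 0")
    case False
    have "c * norm x * norm x \<le> norm (A x - r *\<^sub>C x) * norm x"
      using that norm_cinner_le[of "A x - r *\<^sub>C x" x] by (simp add: power2_eq_square mult.assoc)
    then show ?thesis using False by simp
  qed simp
  have e: "cinner (A x - r *\<^sub>C x) x = cinner (A x) x - r * of_real ((norm x)\<^sup>2)" for x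
    by (simp add: cinner.diff_left cinner_scaleC_left cinner_self)
  consider "Im r \<noteq> 0" | "Im r = 0" "Re r < 0" | "Im r = 0" "Re r > onorm A"
  proof -
    have "Im r = 0 \<Longrightarrow> \<not> (0 \<le> Re r \<and> Re r \<le> onorm A)"
      using r by (auto simp: image_iff complex_eq_iff)
    then show ?thesis using that by linarith
  qed
  then show ?thesis
  proof cases
    case 1
    have "\<bar>Im r\<bar> * (norm x)\<^sup>2 \<le> cmod (cinner (A x - r *\<^sub>C x) x)" for x
    proof -
      have "\<bar>Im (cinner (A x - r *\<^sub>C x) x)\<bar> = \<bar>Im r\<bar> * (norm x)\<^sup>2"
        unfolding e using positive_opD(3)[OF A, of x] by (simp add: abs_mult flip: of_real_power)
      then show ?thesis using abs_Im_le_cmod by metis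
    qed
    then show ?thesis using 1 ge by (intro exI[of _ "\<bar>Im r\<bar>"]) auto
  next
    case 2
    have "- Re r * (norm x)\<^sup>2 \<le> cmod (cinner (A x - r *\<^sub>C x) x)" for x
    proof -
      have "- Re r * (norm x)\<^sup>2 \<le> Re (cinner (A x - r *\<^sub>C x) x)"
        unfolding e using positive_opD(2)[OF A, of x] by (simp flip: of_real_power)
      then show ?thesis using complex_Re_le_cmod order_trans by blast
    qed
    then have "\<forall>x. - Re r * norm x \<le> norm (A x - r *\<^sub>C x)" using ge by blast
    then show ?thesis using 2 by (intro exI[of _ "- Re r"] conjI) auto
  next
    case 3
    have "(Re r - onorm A) * norm x \<le> norm (A x - r *\<^sub>C x)" for x
    proof -
      have "norm (r *\<^sub>C x) - norm (A x) \<le> norm (A x - r *\<^sub>C x)"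
        by (metis norm_minus_commute norm_triangle_ineq2)
      moreover have "Re r * norm x \<le> norm (r *\<^sub>C x)"
        unfolding norm_scaleC by (rule mult_right_mono[OF complex_Re_le_cmod]) simp
      ultimately show ?thesis using bounded_clinearD(8)[OF positive_opD(1)[OF A], of x]
        by (simp add: left_diff_distrib)
    qed
    then show ?thesis using 3 by (intro exI[of _ "Re r - onorm A"]) auto
  qed
qed

text \<open>Induction on the degree: the fundamental theorem of algebra splits off a root, which by
  assumption is outside the interval, and the lower bounds of the linear factor and of the cofactor
  multiply. Only lower bounds occur, never an inverse operator.\<close>

lemma cpoly_op_bounded_below:
  assumes A: "positive_op A"
  shows "(\<And>t. t \<in> {0..onorm A} \<Longrightarrow> poly q (complex_of_real t) \<noteq> 0) \<Longrightarrow>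
    \<exists>\<delta>>0. \<forall>x. \<delta> * norm x \<le> norm (cpoly_op q A x)"
proof (induction "degree q" arbitrary: q)
  case 0
  then obtain c where c: "q = [:c:]" using degree_eq_zeroE by metis
  have "c \<noteq> 0" using 0(2)[of 0] onorm_nonneg[OF positive_opD(1)[OF A]] c by auto
  then show ?case using c by (intro exI[of _ "cmod c"]) (auto simp: cpoly_op_pCons norm_scaleC)
next
  case (Suc n)
  have "\<not> constant (poly q)" using Suc(2) by (simp add: constant_degree)
  then obtain r where "poly q r = 0" using fundamental_theorem_of_algebra by blast
  then obtain q' where q': "q = [:- r, 1:] * q'" by (auto simp: poly_eq_0_iff_dvd)
  have q0: "q' \<noteq> 0" using Suc(2) q' by auto
  have "degree q = Suc (degree q')" unfolding q' using q0 by (subst degree_mult_eq) auto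
  then have d: "n = degree q'" using Suc(2) by simp
  have "poly q' (complex_of_real t) \<noteq> 0" if "t \<in> {0..onorm A}" for t
    using Suc(3)[OF that] unfolding q' by auto
  then obtain \<delta> where \<delta>: "\<delta> > 0" "\<And>x. \<delta> * norm x \<le> norm (cpoly_op q' A x)"
    using Suc(1)[OF d] by blast
  have "r \<notin> complex_of_real ` {0..onorm A}" using Suc(3) \<open>poly q r = 0\<close> by blast
  then obtain \<eta> where \<eta>: "\<eta> > 0" "\<And>x. \<eta> * norm x \<le> norm (A x - r *\<^sub>C x)"
    using positive_op_minus_scalar_bounded_below[OF A] by blast
  have "\<eta> * \<delta> * norm x \<le> norm (cpoly_op q A x)" for x
  proof -
    let ?y = "cpoly_op q' A x"
    have "\<eta> * (\<delta> * norm x) \<le> \<eta> * norm ?y" using \<delta> \<eta>(1) by simp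
    also have "\<dots> \<le> norm (A ?y - r *\<^sub>C ?y)" by (rule \<eta>(2))
    also have "A ?y - r *\<^sub>C ?y = cpoly_op q A x"
      unfolding q' cpoly_op_mult[OF positive_opD(1)[OF A]]
      by (simp add: cpoly_op_pCons scaleC.minus_left)
    finally show ?thesis by (simp add: mult.assoc)
  qed
  then show ?case using \<delta>(1) \<eta>(1) by (intro exI[of _ "\<eta> * \<delta>"]) auto
qed

text \<open>If \<open>\<beta> = \<parallel>q(A)\<parallel>\<close> exceeded \<open>K\<close>, then \<open>\<beta>\<^sup>2 - q\<^sup>2\<close> would have no root in \<open>[0, \<parallel>A\<parallel>]\<close>, so
  \<open>\<beta>\<^sup>2 - q(A)\<^sup>2\<close> would be bounded below, although \<open>\<beta>\<^sup>2\<close> is an approximate eigenvalue of \<open>q(A)\<^sup>2\<close>.\<close>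

lemma norm_poly_op_le:
  assumes A: "positive_op A" and K: "\<And>t. t \<in> {0..onorm A} \<Longrightarrow> \<bar>poly q t\<bar> \<le> K"
  shows "norm (poly_op q A x) \<le> K * norm x"
proof -
  let ?B = "poly_op q A"
  define \<beta> where "\<beta> = onorm ?B"
  note A1 = positive_opD(1)[OF A]
  have B: "bounded_clinear ?B" by (rule bounded_clinear_poly_op[OF A1])
  have K0: "K \<ge> 0" using K[of 0] onorm_nonneg[OF A1] by auto
  have "\<beta> \<le> K"
  proof (rule ccontr)
    assume "\<not> \<beta> \<le> K"
    then have bK: "\<beta> > K" and b0: "\<beta> > 0" using K0 by auto
    define h where "h = [:\<beta>\<^sup>2:] - q * q"
    have "poly h t > 0" if "t \<in> {0..onorm A}" for t
    proof -
      have "poly q t * poly q t \<le> K * K"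
        using K[OF that] by (metis abs_le_square_iff abs_of_nonneg K0 power2_eq_square)
      also have "\<dots> < \<beta>\<^sup>2" unfolding power2_eq_square using bK K0 by (intro mult_strict_mono) auto
      finally show ?thesis by (simp add: h_def)
    qed
    then have "poly (map_poly complex_of_real h) (complex_of_real t) \<noteq> 0" if "t \<in> {0..onorm A}" for t
      using that unfolding poly_map_poly_of_real by (metis less_irrefl of_real_eq_0_iff)
    then obtain \<delta> where \<delta>: "\<delta> > 0" "\<And>x. \<delta> * norm x \<le> norm (poly_op h A x)"
      using cpoly_op_bounded_below[OF A] unfolding poly_op_eq_cpoly_op by blast
    have hx: "poly_op h A x = \<beta>\<^sup>2 *\<^sub>R x - ?B (?B x)" for x
      by (simp add: h_def poly_op_diff poly_op_pCons poly_op_mult[OF A1])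
    \<comment> \<open>Expand |\<beta>^2 x - q(A)^2 x|^2 \<ge> \<delta>^2 |x|^2 and insert |q(A)^2 x|
      \<le> \<beta>^2 |x|: what remains bounds |q(A) x|^2 by \<kappa> |x|^2, with \<kappa> strictly
      below \<beta>^2.\<close>
    define \<kappa> where "\<kappa> = \<beta>\<^sup>2 - \<delta>\<^sup>2 / (2 * \<beta>\<^sup>2)"
    have le: "(norm (?B x))\<^sup>2 \<le> \<kappa> * (norm x)\<^sup>2" for x
    proof -
      have n: "norm (?B y) \<le> \<beta> * norm y" for y unfolding \<beta>_def by (rule bounded_clinearD(8)[OF B])
      have "norm (?B (?B x)) \<le> \<beta>\<^sup>2 * norm x"
        using order_trans[OF n[of "?B x"] mult_left_mono[OF n[of x]]] b0
        by (simp add: power2_eq_square mult.assoc)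
      then have 1: "(norm (?B (?B x)))\<^sup>2 \<le> (\<beta>\<^sup>2)\<^sup>2 * (norm x)\<^sup>2"
        by (metis norm_ge_zero power_mono power_mult_distrib)
      have "(\<delta> * norm x)\<^sup>2 \<le> (norm (\<beta>\<^sup>2 *\<^sub>R x + (- ?B (?B x))))\<^sup>2"
        using \<delta> hx by (intro power_mono) auto
      also have "\<dots> = (\<beta>\<^sup>2)\<^sup>2 * (norm x)\<^sup>2 + (norm (?B (?B x)))\<^sup>2 - 2 * \<beta>\<^sup>2 * Re (cinner x (?B (?B x)))"
        unfolding norm_add_sq by (simp add: cinner.minus_right cinner_scaleR_left power_mult_distrib)
      also have "cinner x (?B (?B x)) = of_real ((norm (?B x))\<^sup>2)"
        by (simp add: poly_op_symmetric[OF A, symmetric] cinner_self)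
      finally have "\<delta>\<^sup>2 * (norm x)\<^sup>2 \<le> 2 * ((\<beta>\<^sup>2)\<^sup>2 * (norm x)\<^sup>2) - 2 * \<beta>\<^sup>2 * (norm (?B x))\<^sup>2"
        using 1 by (simp add: power_mult_distrib)
      then have "2 * \<beta>\<^sup>2 * (norm (?B x))\<^sup>2 \<le> (2 * (\<beta>\<^sup>2)\<^sup>2 - \<delta>\<^sup>2) * (norm x)\<^sup>2"
        by (simp add: algebra_simps)
      also have "\<dots> = 2 * \<beta>\<^sup>2 * (\<kappa> * (norm x)\<^sup>2)" using b0 by (simp add: \<kappa>_def field_simps power2_eq_square)
      finally show ?thesis using b0 by simp
    qed
    \<comment> \<open>The maximum covers the possibility that \<kappa> is negative.\<close>
    define \<mu> where "\<mu> = sqrt (max \<kappa> 0)"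
    have "norm (?B x) \<le> \<mu> * norm x" for x
    proof (rule power2_le_imp_le)
      have "\<kappa> * (norm x)\<^sup>2 \<le> max \<kappa> 0 * (norm x)\<^sup>2" by (intro mult_right_mono) auto
      then show "(norm (?B x))\<^sup>2 \<le> (\<mu> * norm x)\<^sup>2"
        using le[of x] by (simp add: \<mu>_def power_mult_distrib)
    qed (simp add: \<mu>_def)
    then have "\<beta> \<le> \<mu>" unfolding \<beta>_def by (intro onorm_bound) (auto simp: \<mu>_def)
    then have "\<beta>\<^sup>2 \<le> \<mu>\<^sup>2" using b0 by (intro power_mono) auto
    also have "\<mu>\<^sup>2 = max \<kappa> 0" by (simp add: \<mu>_def)
    finally have "\<beta>\<^sup>2 \<le> max \<kappa> 0" .
    moreover have "\<delta>\<^sup>2 / (2 * \<beta>\<^sup>2) > 0" using b0 \<delta>(1) by simp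
    ultimately show False using b0 unfolding \<kappa>_def by (auto simp: max_def split: if_splits)
  qed
  then show ?thesis using bounded_clinearD(8)[OF B, of x] mult_right_mono[of \<beta> K "norm x"]
    unfolding \<beta>_def by simp
qed

text \<open>If 0 \<le> q \<le> 2K on the interval, then |K - q| \<le> K there, so K - q(A) has norm
  at most K and its quadratic form cannot exceed K |x|^2.\<close>

lemma poly_op_nonneg:
  assumes A: "positive_op A" and q: "\<And>t. t \<in> {0..onorm A} \<Longrightarrow> 0 \<le> poly q t"
  shows "0 \<le> Re (cinner (poly_op q A x) x)"
proof -
  have "bounded (poly q ` {0..onorm A})"
    by (intro compact_imp_bounded compact_continuous_image continuous_intros) auto
  then obtain K where K: "\<And>t. t \<in> {0..onorm A} \<Longrightarrow> \<bar>poly q t\<bar> \<le> 2 * K"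
    by (metis bounded_real field_sum_of_halves imageI mult_2)
  have "norm (poly_op ([:K:] - q) A x) \<le> K * norm x"
  proof (rule norm_poly_op_le[OF A])
    fix t assume t: "t \<in> {0..onorm A}"
    show "\<bar>poly ([:K:] - q) t\<bar> \<le> K" using q[OF t] K[OF t] by simp
  qed
  then have "norm (K *\<^sub>R x - poly_op q A x) * norm x \<le> K * norm x * norm x"
    by (intro mult_right_mono) (auto simp: poly_op_diff poly_op_pCons)
  moreover have "Re (cinner (K *\<^sub>R x - poly_op q A x) x) \<le> norm (K *\<^sub>R x - poly_op q A x) * norm x"
    using norm_cinner_le complex_Re_le_cmod order_trans by blast
  ultimately show ?thesis
    by (simp add: cinner.diff_left cinner_scaleR_left cinner_self power2_eq_square mult.assoc)
qed

subsection \<open>Powers\<close>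

lemma ex_poly_approx_powr:
  assumes "s > 0" "\<epsilon> > (0::real)"
  shows "\<exists>q. \<forall>t\<in>{0..M}. \<bar>poly q t - t powr s\<bar> < \<epsilon>"
proof -
  have "continuous_on {0..M} (\<lambda>t::real. t powr s)"
    using assms(1) by (intro continuous_on_powr') (auto intro!: continuous_intros)
  then obtain g where g: "real_polynomial_function g" "\<And>t. t \<in> {0..M} \<Longrightarrow> \<bar>t powr s - g t\<bar> < \<epsilon>"
    using Stone_Weierstrass_real_polynomial_function[OF compact_Icc _ assms(2)] by metis
  obtain a n where an: "g = (\<lambda>t. \<Sum>i\<le>n. a i * t ^ i)"
    using g(1) unfolding real_polynomial_function_iff_sum by blast
  have "poly (\<Sum>i\<le>n. monom (a i) i) t = g t" for t by (simp add: an poly_sum poly_monom)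
  then show ?thesis using g(2) by (intro exI[of _ "\<Sum>i\<le>n. monom (a i) i"]) (auto simp: abs_minus_commute)
qed

lemma ex_poly_seq_powr:
  assumes "s > (0::real)"
  shows "\<exists>q :: nat \<Rightarrow> real poly. \<forall>n. \<forall>t\<in>{0..M}. \<bar>poly (q n) t - t powr s\<bar> \<le> inverse (Suc n)"
  using ex_poly_approx_powr[OF assms, of "inverse (real (Suc _))" M]
  by (metis less_imp_le positive_imp_inverse_positive of_nat_0_less_iff zero_less_Suc)

lemma uniform_limit_inverse_Suc:
  fixes f :: "nat \<Rightarrow> 'a \<Rightarrow> real"
  assumes "\<And>n t. t \<in> S \<Longrightarrow> \<bar>f n t - g t\<bar> \<le> inverse (Suc n)"
  shows "uniform_limit S f g sequentially"
  unfolding uniform_limit_iff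
proof (intro allI impI)
  fix e :: real assume "e > 0"
  then have "\<forall>\<^sub>F n in sequentially. inverse (real (Suc n)) < e"
    by (rule order_tendstoD(2)[OF LIMSEQ_inverse_real_of_nat])
  then show "\<forall>\<^sub>F n in sequentially. \<forall>t\<in>S. dist (f n t) (g t) < e"
  proof (rule eventually_mono, intro ballI)
    fix n t assume "inverse (real (Suc n)) < e" "t \<in> S"
    then show "dist (f n t) (g t) < e" using assms[of t n] unfolding dist_real_def by linarith
  qed
qed

text \<open>This gives the \<open>THE\<close> in \<open>op_powr\<close> its meaning.
  \<open>B\<close> is the strong limit along one sequence \<open>q\<close> from the Weierstrass
  theorem; \<open>err\<close> turns any uniform error on the interval into an operator error, which
  yields convergence for every other sequence. Uniqueness is tested on \<open>q\<close>.\<close>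

lemma op_powr_ex1:
  assumes A: "positive_op A" and s: "s > 0"
  shows "\<exists>!B. bounded_clinear B \<and>
     (\<forall>q :: nat \<Rightarrow> real poly.
        uniform_limit {0..onorm A} (\<lambda>n t. poly (q n) t) (\<lambda>t. t powr s) sequentially \<longrightarrow>
        (\<lambda>n. onorm (\<lambda>x. poly_op (q n) A x - B x)) \<longlonglongrightarrow> 0)"
proof -
  let ?I = "{0..onorm A}"
  note A1 = positive_opD(1)[OF A]
  obtain q where q: "\<And>n t. t \<in> ?I \<Longrightarrow> \<bar>poly (q n) t - t powr s\<bar> \<le> inverse (Suc n)"
    using ex_poly_seq_powr[OF s] by blast
  have cl: "norm (poly_op r A x - poly_op (q n) A x) \<le> (\<epsilon> + inverse (Suc n)) * norm x"
    if "\<And>t. t \<in> ?I \<Longrightarrow> \<bar>poly r t - t powr s\<bar> \<le> \<epsilon>" for r n \<epsilon> x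
    unfolding poly_op_diff[symmetric]
  proof (rule norm_poly_op_le[OF A])
    fix t assume "t \<in> ?I"
    then show "\<bar>poly (r - q n) t\<bar> \<le> \<epsilon> + inverse (Suc n)"
      using that[of t] q[of t n] by (simp add: abs_le_iff)
  qed
  have inv0: "(\<lambda>n. inverse (real (Suc n))) \<longlonglongrightarrow> 0" by (rule LIMSEQ_inverse_real_of_nat)
  have "\<exists>l. (\<lambda>n. poly_op (q n) A x) \<longlonglongrightarrow> l" for x
  proof -
    have "Cauchy (\<lambda>n. poly_op (q n) A x)"
    proof (rule metric_CauchyI)
      fix e :: real assume "e > 0"
      have "(\<lambda>n. (inverse (real (Suc n)) + inverse (real (Suc n))) * norm x) \<longlonglongrightarrow> (0 + 0) * norm x"
        by (intro tendsto_intros inv0)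
      then have "\<forall>\<^sub>F n in sequentially. (inverse (real (Suc n)) + inverse (real (Suc n))) * norm x < e"
        using \<open>e > 0\<close> by (simp add: order_tendstoD)
      then obtain N where N: "(inverse (real (Suc N)) + inverse (real (Suc N))) * norm x < e"
        by (meson eventually_sequentially order_refl)
      have "dist (poly_op (q m) A x) (poly_op (q n) A x) < e" if "m \<ge> N" "n \<ge> N" for m n
      proof -
        have "norm (poly_op (q m) A x - poly_op (q n) A x)
            \<le> (inverse (real (Suc m)) + inverse (real (Suc n))) * norm x"
          by (rule cl[OF q])
        also have "\<dots> \<le> (inverse (real (Suc N)) + inverse (real (Suc N))) * norm x"
          using that by (intro mult_right_mono add_mono le_imp_inverse_le) auto
        finally show ?thesis using N by (simp add: dist_norm)
      qed
      then show "\<exists>M. \<forall>m\<ge>M. \<forall>n\<ge>M. dist (poly_op (q m) A x) (poly_op (q n) A x) < e" by blast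
    qed
    then show ?thesis using Cauchy_convergent convergent_def by blast
  qed
  then obtain B where B: "\<And>x. (\<lambda>n. poly_op (q n) A x) \<longlonglongrightarrow> B x" by metis
  have err: "norm (poly_op r A x - B x) \<le> \<epsilon> * norm x"
    if r: "\<And>t. t \<in> ?I \<Longrightarrow> \<bar>poly r t - t powr s\<bar> \<le> \<epsilon>" for r \<epsilon> x
  proof (rule LIMSEQ_le)
    show "(\<lambda>n. norm (poly_op r A x - poly_op (q n) A x)) \<longlonglongrightarrow> norm (poly_op r A x - B x)"
      by (intro tendsto_intros B)
    have "(\<lambda>n. (\<epsilon> + inverse (real (Suc n))) * norm x) \<longlonglongrightarrow> (\<epsilon> + 0) * norm x"
      by (intro tendsto_intros inv0)
    then show "(\<lambda>n. (\<epsilon> + inverse (real (Suc n))) * norm x) \<longlonglongrightarrow> \<epsilon> * norm x" by simp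
    show "\<exists>N. \<forall>n\<ge>N. norm (poly_op r A x - poly_op (q n) A x) \<le> (\<epsilon> + inverse (real (Suc n))) * norm x"
      using cl[OF r] by blast
  qed
  have Bb: "bounded_clinear B"
  proof (rule bounded_clinearI)
    note P = bounded_clinearD[OF bounded_clinear_poly_op[OF A1]]
    show "B (x + y) = B x + B y" for x y
      using LIMSEQ_unique[OF B[of "x + y"]] tendsto_add[OF B[of x] B[of y]] by (simp add: P)
    show "B (c *\<^sub>C x) = c *\<^sub>C B x" for c x
      using LIMSEQ_unique[OF B[of "c *\<^sub>C x"]] scaleC.tendsto[OF tendsto_const B[of x]] by (simp add: P)
    show "norm (B x) \<le> (onorm (poly_op (q 0) A) + 1) * norm x" for x
    proof -
      have "norm (poly_op (q 0) A x - B x) \<le> 1 * norm x" by (rule err) (use q[of _ 0] in auto)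
      moreover have "norm (B x) \<le> norm (poly_op (q 0) A x) + norm (poly_op (q 0) A x - B x)"
        by (metis norm_minus_commute norm_triangle_sub)
      ultimately show ?thesis using P(8)[of "q 0" x] by (simp add: distrib_right)
    qed
  qed
  have lim: "(\<lambda>n. onorm (\<lambda>x. poly_op (r n) A x - B x)) \<longlonglongrightarrow> 0"
    if r: "uniform_limit ?I (\<lambda>n t. poly (r n) t) (\<lambda>t. t powr s) sequentially" for r :: "nat \<Rightarrow> real poly"
  proof (rule LIMSEQ_I)
    fix e :: real assume "e > 0"
    then have "\<forall>\<^sub>F n in sequentially. \<forall>t\<in>?I. dist (poly (r n) t) (t powr s) < e / 2"
      using r unfolding uniform_limit_iff by (meson half_gt_zero)
    then obtain N where N: "\<And>n t. n \<ge> N \<Longrightarrow> t \<in> ?I \<Longrightarrow> \<bar>poly (r n) t - t powr s\<bar> < e / 2"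
      unfolding eventually_sequentially dist_real_def by blast
    have "norm (onorm (\<lambda>x. poly_op (r n) A x - B x) - 0) < e" if "n \<ge> N" for n
    proof -
      have "onorm (\<lambda>x. poly_op (r n) A x - B x) \<le> e / 2"
        using \<open>e > 0\<close> N[OF that] by (intro onorm_bound err) (auto intro: less_imp_le)
      moreover have "0 \<le> onorm (\<lambda>x. poly_op (r n) A x - B x)"
        by (intro onorm_nonneg bounded_clinear_diff bounded_clinear_poly_op A1 Bb)
      ultimately show ?thesis using \<open>e > 0\<close> by simp
    qed
    then show "\<exists>N. \<forall>n\<ge>N. norm (onorm (\<lambda>x. poly_op (r n) A x - B x) - 0) < e" by blast
  qed
  have qlim: "uniform_limit ?I (\<lambda>n t. poly (q n) t) (\<lambda>t. t powr s) sequentially"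
    by (rule uniform_limit_inverse_Suc[OF q])
  show ?thesis
  proof (rule ex1I[of _ B])
    show "bounded_clinear B \<and> (\<forall>q :: nat \<Rightarrow> real poly.
        uniform_limit ?I (\<lambda>n t. poly (q n) t) (\<lambda>t. t powr s) sequentially \<longrightarrow>
        (\<lambda>n. onorm (\<lambda>x. poly_op (q n) A x - B x)) \<longlonglongrightarrow> 0)" using Bb lim by blast
    fix B' assume B': "bounded_clinear B' \<and> (\<forall>q :: nat \<Rightarrow> real poly.
        uniform_limit ?I (\<lambda>n t. poly (q n) t) (\<lambda>t. t powr s) sequentially \<longrightarrow>
        (\<lambda>n. onorm (\<lambda>x. poly_op (q n) A x - B' x)) \<longlonglongrightarrow> 0)"
    show "B' = B"
    proof
      fix x
      have "bounded_clinear (\<lambda>x. poly_op (q n) A x - B' x)" for n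
        using B' by (intro bounded_clinear_diff bounded_clinear_poly_op A1) auto
      then have le: "norm (poly_op (q n) A x - B' x) \<le> onorm (\<lambda>x. poly_op (q n) A x - B' x) * norm x" for n
        by (rule bounded_clinearD(8))
      have "(\<lambda>n. onorm (\<lambda>x. poly_op (q n) A x - B' x) * norm x) \<longlonglongrightarrow> 0 * norm x"
        using B' qlim by (intro tendsto_intros) auto
      then have "(\<lambda>n. poly_op (q n) A x - B' x) \<longlonglongrightarrow> 0"
        by (intro Lim_null_comparison[OF always_eventually[OF allI[OF le]]]) simp
      then have "(\<lambda>n. poly_op (q n) A x) \<longlonglongrightarrow> B' x" by (rule LIM_zero_cancel)
      then show "B' x = B x" using B LIMSEQ_unique by blast
    qed
  qed
qed

text \<open>The working form of the definition: one sequence with an explicit rate and strong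
  convergence replaces all sequences and the operator norm.\<close>

lemma op_powr_limit:
  assumes A: "positive_op A" and s: "s > 0"
  shows "bounded_clinear (op_powr A s)"
    and "\<exists>q :: nat \<Rightarrow> real poly. (\<forall>n. \<forall>t\<in>{0..onorm A}. \<bar>poly (q n) t - t powr s\<bar> \<le> inverse (Suc n)) \<and>
      (\<forall>x. (\<lambda>n. poly_op (q n) A x) \<longlonglongrightarrow> op_powr A s x)"
proof -
  let ?I = "{0..onorm A}" and ?B = "op_powr A s"
  have sp: "bounded_clinear ?B \<and>
     (\<forall>q :: nat \<Rightarrow> real poly.
        uniform_limit ?I (\<lambda>n t. poly (q n) t) (\<lambda>t. t powr s) sequentially \<longrightarrow>
        (\<lambda>n. onorm (\<lambda>x. poly_op (q n) A x - ?B x)) \<longlonglongrightarrow> 0)"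
    unfolding op_powr_def by (rule theI'[OF op_powr_ex1[OF A s]])
  then show B: "bounded_clinear ?B" by blast
  obtain q where q: "\<And>n t. t \<in> ?I \<Longrightarrow> \<bar>poly (q n) t - t powr s\<bar> \<le> inverse (Suc n)"
    using ex_poly_seq_powr[OF s] by blast
  have "uniform_limit ?I (\<lambda>n t. poly (q n) t) (\<lambda>t. t powr s) sequentially"
    by (rule uniform_limit_inverse_Suc[OF q])
  then have lim: "(\<lambda>n. onorm (\<lambda>x. poly_op (q n) A x - ?B x)) \<longlonglongrightarrow> 0" using sp by blast
  have "(\<lambda>n. poly_op (q n) A x) \<longlonglongrightarrow> ?B x" for x
  proof -
    have "bounded_clinear (\<lambda>x. poly_op (q n) A x - ?B x)" for n
      by (intro bounded_clinear_diff bounded_clinear_poly_op positive_opD(1)[OF A] B)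
    then have le: "norm (poly_op (q n) A x - ?B x) \<le> onorm (\<lambda>x. poly_op (q n) A x - ?B x) * norm x" for n
      by (rule bounded_clinearD(8))
    have "(\<lambda>n. onorm (\<lambda>x. poly_op (q n) A x - ?B x) * norm x) \<longlonglongrightarrow> 0 * norm x"
      by (intro tendsto_intros lim)
    then have "(\<lambda>n. poly_op (q n) A x - ?B x) \<longlonglongrightarrow> 0"
      by (intro Lim_null_comparison[OF always_eventually[OF allI[OF le]]]) simp
    then show ?thesis by (rule LIM_zero_cancel)
  qed
  then show "\<exists>q :: nat \<Rightarrow> real poly. (\<forall>n. \<forall>t\<in>?I. \<bar>poly (q n) t - t powr s\<bar> \<le> inverse (Suc n)) \<and>
      (\<forall>x. (\<lambda>n. poly_op (q n) A x) \<longlonglongrightarrow> ?B x)" using q by blast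
qed

lemma op_powr_symmetric:
  assumes A: "positive_op A" and s: "s > 0"
  shows "cinner (op_powr A s x) y = cinner x (op_powr A s y)"
proof -
  obtain q where q: "\<And>x. (\<lambda>n. poly_op (q n) A x) \<longlonglongrightarrow> op_powr A s x"
    using op_powr_limit(2)[OF A s] by blast
  have "(\<lambda>n. cinner (poly_op (q n) A x) y) \<longlonglongrightarrow> cinner (op_powr A s x) y"
    by (intro cinner.tendsto q tendsto_const)
  moreover have "(\<lambda>n. cinner x (poly_op (q n) A y)) \<longlonglongrightarrow> cinner x (op_powr A s y)"
    by (intro cinner.tendsto q tendsto_const)
  ultimately show ?thesis using LIMSEQ_unique unfolding poly_op_symmetric[OF A] by blast
qed

text \<open>The scalar inequality survives the functional calculus because C (q_n + 1/(n+1)) - r is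
  a polynomial that is nonnegative on the interval. The case C = 1, r = 0 gives positivity of
  powers; the case of a linear r gives the Young-type bound behind the Hoelder inequality.\<close>

lemma poly_op_le_op_powr:
  assumes A: "positive_op A" and s: "s > 0" and C: "C \<ge> 0"
    and r: "\<And>t. t \<in> {0..onorm A} \<Longrightarrow> poly r t \<le> C * t powr s"
  shows "Re (cinner (poly_op r A x) x) \<le> C * Re (cinner (op_powr A s x) x)"
proof -
  obtain q where q: "\<And>n t. t \<in> {0..onorm A} \<Longrightarrow> \<bar>poly (q n) t - t powr s\<bar> \<le> inverse (Suc n)"
      "\<And>x. (\<lambda>n. poly_op (q n) A x) \<longlonglongrightarrow> op_powr A s x"
    using op_powr_limit(2)[OF A s] by blast
  have "(\<lambda>n. C * Re (cinner (poly_op (q n) A x) x) + C * inverse (real (Suc n)) * (norm x)\<^sup>2)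
      \<longlonglongrightarrow> C * Re (cinner (op_powr A s x) x) + C * 0 * (norm x)\<^sup>2"
    by (intro tendsto_intros cinner.tendsto q(2) LIMSEQ_inverse_real_of_nat)
  moreover have "Re (cinner (poly_op r A x) x) \<le>
      C * Re (cinner (poly_op (q n) A x) x) + C * inverse (real (Suc n)) * (norm x)\<^sup>2" for n
  proof -
    have "0 \<le> Re (cinner (poly_op (smult C (q n) + [:C * inverse (Suc n):] - r) A x) x)"
    proof (rule poly_op_nonneg[OF A])
      fix t assume t: "t \<in> {0..onorm A}"
      have "poly r t \<le> C * t powr s" by (rule r[OF t])
      also have "\<dots> \<le> C * (poly (q n) t + inverse (Suc n))"
        using q(1)[OF t, of n] C by (intro mult_left_mono) auto
      finally show "0 \<le> poly (smult C (q n) + [:C * inverse (Suc n):] - r) t"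
        by (simp add: distrib_left)
    qed
    then show ?thesis
      by (simp add: poly_op_diff poly_op_add poly_op_smult poly_op_pCons cinner.diff_left
          cinner_add_left cinner_scaleR_left cinner_self del: of_nat_Suc)
  qed
  ultimately show ?thesis by (intro LIMSEQ_le_const) auto
qed

lemma positive_op_powr:
  assumes A: "positive_op A" and s: "s > 0"
  shows "positive_op (op_powr A s)"
proof (rule positive_opI[OF op_powr_limit(1)[OF A s]])
  show "0 \<le> Re (cinner (op_powr A s x) x)" for x
    using poly_op_le_op_powr[OF A s, of 1 0 x] by simp
  show "Im (cinner (op_powr A s x) x) = 0" for x
    by (rule symmetric_Im[OF op_powr_symmetric[OF A s]])
qed

text \<open>The squares q_n^2 tend to t uniformly on the interval. Moving one factor q_n(A) across
  the inner product makes strong convergence of q_n(A) in each argument sufficient to identify the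
  other limit.\<close>

lemma op_powr_half_square:
  assumes A: "positive_op A"
  shows "op_powr A (1/2) (op_powr A (1/2) x) = A x"
proof (rule cinner_eqI)
  fix y
  let ?B = "op_powr A (1/2)" and ?I = "{0..onorm A}" and ?M = "onorm A"
  note A1 = positive_opD(1)[OF A]
  obtain q where q: "\<And>n t. t \<in> {0..onorm A} \<Longrightarrow> \<bar>poly (q n) t - t powr (1/2)\<bar> \<le> inverse (Suc n)"
      "\<And>x. (\<lambda>n. poly_op (q n) A x) \<longlonglongrightarrow> ?B x"
    using op_powr_limit(2)[OF A half_gt_zero[OF zero_less_one]] by blast
  have X: "poly_op [:0, 1:] A x = A x" for x by (simp add: poly_op_pCons)
  have le: "norm (poly_op (q n) A (poly_op (q n) A x) - A x) \<le> (inverse (Suc n) * (2 * sqrt ?M + inverse (Suc n))) * norm x" for n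
  proof -
    have "norm (poly_op (q n * q n - [:0, 1:]) A x) \<le> (inverse (Suc n) * (2 * sqrt ?M + inverse (Suc n))) * norm x"
    proof (rule norm_poly_op_le[OF A])
      fix t assume t: "t \<in> ?I"
      let ?p = "poly (q n) t" and ?s = "sqrt t"
      have 1: "\<bar>?p - ?s\<bar> \<le> inverse (Suc n)" using q(1)[OF t, of n] t by (simp add: powr_half_sqrt)
      have "poly (q n * q n - [:0, 1:]) t = ?p * ?p - ?s * ?s" using t by simp
      also have "\<dots> = (?p - ?s) * (2 * ?s + (?p - ?s))" by (simp add: algebra_simps)
      also have "\<bar>\<dots>\<bar> \<le> inverse (Suc n) * (2 * sqrt ?M + inverse (Suc n))"
        unfolding abs_mult
      proof (rule mult_mono[OF 1])
        have "?s \<le> sqrt ?M" "?s \<ge> 0" using t by auto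
        then show "\<bar>2 * ?s + (?p - ?s)\<bar> \<le> 2 * sqrt ?M + inverse (Suc n)" using 1 by arith
      qed auto
      finally show "\<bar>poly (q n * q n - [:0, 1:]) t\<bar> \<le> inverse (Suc n) * (2 * sqrt ?M + inverse (Suc n))" .
    qed
    then show ?thesis by (simp only: poly_op_diff poly_op_mult[OF A1] X)
  qed
  have "(\<lambda>n. (inverse (real (Suc n)) * (2 * sqrt ?M + inverse (real (Suc n)))) * norm x) \<longlonglongrightarrow> (0 * (2 * sqrt ?M + 0)) * norm x"
    by (intro tendsto_intros LIMSEQ_inverse_real_of_nat)
  then have "(\<lambda>n. poly_op (q n) A (poly_op (q n) A x) - A x) \<longlonglongrightarrow> 0"
    by (intro Lim_null_comparison[OF always_eventually[OF allI[OF le]]]) simp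
  then have "(\<lambda>n. poly_op (q n) A (poly_op (q n) A x)) \<longlonglongrightarrow> A x" by (rule LIM_zero_cancel)
  then have "(\<lambda>n. cinner y (poly_op (q n) A (poly_op (q n) A x))) \<longlonglongrightarrow> cinner y (A x)"
    by (intro cinner.tendsto tendsto_const)
  moreover have "(\<lambda>n. cinner (poly_op (q n) A y) (poly_op (q n) A x)) \<longlonglongrightarrow> cinner (?B y) (?B x)"
    by (intro cinner.tendsto q(2))
  ultimately have "cinner y (A x) = cinner (?B y) (?B x)"
    using LIMSEQ_unique unfolding poly_op_symmetric[OF A] by blast
  then show "cinner y (?B (?B x)) = cinner y (A x)" using op_powr_symmetric[OF A, of "1/2"] by simp
qed

lemma op_powr_eigenvector:
  assumes A: "positive_op A" and s: "s > 0" and e: "A e = d *\<^sub>R e" "d \<ge> 0"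
  shows "op_powr A s e = (d powr s) *\<^sub>R e"
proof (cases "e = 0")
  case True
  then show ?thesis using bounded_clinearD(5)[OF op_powr_limit(1)[OF A s]] by simp
next
  case False
  note A1 = positive_opD(1)[OF A]
  obtain q where q: "\<And>n t. t \<in> {0..onorm A} \<Longrightarrow> \<bar>poly (q n) t - t powr s\<bar> \<le> inverse (Suc n)"
      "\<And>x. (\<lambda>n. poly_op (q n) A x) \<longlonglongrightarrow> op_powr A s x"
    using op_powr_limit(2)[OF A s] by blast
  have "d * norm e \<le> onorm A * norm e" using bounded_clinearD(8)[OF A1, of e] e by simp
  then have d: "d \<in> {0..onorm A}" using e(2) False by simp
  have "(\<lambda>n. poly (q n) d - d powr s) \<longlonglongrightarrow> 0"
    using q(1)[OF d] by (intro Lim_null_comparison[OF _ LIMSEQ_inverse_real_of_nat]) (auto intro!: always_eventually)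
  then have "(\<lambda>n. poly (q n) d *\<^sub>R e) \<longlonglongrightarrow> (d powr s) *\<^sub>R e"
    by (intro tendsto_intros) (rule LIM_zero_cancel)
  then show ?thesis using q(2)[of e] LIMSEQ_unique unfolding poly_op_eigenvector[OF A1 e(1)] by blast
qed

section \<open>A Hoelder inequality for Schatten operators\<close>

definition contraction :: "('h::complex_hilbert_space \<Rightarrow> 'h) \<Rightarrow> bool" where
  "contraction z \<longleftrightarrow> bounded_clinear z \<and> (\<forall>x. norm (z x) \<le> norm x)"

lemma contractionD:
  assumes "contraction z"
  shows "bounded_clinear z" "norm (z x) \<le> norm x"
  using assms unfolding contraction_def by auto

lemma contraction_id: "contraction id"
  unfolding contraction_def by (simp add: bounded_clinear_id)

lemma contraction_comp: "contraction w \<Longrightarrow> contraction z \<Longrightarrow> contraction (w \<circ> z)"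
  unfolding contraction_def using bounded_clinear_comp order_trans by fastforce

lemma contraction_cadjoint: "contraction z \<Longrightarrow> contraction (cadjoint z)"
  using bounded_clinear_cadjoint[of z 1] unfolding contraction_def by auto

section \<open>Absolute values and traces\<close>

lemma cinner_cadjoint_comp:
  assumes "bounded_clinear T"
  shows "cinner ((cadjoint T \<circ> T) x) x = of_real ((norm (T x))\<^sup>2)"
proof -
  have "cinner x (cadjoint T (T x)) = of_real ((norm (T x))\<^sup>2)"
    by (simp add: cinner_cadjoint[OF assms, symmetric] cinner_self)
  then show ?thesis using cinner_commute[of "cadjoint T (T x)" x] by simp
qed

lemma positive_op_cadjoint_comp:
  assumes "bounded_clinear T"
  shows "positive_op (cadjoint T \<circ> T)"
proof (rule positive_opI)
  show "bounded_clinear (cadjoint T \<circ> T)"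
    using assms bounded_clinear_cadjoint(1)[OF assms bounded_clinearD(8)[OF assms]] by (intro bounded_clinear_comp)
qed (simp_all add: cinner_cadjoint_comp[OF assms] del: o_apply flip: of_real_power)

lemma positive_op_abs: "bounded_clinear T \<Longrightarrow> positive_op (op_abs T)"
  unfolding op_abs_def by (intro positive_op_powr positive_op_cadjoint_comp) auto

lemma norm_op_abs:
  assumes "bounded_clinear T"
  shows "norm (op_abs T x) = norm (T x)"
proof -
  have "cinner (op_abs T x) (op_abs T x) = cinner (op_abs T (op_abs T x)) x"
    by (simp add: positive_op_symmetric[OF positive_op_abs[OF assms]])
  also have "\<dots> = cinner ((cadjoint T \<circ> T) x) x"
    unfolding op_abs_def op_powr_half_square[OF positive_op_cadjoint_comp[OF assms]] ..
  also have "\<dots> = of_real ((norm (T x))\<^sup>2)" by (rule cinner_cadjoint_comp[OF assms])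
  finally show ?thesis unfolding cinner_self of_real_eq_iff by simp
qed

lemma pos_trace_eq_SUP:
  "pos_trace A = (SUP F\<in>{F. finite F \<and> F \<subseteq> onb}. \<Sum>e\<in>F. ennreal (Re (cinner (A e) e)))"
  unfolding pos_trace_def onb_def[symmetric] by (rule nonneg_infsum_complete) simp

lemma sum_le_pos_trace:
  assumes "positive_op K" "pos_trace K < \<infinity>" "finite F" "F \<subseteq> onb"
  shows "(\<Sum>e\<in>F. Re (cinner (K e) e)) \<le> enn2real (pos_trace K)"
proof -
  have "ennreal (\<Sum>e\<in>F. Re (cinner (K e) e)) = (\<Sum>e\<in>F. ennreal (Re (cinner (K e) e)))"
    using positive_opD(2)[OF assms(1)] by (simp add: sum_ennreal)
  also have "\<dots> \<le> pos_trace K" unfolding pos_trace_eq_SUP by (rule SUP_upper) (use assms in auto)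
  also have "\<dots> = ennreal (enn2real (pos_trace K))" using assms(2) by simp
  finally show ?thesis by (subst (asm) ennreal_le_iff) auto
qed

text \<open>With K = R^2 each summand is |R z b|^2. The vectors z b need not be orthogonal, so this
  is no change of basis: Parseval expands R z b over \<open>onb\<close>, the sums are exchanged, and
  R z is moved to the other side. Bessel then bounds the sum over b by the squared norm of the
  adjoint of z applied to R e, hence by |R e|^2.\<close>

lemma sum_contraction_le_pos_trace:
  assumes K: "positive_op K" "pos_trace K < \<infinity>" and z: "contraction z" and B: "finite B" "B \<subseteq> onb"
  shows "(\<Sum>e\<in>B. Re (cinner (K (z e)) (z e))) \<le> enn2real (pos_trace K)"
proof (rule field_le_epsilon)
  fix \<epsilon> :: real assume "\<epsilon> > 0"
  define R where "R = op_powr K (1/2)"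
  have R: "Re (cinner (K v) v) = (norm (R v))\<^sup>2" for v
    unfolding R_def Re_cinner_self[symmetric]
    by (simp add: op_powr_half_square[OF K(1)] op_powr_symmetric[OF K(1), symmetric])
  define \<delta> where "\<delta> = \<epsilon> / (card B + 1)"
  have "\<delta> > 0" using \<open>\<epsilon> > 0\<close> by (simp add: \<delta>_def)
  then obtain F where F: "\<And>b. finite (F b)" "\<And>b. F b \<subseteq> onb" "\<And>b G. finite G \<Longrightarrow> F b \<subseteq> G \<Longrightarrow> G \<subseteq> onb \<Longrightarrow>
      (norm (R (z b)))\<^sup>2 - \<delta> \<le> (\<Sum>e\<in>G. (cmod (cinner (R (z b)) e))\<^sup>2)"
    using parseval_approx[of \<delta> "R (z _)"] by metis
  define G where "G = (\<Union>b\<in>B. F b)"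
  have G: "finite G" "G \<subseteq> onb" using F B by (auto simp: G_def)
  have adj: "cmod (cinner (R (z b)) e) = cmod (cinner (cadjoint z (R e)) b)" for b e
  proof -
    have "cinner (R (z b)) e = cinner b (cadjoint z (R e))"
      using cinner_cadjoint[OF contractionD(1)[OF z]] op_powr_symmetric[OF K(1)] by (simp add: R_def)
    then show ?thesis using cinner_commute[of b] by (metis complex_mod_cnj)
  qed
  have "(\<Sum>b\<in>B. Re (cinner (K (z b)) (z b))) \<le> (\<Sum>b\<in>B. \<delta> + (\<Sum>e\<in>G. (cmod (cinner (R (z b)) e))\<^sup>2))"
  proof (rule sum_mono)
    fix b assume "b \<in> B"
    then have "F b \<subseteq> G" by (auto simp: G_def)
    then show "Re (cinner (K (z b)) (z b)) \<le> \<delta> + (\<Sum>e\<in>G. (cmod (cinner (R (z b)) e))\<^sup>2)"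
      using F(3)[OF G(1) _ G(2), of b] by (simp add: R)
  qed
  also have "\<dots> = card B * \<delta> + (\<Sum>e\<in>G. \<Sum>b\<in>B. (cmod (cinner (cadjoint z (R e)) b))\<^sup>2)"
    by (simp add: sum.distrib adj sum.swap[of _ G])
  also have "\<dots> \<le> \<epsilon> + (\<Sum>e\<in>G. Re (cinner (K e) e))"
  proof (rule add_mono)
    show "card B * \<delta> \<le> \<epsilon>" using \<open>\<epsilon> > 0\<close> by (simp add: \<delta>_def field_simps)
    show "(\<Sum>e\<in>G. \<Sum>b\<in>B. (cmod (cinner (cadjoint z (R e)) b))\<^sup>2) \<le> (\<Sum>e\<in>G. Re (cinner (K e) e))"
    proof (rule sum_mono)
      fix e
      have "(\<Sum>b\<in>B. (cmod (cinner (cadjoint z (R e)) b))\<^sup>2) \<le> (norm (cadjoint z (R e)))\<^sup>2"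
        by (rule bessel[OF B(2,1)])
      also have "\<dots> \<le> (norm (R e))\<^sup>2"
        by (intro power_mono contractionD(2)[OF contraction_cadjoint[OF z]]) simp
      finally show "(\<Sum>b\<in>B. (cmod (cinner (cadjoint z (R e)) b))\<^sup>2) \<le> Re (cinner (K e) e)" by (simp add: R)
    qed
  qed
  also have "\<dots> \<le> \<epsilon> + enn2real (pos_trace K)" using sum_le_pos_trace[OF K G] by simp
  finally show "(\<Sum>e\<in>B. Re (cinner (K (z e)) (z e))) \<le> enn2real (pos_trace K) + \<epsilon>" by simp
qed

text \<open>Weighted arithmetic-geometric mean inequality for \<mu>^(1-p) t^p and \<mu> with weights
  1/p and 1 - 1/p: their weighted geometric mean is t. Equality holds at t = \<mu>.\<close>

lemma le_weighted_powr:
  fixes t \<mu> p :: real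
  assumes "0 \<le> t" "0 < \<mu>" "1 \<le> p"
  shows "t \<le> 1 / p * \<mu> powr (1 - p) * t powr p + (1 - 1 / p) * \<mu>"
proof (cases "t = 0")
  case True
  then show ?thesis using assms by (simp add: field_simps)
next
  case False
  then have t: "t > 0" using assms by simp
  have "(\<mu> powr (1 - p) * t powr p) powr (1 / p) * \<mu> powr (1 - 1 / p)
      \<le> 1 / p * (\<mu> powr (1 - p) * t powr p) + (1 - 1 / p) * \<mu>"
    using assms t by (intro Youngs_inequality_0) (auto simp: field_simps)
  also have "(\<mu> powr (1 - p) * t powr p) powr (1 / p) * \<mu> powr (1 - 1 / p) = t"
  proof -
    have "(\<mu> powr (1 - p) * t powr p) powr (1 / p) = \<mu> powr ((1 - p) / p) * t"
      using assms t by (simp add: powr_mult powr_powr)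
    moreover have "\<mu> powr ((1 - p) / p) * \<mu> powr (1 - 1 / p) = 1"
      using assms by (simp add: powr_add[symmetric] diff_divide_distrib)
    ultimately show ?thesis by (simp add: algebra_simps)
  qed
  finally show ?thesis by (simp add: mult.assoc)
qed

text \<open>Hoelder's inequality by linearisation: \<open>le_weighted_powr\<close> passes to H \<le>
  C H^p + (1 - 1/p) \<mu> as quadratic forms, which can be summed over B. For \<mu> = r N^(-1/p) the
  two terms add up to r N^(1 - 1/p).\<close>

lemma sum_contraction_le_schatten:
  assumes H: "positive_op H" and p: "1 \<le> p" and tr: "pos_trace (op_powr H p) < \<infinity>"
    and r: "enn2real (pos_trace (op_powr H p)) \<le> r powr p" "0 < r"
    and z: "contraction z" and B: "finite B" "B \<subseteq> onb"
  shows "(\<Sum>e\<in>B. Re (cinner (H (z e)) (z e))) \<le> r * real (card B) powr (1 - 1 / p)"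
proof (cases "B = {}")
  case False
  define N where "N = real (card B)"
  have N: "N > 0" using False B by (simp add: N_def card_gt_0_iff)
  have p0: "p > 0" using p by simp
  define \<mu> where "\<mu> = r * N powr (- (1 / p))"
  define C where "C = 1 / p * \<mu> powr (1 - p)"
  have l0: "\<mu> > 0" using r N by (simp add: \<mu>_def)
  have C0: "C \<ge> 0" using p by (simp add: C_def)
  have "(\<Sum>e\<in>B. Re (cinner (H (z e)) (z e))) \<le> (\<Sum>e\<in>B. C * Re (cinner (op_powr H p (z e)) (z e)) + (1 - 1 / p) * \<mu>)"
  proof (rule sum_mono)
    fix e assume e: "e \<in> B"
    have "Re (cinner (poly_op [:- ((1 - 1 / p) * \<mu>), 1:] H (z e)) (z e)) \<le> C * Re (cinner (op_powr H p (z e)) (z e))"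
    proof (rule poly_op_le_op_powr[OF H p0 C0])
      fix t assume "t \<in> {0..onorm H}"
      then show "poly [:- ((1 - 1 / p) * \<mu>), 1:] t \<le> C * t powr p"
        using le_weighted_powr[OF _ l0 p, of t] by (simp add: C_def)
    qed
    then have 1: "Re (cinner (H (z e)) (z e)) \<le> C * Re (cinner (op_powr H p (z e)) (z e)) + (1 - 1 / p) * \<mu> * (norm (z e))\<^sup>2"
      by (simp add: poly_op_pCons cinner_add_left cinner_scaleR_left cinner.diff_left cinner_self flip: of_real_power)
    have "(norm (z e))\<^sup>2 \<le> 1\<^sup>2"
      using contractionD(2)[OF z, of e] norm_onb[of e] e B by (intro power_mono) auto
    then have "(1 - 1 / p) * \<mu> * (norm (z e))\<^sup>2 \<le> (1 - 1 / p) * \<mu> * 1"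
      using p l0 by (intro mult_left_mono) auto
    then show "Re (cinner (H (z e)) (z e)) \<le> C * Re (cinner (op_powr H p (z e)) (z e)) + (1 - 1 / p) * \<mu>"
      using 1 by simp
  qed
  also have "\<dots> = C * (\<Sum>e\<in>B. Re (cinner (op_powr H p (z e)) (z e))) + N * ((1 - 1 / p) * \<mu>)"
    by (simp add: sum.distrib sum_distrib_left N_def)
  also have "\<dots> \<le> C * r powr p + N * ((1 - 1 / p) * \<mu>)"
    using order_trans[OF sum_contraction_le_pos_trace[OF positive_op_powr[OF H p0] tr z B] r(1)] C0
    by (intro add_right_mono mult_left_mono)
  also have "\<dots> = r * N powr (1 - 1 / p)"
  proof -
    have "\<mu> powr (1 - p) * r powr p = r * N powr (1 - 1 / p)"
    proof -
      have "\<mu> powr (1 - p) = r powr (1 - p) * N powr (1 - 1 / p)"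
      proof -
        have ex: "1 - 1 / p = - (1 / p) * (1 - p)" using p by (simp add: field_simps)
        show ?thesis unfolding \<mu>_def ex powr_powr[symmetric] using r by (simp add: powr_mult)
      qed
      then show ?thesis using r powr_add[of r "1 - p" p] by simp
    qed
    moreover have "N * \<mu> = r * N powr (1 - 1 / p)"
      using N powr_add[of N 1 "- (1 / p)"] by (simp add: \<mu>_def)
    ultimately show ?thesis by (simp add: C_def algebra_simps diff_divide_distrib)
  qed
  finally show ?thesis by (simp add: N_def)
qed simp

text \<open>The form of H is nonnegative at x - \<zeta> y, and \<zeta> is the phase of <H x, y>, so
  the cross terms contribute -2 |<H x, y>|. The arithmetic mean is as good as the geometric one
  here, since both diagonal sums later obey the same bound.\<close>

lemma positive_op_cinner_le:
  assumes H: "positive_op H"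
  shows "cmod (cinner (H x) y) \<le> (Re (cinner (H x) x) + Re (cinner (H y) y)) / 2"
proof -
  note lin = bounded_clinearD[OF positive_opD(1)[OF H]]
  define c where "c = cinner (H x) y"
  define \<zeta> where "\<zeta> = (if c = 0 then 1 else sgn c)"
  have z1: "cmod \<zeta> = 1" by (simp add: \<zeta>_def norm_sgn)
  have z2: "cnj \<zeta> * c = of_real (cmod c)"
    by (auto simp: \<zeta>_def sgn_div_norm scaleR_conv_of_real complex_norm_square[symmetric] mult.commute
      power2_eq_square field_simps)
  have "cinner (H y) x = cnj c"
    unfolding c_def by (metis positive_op_symmetric[OF H] cinner_commute)
  moreover have "\<zeta> * cnj \<zeta> = 1" using z1 complex_norm_square[of \<zeta>] by simp
  ultimately have "cinner (H (x - \<zeta> *\<^sub>C y)) (x - \<zeta> *\<^sub>C y) = cinner (H x) x + cinner (H y) y - (cnj \<zeta> * c + cnj (cnj \<zeta> * c))"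
    by (simp add: lin cinner.diff_left cinner.diff_right cinner_scaleC_left cinner_scaleC_right c_def[symmetric] algebra_simps)
  then have "0 \<le> Re (cinner (H x) x) + Re (cinner (H y) y) - 2 * cmod c"
    using positive_opD(2)[OF H, of "x - \<zeta> *\<^sub>C y"] unfolding z2 by simp
  then show ?thesis by (simp add: c_def)
qed

text \<open>An approximate polar decomposition: with \<open>H = |u|\<close> and \<open>M = \<parallel>H\<parallel>\<close>, take \<open>w = u s(H)\<close> for
  the polynomial \<open>s\<close> with \<open>t s(t) = 1 - (1 - t/M)\<^sup>m\<close>.\<close>

lemma approximate_polar_decomposition:
  assumes u: "bounded_clinear u" and \<epsilon>: "\<epsilon> > 0"
  shows "\<exists>w. contraction w \<and> (\<forall>x. norm (u x - w (op_abs u x)) \<le> \<epsilon> * norm x)"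
proof (cases "onorm (op_abs u) = 0")
  case True
  have "u x = 0" for x
    using bounded_clinearD(8)[OF positive_opD(1)[OF positive_op_abs[OF u]], of x] True norm_op_abs[OF u, of x] by simp
  then show ?thesis using \<epsilon> by (intro exI[of _ "\<lambda>x. 0"]) (auto simp: contraction_def bounded_clinear_zero)
next
  case False
  define H where "H = op_abs u"
  define M where "M = onorm H"
  have H: "positive_op H" unfolding H_def by (rule positive_op_abs[OF u])
  note H1 = positive_opD(1)[OF H]
  have nH: "norm (u x) = norm (H x)" for x unfolding H_def by (rule norm_op_abs[OF u, symmetric])
  have M: "M > 0" using False onorm_nonneg[OF H1] by (simp add: M_def H_def)
  \<comment> \<open>The error of the decomposition will be at most M / m.\<close>
  obtain m :: nat where m: "m > M / \<epsilon>" using reals_Archimedean2 by blast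
  then have "0 < real m" using M \<epsilon> by (metis divide_pos_pos less_trans)
  define q where "q = [:1, - 1 / M:] ^ m"
  have "poly (1 - q) 0 = 0" by (simp add: q_def)
  then obtain s where "1 - q = [:- 0, 1:] * s" unfolding poly_eq_0_iff_dvd by (rule dvdE)
  then have s: "[:0, 1:] * s = 1 - q" by simp
  have X: "poly_op [:0, 1:] H x = H x" for x by (simp add: poly_op_pCons)
  define w where "w = u \<circ> poly_op s H"
  have qt: "poly q t = (1 - t / M) ^ m" for t by (simp add: q_def)
  have y: "t / M \<in> {0..1}" if "t \<in> {0..M}" for t using that M by auto
  have "norm (w x) \<le> 1 * norm x" for x
  proof -
    have "norm (poly_op ([:0, 1:] * s) H x) \<le> 1 * norm x"
    proof (rule norm_poly_op_le[OF H])
      fix t assume t: "t \<in> {0..onorm H}"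
      then have "0 \<le> poly q t" "poly q t \<le> 1" unfolding qt using y[of t] by (auto simp: M_def intro: power_le_one)
      then show "\<bar>poly ([:0, 1:] * s) t\<bar> \<le> 1" unfolding s by simp
    qed
    then show ?thesis unfolding w_def o_apply nH poly_op_mult[OF H1] X .
  qed
  then have "contraction w"
    unfolding contraction_def w_def by (simp add: bounded_clinear_comp[OF u bounded_clinear_poly_op[OF H1]])
  moreover have "norm (u x - w (H x)) \<le> \<epsilon> * norm x" for x
  proof -
    \<comment> \<open>This polynomial is t q(t). It appears because u and H have equal norms at the
      vector x - s(H) H x.\<close>
    have "norm (poly_op ([:0, 1:] * ([:1:] - s * [:0, 1:])) H x) \<le> \<epsilon> * norm x"
    proof (rule norm_poly_op_le[OF H])
      fix t assume t: "t \<in> {0..onorm H}"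
      define v where "v = t / M"
      have v: "0 \<le> v" "v \<le> 1" "t = M * v" using y[of t] t M by (auto simp: v_def M_def)
      \<comment> \<open>Bernoulli's 1 + m v \<le> (1 + v)^m together with (1 + v) (1 - v) \<le> 1
        gives m v (1 - v)^m \<le> 1.\<close>
      have "(m * v) * (1 - v) ^ m \<le> (1 + m * v) * (1 - v) ^ m" using v by (intro mult_right_mono) auto
      also have "\<dots> \<le> (1 + v) ^ m * (1 - v) ^ m" using v by (intro mult_right_mono Bernoulli_inequality) auto
      also have "\<dots> = (1 - v * v) ^ m" by (simp add: power_mult_distrib[symmetric] algebra_simps)
      also have "\<dots> \<le> 1" using v by (intro power_le_one) (auto simp: mult_le_one)
      finally have "m * (v * (1 - v) ^ m) \<le> 1" by (simp add: mult.assoc)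
      then have "v * (1 - v) ^ m \<le> 1 / m" using \<open>0 < real m\<close> by (simp add: field_simps)
      then have "M * (v * (1 - v) ^ m) \<le> M * (1 / m)" using M by (intro mult_left_mono) auto
      also have "\<dots> \<le> \<epsilon>" using m \<open>0 < real m\<close> \<epsilon> by (simp add: field_simps)
      finally have "t * poly q t \<le> \<epsilon>" "0 \<le> t * poly q t" using v M by (auto simp: qt mult.assoc)
      moreover have "[:1:] - s * [:0, 1:] = q"
        using s by (simp only: mult.commute[of s]) (simp add: one_pCons[symmetric])
      ultimately show "\<bar>poly ([:0, 1:] * ([:1:] - s * [:0, 1:])) t\<bar> \<le> \<epsilon>" by simp
    qed
    moreover have "poly_op ([:0, 1:] * ([:1:] - s * [:0, 1:])) H x = H (x - poly_op s H (H x))"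
      unfolding poly_op_mult[OF H1, of "[:0, 1:]"] X poly_op_diff poly_op_mult[OF H1, of s]
      by (simp add: poly_op_pCons)
    moreover have "u x - w (H x) = u (x - poly_op s H (H x))"
      by (simp add: w_def bounded_clinearD[OF u])
    ultimately show ?thesis by (simp add: nH)
  qed
  ultimately show ?thesis unfolding H_def by blast
qed

lemma schatten_norm_nonneg: "0 \<le> schatten_norm p u"
  by (simp add: schatten_norm_def)

lemma schatten_class_bounded: "u \<in> schatten_class p \<Longrightarrow> bounded_clinear u"
  by (simp add: schatten_class_def)

text \<open>Up to \<delta>, u equals w |u| with a contraction w, whose adjoint can be absorbed into
  z'. \<open>positive_op_cinner_le\<close> leaves two diagonal sums of |u|, each bounded by
  \<open>sum_contraction_le_schatten\<close>. The strict inequality guarantees r > 0, which that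
  bound requires.\<close>

proposition schatten_hoelder:
  assumes p: "1 \<le> p" and u: "u \<in> schatten_class p" and r: "schatten_norm p u < r"
    and z: "contraction z" "contraction z'" and B: "finite B" "B \<subseteq> onb"
  shows "cmod (\<Sum>e\<in>B. cinner (u (z e)) (z' e)) \<le> r * real (card B) powr (1 - 1 / p)"
proof (rule field_le_epsilon)
  fix \<epsilon> :: real assume \<epsilon>: "\<epsilon> > 0"
  have ub: "bounded_clinear u" and tr: "pos_trace (op_powr (op_abs u) p) < \<infinity>"
    using u by (auto simp: schatten_class_def)
  define H where "H = op_abs u"
  define \<delta> where "\<delta> = \<epsilon> / (card B + 1)"
  have d: "\<delta> > 0" using \<epsilon> by (simp add: \<delta>_def)
  have H: "positive_op H" unfolding H_def by (rule positive_op_abs[OF ub])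
  have r0: "r > 0" using r schatten_norm_nonneg[of p u] by linarith
  have trr: "enn2real (pos_trace (op_powr H p)) \<le> r powr p"
  proof -
    have "(enn2real (pos_trace (op_powr H p)) powr (1 / p)) powr p \<le> r powr p"
      using r p by (intro powr_mono2) (auto simp: schatten_norm_def H_def)
    then show ?thesis using p by (simp add: powr_powr)
  qed
  note bound = sum_contraction_le_schatten[OF H p tr[folded H_def] trr r0 _ B]
  obtain w where w: "contraction w" "\<And>x. norm (u x - w (H x)) \<le> \<delta> * norm x"
    using approximate_polar_decomposition[OF ub d] unfolding H_def by blast
  define y where "y = cadjoint w \<circ> z'"
  have y: "contraction y" unfolding y_def by (intro contraction_comp contraction_cadjoint w z)
  have "cmod (\<Sum>e\<in>B. cinner (u (z e)) (z' e)) \<le> (\<Sum>e\<in>B. cmod (cinner (u (z e)) (z' e)))"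
    by (rule norm_sum)
  also have "\<dots> \<le> (\<Sum>e\<in>B. \<delta> + (Re (cinner (H (z e)) (z e)) + Re (cinner (H (y e)) (y e))) / 2)"
  proof (rule sum_mono)
    fix e assume e: "e \<in> B"
    then have ne: "norm e = 1" using B norm_onb by auto
    have le1: "norm (z e) \<le> 1" "norm (z' e) \<le> 1" using z[THEN contractionD(2), of e] ne by auto
    have "cinner (u (z e)) (z' e) = cinner (u (z e) - w (H (z e))) (z' e) + cinner (H (z e)) (y e)"
      by (simp add: cinner.diff_left y_def cinner_cadjoint[OF contractionD(1)[OF w(1)], symmetric])
    then have "cmod (cinner (u (z e)) (z' e)) \<le> cmod (cinner (u (z e) - w (H (z e))) (z' e)) + cmod (cinner (H (z e)) (y e))"
      by (metis norm_triangle_ineq)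
    also have "cmod (cinner (u (z e) - w (H (z e))) (z' e)) \<le> (\<delta> * norm (z e)) * norm (z' e)"
      by (rule order_trans[OF norm_cinner_le mult_right_mono[OF w(2)]]) simp
    also have "\<dots> \<le> (\<delta> * 1) * 1" using d le1 by (intro mult_mono) auto
    also have "cmod (cinner (H (z e)) (y e)) \<le> (Re (cinner (H (z e)) (z e)) + Re (cinner (H (y e)) (y e))) / 2"
      by (rule positive_op_cinner_le[OF H])
    finally show "cmod (cinner (u (z e)) (z' e)) \<le> \<delta> + (Re (cinner (H (z e)) (z e)) + Re (cinner (H (y e)) (y e))) / 2"
      by simp
  qed
  also have "\<dots> = card B * \<delta> + ((\<Sum>e\<in>B. Re (cinner (H (z e)) (z e))) + (\<Sum>e\<in>B. Re (cinner (H (y e)) (y e)))) / 2"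
    by (simp add: sum.distrib sum_divide_distrib[symmetric])
  also have "\<dots> \<le> \<epsilon> + r * real (card B) powr (1 - 1 / p)"
  proof (rule add_mono)
    show "card B * \<delta> \<le> \<epsilon>" using \<epsilon> by (simp add: \<delta>_def field_simps)
  qed (use bound[OF z(1)] bound[OF y] in simp)
  finally show "cmod (\<Sum>e\<in>B. cinner (u (z e)) (z' e)) \<le> r * real (card B) powr (1 - 1 / p) + \<epsilon>" by simp
qed

text \<open>A positive operator is its own absolute value. On a basis of eigenvectors both powers
  can be evaluated directly, so |c|^p has the diagonal entries d^p.\<close>

lemma schatten_class_diagonal:
  assumes c: "positive_op c" and d: "\<And>e. e \<in> onb \<Longrightarrow> c e = d e *\<^sub>R e" "\<And>e. e \<in> onb \<Longrightarrow> 0 \<le> d e"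
    and p: "1 \<le> p" and K: "\<And>F. finite F \<Longrightarrow> F \<subseteq> onb \<Longrightarrow> (\<Sum>e\<in>F. d e powr p) \<le> K"
  shows "c \<in> schatten_class p"
proof -
  note c1 = positive_opD(1)[OF c]
  have adj: "cadjoint c = c" by (rule cadjoint_unique[OF c1 positive_op_symmetric[OF c]])
  have abs: "op_abs c e = d e *\<^sub>R e" if e: "e \<in> onb" for e
  proof -
    have "op_powr (c \<circ> c) (1 / 2) e = ((d e * d e) powr (1 / 2)) *\<^sub>R e"
      using positive_op_cadjoint_comp[OF c1] d[OF e]
      by (intro op_powr_eigenvector) (auto simp: adj bounded_clinearD[OF c1])
    then show ?thesis using d(2)[OF e] by (simp add: op_abs_def adj powr_half_sqrt)
  qed
  have "Re (cinner (op_powr (op_abs c) p e) e) = d e powr p" if e: "e \<in> onb" for e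
    using op_powr_eigenvector[OF positive_op_abs[OF c1] _ abs[OF e] d(2)[OF e], of p] p e
    by (simp add: cinner_scaleR_left onb_cinner)
  then have "pos_trace (op_powr (op_abs c) p) \<le> ennreal K"
    unfolding pos_trace_eq_SUP
    by (intro SUP_least) (auto simp: subset_iff sum_ennreal intro!: ennreal_leI K)
  also have "ennreal K < \<infinity>" by simp
  finally show ?thesis using c1 by (simp add: schatten_class_def)
qed

section \<open>The bimodule of bilinear forms\<close>

text \<open>A weaker ideal norm, obviously subadditive and compatible with composition by bounded operators.
  Measuring forms with it makes the triangle inequality for the Schatten norm unnecessary.\<close>

definition weak_ball :: "real \<Rightarrow> real \<Rightarrow> ('h::complex_hilbert_space \<Rightarrow> 'h) set" where
  "weak_ball p r = {S. bounded_clinear S \<and> (\<forall>B z z'. finite B \<longrightarrow> B \<subseteq> onb \<longrightarrow>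
     contraction z \<longrightarrow> contraction z' \<longrightarrow>
     cmod (\<Sum>e\<in>B. cinner (S (z e)) (z' e)) \<le> r * real (card B) powr (1 - 1 / p))}"

definition weak_class :: "real \<Rightarrow> ('h::complex_hilbert_space \<Rightarrow> 'h) set" where
  "weak_class p = (\<Union>r. weak_ball p r)"

lemma weak_ballI:
  "bounded_clinear S \<Longrightarrow> (\<And>B z z'. finite B \<Longrightarrow> B \<subseteq> onb \<Longrightarrow> contraction z \<Longrightarrow> contraction z' \<Longrightarrow>
    cmod (\<Sum>e\<in>B. cinner (S (z e)) (z' e)) \<le> r * real (card B) powr (1 - 1 / p)) \<Longrightarrow> S \<in> weak_ball p r"
  unfolding weak_ball_def by blast

lemma weak_ballD:
  assumes "S \<in> weak_ball p r"
  shows "bounded_clinear S"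
    "finite B \<Longrightarrow> B \<subseteq> onb \<Longrightarrow> contraction z \<Longrightarrow> contraction z' \<Longrightarrow>
      cmod (\<Sum>e\<in>B. cinner (S (z e)) (z' e)) \<le> r * real (card B) powr (1 - 1 / p)"
  using assms unfolding weak_ball_def by blast+

lemma weak_ball_mono: "S \<in> weak_ball p r \<Longrightarrow> r \<le> s \<Longrightarrow> S \<in> weak_ball p s"
  by (rule weak_ballI) (blast dest: weak_ballD, rule order_trans[OF weak_ballD(2) mult_right_mono], simp_all)

lemma weak_ball_zero: "0 \<le> r \<Longrightarrow> (\<lambda>x. 0) \<in> weak_ball p r"
  by (rule weak_ballI) (auto simp: bounded_clinear_zero)

lemma weak_ball_add:
  assumes "S \<in> weak_ball p r" "T \<in> weak_ball p s"
  shows "(\<lambda>x. S x + T x) \<in> weak_ball p (r + s)"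
proof (rule weak_ballI)
  fix B :: "'a set" and z z' :: "'a \<Rightarrow> 'a" assume B: "finite B" "B \<subseteq> onb" "contraction z" "contraction z'"
  have "cmod (\<Sum>e\<in>B. cinner (S (z e) + T (z e)) (z' e))
      \<le> cmod (\<Sum>e\<in>B. cinner (S (z e)) (z' e)) + cmod (\<Sum>e\<in>B. cinner (T (z e)) (z' e))"
    by (simp add: cinner_add_left sum.distrib norm_triangle_ineq)
  also have "\<dots> \<le> (r + s) * real (card B) powr (1 - 1 / p)"
    using add_mono[OF weak_ballD(2)[OF assms(1) B] weak_ballD(2)[OF assms(2) B]] by (simp add: distrib_right)
  finally show "cmod (\<Sum>e\<in>B. cinner (S (z e) + T (z e)) (z' e)) \<le> (r + s) * real (card B) powr (1 - 1 / p)" .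
qed (intro bounded_clinear_add weak_ballD(1)[OF assms(1)] weak_ballD(1)[OF assms(2)])

lemma weak_ball_scale:
  assumes "S \<in> weak_ball p r"
  shows "(\<lambda>x. c *\<^sub>C S x) \<in> weak_ball p (cmod c * r)"
proof (rule weak_ballI)
  fix B :: "'a set" and z z' :: "'a \<Rightarrow> 'a" assume B: "finite B" "B \<subseteq> onb" "contraction z" "contraction z'"
  show "cmod (\<Sum>e\<in>B. cinner (c *\<^sub>C S (z e)) (z' e)) \<le> cmod c * r * real (card B) powr (1 - 1 / p)"
    using mult_left_mono[OF weak_ballD(2)[OF assms(1) B], of "cmod c"]
    by (simp add: cinner_scaleC_left sum_distrib_left[symmetric] norm_mult mult.assoc)
qed (intro bounded_clinear_scaleC weak_ballD(1)[OF assms])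

lemma contraction_scale:
  assumes "bounded_clinear a" "\<And>x. norm (a x) \<le> \<kappa> * norm x" "0 < \<kappa>" "contraction z"
  shows "contraction (\<lambda>x. (1 / \<kappa>) *\<^sub>R a (z x))"
  unfolding contraction_def
proof (intro conjI allI)
  have "bounded_clinear (\<lambda>x. complex_of_real (1 / \<kappa>) *\<^sub>C (a \<circ> z) x)"
    by (intro bounded_clinear_scaleC bounded_clinear_comp assms contractionD)
  then show "bounded_clinear (\<lambda>x. (1 / \<kappa>) *\<^sub>R a (z x))" unfolding scaleR_scaleC by simp
  fix x
  have "norm (a (z x)) \<le> \<kappa> * norm x"
    using order_trans[OF assms(2) mult_left_mono[OF contractionD(2)[OF assms(4)]]] assms(3) by simp
  then show "norm ((1 / \<kappa>) *\<^sub>R a (z x)) \<le> norm x" using assms(3) by (simp add: field_simps)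
qed

text \<open>The adjoint of a, divided by \<kappa>, is a contraction and can be absorbed into z'.
  Absorbing factors on either side is the reason why \<open>weak_ball\<close> quantifies over z and
  z'.\<close>

lemma weak_ball_comp_left:
  assumes "S \<in> weak_ball p r" "bounded_clinear a" "\<And>x. norm (a x) \<le> \<kappa> * norm x" "0 < \<kappa>"
  shows "a \<circ> S \<in> weak_ball p (\<kappa> * r)"
proof (rule weak_ballI)
  fix B :: "'a set" and z z' :: "'a \<Rightarrow> 'a" assume B: "finite B" "B \<subseteq> onb" "contraction z" "contraction z'"
  define w where "w x = (1 / \<kappa>) *\<^sub>R cadjoint a (z' x)" for x
  have w: "contraction w" unfolding w_def
    by (rule contraction_scale[OF bounded_clinear_cadjoint[OF assms(2,3)] assms(4) B(4)])
  have "cinner ((a \<circ> S) (z e)) (z' e) = of_real \<kappa> * cinner (S (z e)) (w e)" for e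
    using assms(4) by (simp add: w_def cinner_cadjoint[OF assms(2)] cinner_scaleR_right scaleR_conv_of_real)
  then show "cmod (\<Sum>e\<in>B. cinner ((a \<circ> S) (z e)) (z' e)) \<le> \<kappa> * r * real (card B) powr (1 - 1 / p)"
    using mult_left_mono[OF weak_ballD(2)[OF assms(1) B(1-3) w], of \<kappa>] assms(4)
    by (simp only: sum_distrib_left[symmetric] norm_mult) (simp add: mult.assoc)
qed (intro bounded_clinear_comp weak_ballD(1)[OF assms(1)] assms(2))

lemma weak_ball_comp_right:
  assumes "S \<in> weak_ball p r" "bounded_clinear a" "\<And>x. norm (a x) \<le> \<kappa> * norm x" "0 < \<kappa>"
  shows "S \<circ> a \<in> weak_ball p (\<kappa> * r)"
proof (rule weak_ballI)
  fix B :: "'a set" and z z' :: "'a \<Rightarrow> 'a" assume B: "finite B" "B \<subseteq> onb" "contraction z" "contraction z'"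
  define w where "w x = (1 / \<kappa>) *\<^sub>R a (z x)" for x
  have w: "contraction w" unfolding w_def by (rule contraction_scale[OF assms(2-4) B(3)])
  have "cinner ((S \<circ> a) (z e)) (z' e) = of_real \<kappa> * cinner (S (w e)) (z' e)" for e
    using assms(4) bounded_clinearD(7)[OF weak_ballD(1)[OF assms(1)]]
    by (simp add: w_def cinner_scaleR_left scaleR_conv_of_real)
  then show "cmod (\<Sum>e\<in>B. cinner ((S \<circ> a) (z e)) (z' e)) \<le> \<kappa> * r * real (card B) powr (1 - 1 / p)"
    using mult_left_mono[OF weak_ballD(2)[OF assms(1) B(1,2) w B(4)], of \<kappa>] assms(4)
    by (simp only: sum_distrib_left[symmetric] norm_mult) (simp add: mult.assoc)
qed (intro bounded_clinear_comp weak_ballD(1)[OF assms(1)] assms(2))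

text \<open>A single basis vector e suffices as test set: v \<mapsto> <v, e> x and v \<mapsto> <v,
  e> y are contractions for x, y in the unit ball, and card {e} = 1.\<close>

lemma weak_ball_norm_le:
  assumes S: "S \<in> weak_ball p r" and ne: "onb \<noteq> ({} :: 'h::complex_hilbert_space set)"
  shows "norm (S x) \<le> r * norm (x :: 'h)"
proof -
  obtain e :: 'h where e: "e \<in> onb" using ne by blast
  note Sb = weak_ballD(1)[OF S]
  have 1: "cmod (cinner (S x) y) \<le> r" if "norm x \<le> 1" "norm y \<le> 1" for x y
  proof -
    have c: "contraction (\<lambda>v. cinner v e *\<^sub>C w)" if "norm w \<le> 1" for w
      unfolding contraction_def
    proof (intro conjI allI bounded_clinear_rank1)
      fix v
      have "cmod (cinner v e) * norm w \<le> norm v * 1"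
        using norm_cinner_le[of v e] norm_onb[OF e] that by (intro mult_mono) auto
      then show "norm (cinner v e *\<^sub>C w) \<le> norm v" by (simp add: norm_scaleC)
    qed
    have "cmod (\<Sum>b\<in>{e}. cinner (S (cinner b e *\<^sub>C x)) (cinner b e *\<^sub>C y)) \<le> r * real (card {e}) powr (1 - 1 / p)"
      by (rule weak_ballD(2)[OF S]) (use e c that in auto)
    then show ?thesis using e by (simp add: onb_cinner)
  qed
  have r0: "0 \<le> r" using 1[of 0 0] by simp
  show ?thesis
  proof (cases "x = 0 \<or> S x = 0")
    case True
    then show ?thesis using r0 bounded_clinearD(5)[OF Sb] by auto
  next
    case False
    have "cmod (cinner (S (inverse (norm x) *\<^sub>R x)) (inverse (norm (S x)) *\<^sub>R S x)) \<le> r"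
      using False by (intro 1) auto
    also have "cinner (S (inverse (norm x) *\<^sub>R x)) (inverse (norm (S x)) *\<^sub>R S x)
        = of_real (inverse (norm x) * norm (S x))"
      using False by (simp add: bounded_clinearD(7)[OF Sb] cinner_scaleR_left cinner_scaleR_right cinner_self
          scaleR_conv_of_real power2_eq_square)
    finally show ?thesis using False by (simp add: norm_divide norm_mult norm_inverse field_simps)
  qed
qed

lemma schatten_subset_weak_ball:
  "1 \<le> p \<Longrightarrow> u \<in> schatten_class p \<Longrightarrow> schatten_norm p u < r \<Longrightarrow> u \<in> weak_ball p r"
  by (rule weak_ballI[OF schatten_class_bounded]) (auto intro: schatten_hoelder)

lemma schatten_subset_weak_class: "1 \<le> p \<Longrightarrow> schatten_class p \<subseteq> weak_class p"
  unfolding weak_class_def using schatten_subset_weak_ball less_add_one by blast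

text \<open>Testing the identity on n basis vectors gives n \<le> r n^(1 - 1/p), hence n^(1/p) \<le>
  |r|, for every n. This keeps the point \<open>id\<close> apart from the class, so that a form can
  be prescribed independently on the three kinds of pairs.\<close>

lemma id_notin_weak_class:
  assumes p: "1 \<le> p" and inf: "infinite (onb :: 'h::complex_hilbert_space set)"
  shows "(id :: 'h \<Rightarrow> 'h) \<notin> weak_class p"
proof
  assume "(id :: 'h \<Rightarrow> 'h) \<in> weak_class p"
  then obtain r where r: "(id :: 'h \<Rightarrow> 'h) \<in> weak_ball p r" by (auto simp: weak_class_def)
  obtain n :: nat where n: "\<bar>r\<bar> powr p < n" using reals_Archimedean2 by blast
  then have n0: "0 < real n" by (metis le_less_trans powr_ge_zero)
  obtain B :: "'h set" where B: "finite B" "card B = n" "B \<subseteq> onb"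
    using infinite_arbitrarily_large[OF inf] by blast
  have "(\<Sum>e\<in>B. cinner (id e) (id e)) = of_nat n"
    using B by (simp add: onb_cinner subset_iff)
  then have "real n \<le> r * real n powr (1 - 1 / p)"
    using weak_ballD(2)[OF r B(1,3) contraction_id contraction_id] B(2) by (simp add: id_def)
  also have "\<dots> \<le> \<bar>r\<bar> * real n powr (1 - 1 / p)" by (intro mult_right_mono) auto
  finally have "real n powr (1 / p) * real n powr (1 - 1 / p) \<le> \<bar>r\<bar> * real n powr (1 - 1 / p)"
    using n0 by (simp add: powr_add[symmetric])
  then have "real n powr (1 / p) \<le> \<bar>r\<bar>" using n0 by simp
  then have "(real n powr (1 / p)) powr p \<le> \<bar>r\<bar> powr p" using p by (intro powr_mono2) auto
  then show False using n n0 p by (simp add: powr_powr)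
qed

section \<open>The Banach space of forms\<close>

definition op_add :: "('h \<Rightarrow> 'h) \<Rightarrow> ('h \<Rightarrow> 'h) \<Rightarrow> ('h::complex_hilbert_space \<Rightarrow> 'h)" where
  "op_add S T = (\<lambda>x. S x + T x)"

definition op_scale :: "complex \<Rightarrow> ('h \<Rightarrow> 'h) \<Rightarrow> ('h::complex_hilbert_space \<Rightarrow> 'h)" where
  "op_scale c S = (\<lambda>x. c *\<^sub>C S x)"

lemma weak_class_op:
  "S \<in> weak_class p \<Longrightarrow> T \<in> weak_class p \<Longrightarrow> op_add S T \<in> weak_class p"
  "S \<in> weak_class p \<Longrightarrow> op_scale c S \<in> weak_class p"
  unfolding weak_class_def op_add_def op_scale_def by (blast intro: weak_ball_add weak_ball_scale)+

lemma weak_class_boundedI: "S \<in> weak_class p \<Longrightarrow> bounded_clinear S"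
  unfolding weak_class_def using weak_ballD(1) by blast

lemma weak_ball_subset_class: "S \<in> weak_ball p r \<Longrightarrow> S \<in> weak_class p"
  unfolding weak_class_def by blast

text \<open>A form \<open>G\<close> is evaluated at \<open>(S, T)\<close>, \<open>(S, id)\<close> and \<open>(id, T)\<close>; the identity plays the role of
  an adjoined unit, and the pair \<open>(id, id)\<close> is excluded.\<close>

definition form_dom :: "real \<Rightarrow> (('h::complex_hilbert_space \<Rightarrow> 'h) \<times> ('h \<Rightarrow> 'h)) set" where
  "form_dom p = weak_class p \<times> insert id (weak_class p) \<union> insert id (weak_class p) \<times> weak_class p"

definition form_ball :: "real \<Rightarrow> (('h::complex_hilbert_space \<Rightarrow> 'h) \<times> ('h \<Rightarrow> 'h)) set" where
  "form_ball p = weak_ball p 1 \<times> insert id (weak_ball p 1) \<union> insert id (weak_ball p 1) \<times> weak_ball p 1"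

text \<open>Linearity is imposed within the class only, never on combinations with
  \<open>id\<close>, which is an isolated extra point. The value 0 off the domain represents each
  form by one function.\<close>

definition forms :: "real \<Rightarrow> (('h::complex_hilbert_space \<Rightarrow> 'h) \<Rightarrow> ('h \<Rightarrow> 'h) \<Rightarrow> complex) set" where
  "forms p = {G.
     (\<forall>S T. (S, T) \<notin> form_dom p \<longrightarrow> G S T = 0) \<and>
     (\<forall>R\<in>insert id (weak_class p). \<forall>S\<in>weak_class p. \<forall>T\<in>weak_class p.
        G (op_add S T) R = G S R + G T R \<and> G R (op_add S T) = G R S + G R T) \<and>
     (\<forall>R\<in>insert id (weak_class p). \<forall>S\<in>weak_class p. \<forall>c.
        G (op_scale c S) R = c * G S R \<and> G R (op_scale c S) = c * G R S) \<and>
     (\<exists>K. \<forall>(S, T)\<in>form_ball p. cmod (G S T) \<le> K)}"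

definition form_norm :: "real \<Rightarrow> (('h::complex_hilbert_space \<Rightarrow> 'h) \<Rightarrow> ('h \<Rightarrow> 'h) \<Rightarrow> complex) \<Rightarrow> real" where
  "form_norm p G = (SUP (S, T)\<in>form_ball p. cmod (G S T))"

text \<open>The actions make evaluation at (S, T), as an element of the dual, behave like the tensor
  S \<otimes> T: a acts from the left to give evaluation at (a S, T), and from the right to give (S,
  T a). Dualising swaps the sides, hence \<open>lact\<close> changes the second argument.\<close>

definition form_module ::
  "real \<Rightarrow> ('h::complex_hilbert_space \<Rightarrow> 'h, ('h \<Rightarrow> 'h) \<Rightarrow> ('h \<Rightarrow> 'h) \<Rightarrow> complex) bimodule_structure" where
  "form_module p =
     \<lparr>vcarrier = forms p,
      vadd = (\<lambda>G G' S T. G S T + G' S T),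
      vzero = (\<lambda>S T. 0),
      vscale = (\<lambda>c G S T. c * G S T),
      vnorm = form_norm p,
      lact = (\<lambda>a G S T. if (S, T) \<in> form_dom p then G S (T \<circ> a) else 0),
      ract = (\<lambda>G a S T. if (S, T) \<in> form_dom p then G (a \<circ> S) T else 0)\<rparr>"

lemma form_ball_subset_dom: "form_ball p \<subseteq> form_dom p"
  unfolding form_ball_def form_dom_def by (auto intro: weak_ball_subset_class)

lemma form_ball_nonempty: "form_ball p \<noteq> {}"
  unfolding form_ball_def using weak_ball_zero[of 1 p] by auto

lemma form_domI:
  "S \<in> weak_class p \<Longrightarrow> T \<in> insert id (weak_class p) \<Longrightarrow> (S, T) \<in> form_dom p"
  "S \<in> insert id (weak_class p) \<Longrightarrow> T \<in> weak_class p \<Longrightarrow> (S, T) \<in> form_dom p"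
  unfolding form_dom_def by auto

lemma formsI:
  assumes "\<And>S T. (S, T) \<notin> form_dom p \<Longrightarrow> G S T = 0"
    and "\<And>R S T. R \<in> insert id (weak_class p) \<Longrightarrow> S \<in> weak_class p \<Longrightarrow> T \<in> weak_class p \<Longrightarrow>
      G (op_add S T) R = G S R + G T R"
    and "\<And>R S T. R \<in> insert id (weak_class p) \<Longrightarrow> S \<in> weak_class p \<Longrightarrow> T \<in> weak_class p \<Longrightarrow>
      G R (op_add S T) = G R S + G R T"
    and "\<And>R S c. R \<in> insert id (weak_class p) \<Longrightarrow> S \<in> weak_class p \<Longrightarrow> G (op_scale c S) R = c * G S R"
    and "\<And>R S c. R \<in> insert id (weak_class p) \<Longrightarrow> S \<in> weak_class p \<Longrightarrow> G R (op_scale c S) = c * G R S"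
    and "\<And>S T. (S, T) \<in> form_ball p \<Longrightarrow> cmod (G S T) \<le> K"
  shows "G \<in> forms p"
  unfolding forms_def mem_Collect_eq
proof (intro conjI allI ballI impI)
  show "\<exists>K. \<forall>(S, T)\<in>form_ball p. cmod (G S T) \<le> K" using assms(6) by (intro exI[of _ K]) auto
qed (use assms(1-5) in simp_all)

lemma formsD:
  assumes "G \<in> forms p"
  shows "(S, T) \<notin> form_dom p \<Longrightarrow> G S T = 0"
    and "R \<in> insert id (weak_class p) \<Longrightarrow> S \<in> weak_class p \<Longrightarrow> T \<in> weak_class p \<Longrightarrow>
      G (op_add S T) R = G S R + G T R"
    and "R \<in> insert id (weak_class p) \<Longrightarrow> S \<in> weak_class p \<Longrightarrow> T \<in> weak_class p \<Longrightarrow>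
      G R (op_add S T) = G R S + G R T"
    and "R \<in> insert id (weak_class p) \<Longrightarrow> S \<in> weak_class p \<Longrightarrow> G (op_scale c S) R = c * G S R"
    and "R \<in> insert id (weak_class p) \<Longrightarrow> S \<in> weak_class p \<Longrightarrow> G R (op_scale c S) = c * G R S"
  using assms unfolding forms_def by blast+

lemma form_norm_upper:
  assumes "G \<in> forms p" "(S, T) \<in> form_ball p"
  shows "cmod (G S T) \<le> form_norm p G"
proof -
  obtain K where "\<forall>(S, T)\<in>form_ball p. cmod (G S T) \<le> K" using assms(1) unfolding forms_def by blast
  then have "bdd_above ((\<lambda>(S, T). cmod (G S T)) ` form_ball p)" by (intro bdd_aboveI[of _ K]) auto
  then show ?thesis unfolding form_norm_def using cSUP_upper[OF assms(2)] by fastforce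
qed

lemma form_norm_least:
  "(\<And>S T. (S, T) \<in> form_ball p \<Longrightarrow> cmod (G S T) \<le> K) \<Longrightarrow> form_norm p G \<le> K"
  unfolding form_norm_def by (rule cSUP_least[OF form_ball_nonempty]) auto

lemma form_norm_nonneg: "G \<in> forms p \<Longrightarrow> 0 \<le> form_norm p G"
proof -
  assume G: "G \<in> forms p"
  obtain S T :: "'a \<Rightarrow> 'a" where "(S, T) \<in> form_ball p" using form_ball_nonempty by (metis ex_in_conv surj_pair)
  from order_trans[OF norm_ge_zero form_norm_upper[OF G this]] show ?thesis .
qed

lemma op_scale_scale: "op_scale c (op_scale d S) = op_scale (c * d) S"
  by (simp add: op_scale_def scaleC_scaleC)

lemma op_scale_one: "op_scale 1 S = S"
  by (simp add: op_scale_def)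

lemma weak_ball_rescale:
  assumes "S \<in> weak_ball p r" "0 < r"
  obtains S' where "S' \<in> weak_ball p 1" "S = op_scale (of_real r) S'"
proof
  show "op_scale (of_real (1 / r)) S \<in> weak_ball p 1"
    using weak_ball_scale[OF assms(1), of "of_real (1 / r)"] assms(2) by (simp add: op_scale_def norm_divide)
  show "S = op_scale (of_real r) (op_scale (of_real (1 / r)) S)"
    using assms(2) by (simp add: op_scale_scale op_scale_one)
qed

lemma form_bound:
  assumes G: "G \<in> forms p" and r: "0 < r"
  shows "S \<in> weak_ball p r \<Longrightarrow> T \<in> insert id (weak_ball p 1) \<Longrightarrow> cmod (G S T) \<le> r * form_norm p G"
    and "S \<in> insert id (weak_ball p 1) \<Longrightarrow> T \<in> weak_ball p r \<Longrightarrow> cmod (G S T) \<le> r * form_norm p G"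
proof -
  assume S: "S \<in> weak_ball p r" and T: "T \<in> insert id (weak_ball p 1)"
  obtain S' where S': "S' \<in> weak_ball p 1" "S = op_scale (of_real r) S'" using weak_ball_rescale[OF S r] .
  have "G S T = of_real r * G S' T" unfolding S'(2)
    using T by (intro formsD(4)[OF G]) (auto intro: weak_ball_subset_class S')
  moreover have "cmod (G S' T) \<le> form_norm p G"
    using S' T by (intro form_norm_upper[OF G]) (auto simp: form_ball_def)
  ultimately show "cmod (G S T) \<le> r * form_norm p G" using r by (simp add: norm_mult)
next
  assume T: "T \<in> weak_ball p r" and S: "S \<in> insert id (weak_ball p 1)"
  obtain S' where S': "S' \<in> weak_ball p 1" "T = op_scale (of_real r) S'" using weak_ball_rescale[OF T r] .
  have "G S T = of_real r * G S S'" unfolding S'(2)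
    using S by (intro formsD(5)[OF G]) (auto intro: weak_ball_subset_class S')
  moreover have "cmod (G S S') \<le> form_norm p G"
    using S' S by (intro form_norm_upper[OF G]) (auto simp: form_ball_def)
  ultimately show "cmod (G S T) \<le> r * form_norm p G" using r by (simp add: norm_mult)
qed

text \<open>The factor and the point of the ball are the same for all forms. Therefore
  \<open>form_norm\<close> separates forms, and a sequence that is Cauchy in norm converges
  pointwise on the whole domain.\<close>

lemma form_rescale:
  assumes "(S, T) \<in> form_dom p"
  shows "\<exists>c S' T'. (S', T') \<in> form_ball p \<and> (\<forall>G\<in>forms p. G S T = c * G S' T')"
proof -
  have ex: "\<exists>c S'. S' \<in> weak_ball p 1 \<and> S = op_scale c S'" if S: "S \<in> weak_class p" for S :: "'a \<Rightarrow> 'a"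
  proof -
    obtain r where "S \<in> weak_ball p r" using S by (auto simp: weak_class_def)
    then have "S \<in> weak_ball p (max r 1)" by (rule weak_ball_mono) simp
    then show ?thesis using weak_ball_rescale[of S p "max r 1"] by (metis less_max_iff_disj zero_less_one)
  qed
  note wc = weak_ball_subset_class
  consider "S \<in> weak_class p" "T \<in> weak_class p" | "S \<in> weak_class p" "T = id" | "S = id" "T \<in> weak_class p"
    using assms by (auto simp: form_dom_def)
  then show ?thesis
  proof cases
    case 1
    then obtain c S' d T' where *: "S' \<in> weak_ball p 1" "S = op_scale c S'" "T' \<in> weak_ball p 1" "T = op_scale d T'"
      using ex by metis
    have "G S T = (c * d) * G S' T'" if G: "G \<in> forms p" for G
      unfolding *(2,4) using wc[OF *(1)] wc[OF *(3)] by (simp add: formsD(4,5)[OF G] weak_class_op)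
    then show ?thesis using * by (intro exI[of _ "c * d"] exI[of _ S'] exI[of _ T']) (auto simp: form_ball_def)
  next
    case 2
    then obtain c S' where *: "S' \<in> weak_ball p 1" "S = op_scale c S'" using ex by metis
    have "G S T = c * G S' T" if G: "G \<in> forms p" for G
      unfolding *(2) using wc[OF *(1)] 2 by (simp add: formsD(4)[OF G])
    then show ?thesis using * 2 by (intro exI[of _ "c"] exI[of _ S'] exI[of _ T]) (auto simp: form_ball_def)
  next
    case 3
    then obtain c S' where *: "S' \<in> weak_ball p 1" "T = op_scale c S'" using ex by metis
    have "G S T = c * G S S'" if G: "G \<in> forms p" for G
      unfolding *(2) using wc[OF *(1)] 3 by (simp add: formsD(5)[OF G])
    then show ?thesis using * 3 by (intro exI[of _ "c"] exI[of _ S] exI[of _ S']) (auto simp: form_ball_def)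
  qed
qed

lemma forms_add:
  assumes "G \<in> forms p" "G' \<in> forms p"
  shows "(\<lambda>S T. G S T + G' S T) \<in> forms p"
    and "form_norm p (\<lambda>S T. G S T + G' S T) \<le> form_norm p G + form_norm p G'"
proof -
  have le: "cmod (G S T + G' S T) \<le> form_norm p G + form_norm p G'" if "(S, T) \<in> form_ball p" for S T
    using norm_triangle_ineq[of "G S T" "G' S T"] form_norm_upper[OF assms(1) that] form_norm_upper[OF assms(2) that]
    by linarith
  show "(\<lambda>S T. G S T + G' S T) \<in> forms p"
    by (rule formsI[OF _ _ _ _ _ le]) (simp_all add: formsD[OF assms(1)] formsD[OF assms(2)] algebra_simps)
  show "form_norm p (\<lambda>S T. G S T + G' S T) \<le> form_norm p G + form_norm p G'"
    by (rule form_norm_least[OF le])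
qed

lemma forms_scale:
  assumes "G \<in> forms p"
  shows "(\<lambda>S T. c * G S T) \<in> forms p"
    and "form_norm p (\<lambda>S T. c * G S T) = cmod c * form_norm p G"
proof -
  have le: "cmod (c * G S T) \<le> cmod c * form_norm p G" if "(S, T) \<in> form_ball p" "G \<in> forms p" for S T c G
    using form_norm_upper[OF that(2,1)] by (simp add: norm_mult mult_left_mono)
  show cG: "(\<lambda>S T. c * G S T) \<in> forms p" for c
    by (rule formsI[OF _ _ _ _ _ le[OF _ assms]]) (simp_all add: formsD[OF assms] algebra_simps)
  have le': "form_norm p (\<lambda>S T. c * G S T) \<le> cmod c * form_norm p G" if "G \<in> forms p" for c G
    by (rule form_norm_least[OF le[OF _ that]])
  show "form_norm p (\<lambda>S T. c * G S T) = cmod c * form_norm p G"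
  proof (cases "c = 0")
    case True
    then show ?thesis using le'[OF assms, of 0] form_norm_nonneg[OF cG[of 0]] by simp
  next
    case False
    have "cmod c * form_norm p G = cmod c * form_norm p (\<lambda>S T. (1 / c) * (c * G S T))" using False by simp
    also have "\<dots> \<le> cmod c * (cmod (1 / c) * form_norm p (\<lambda>S T. c * G S T))"
      by (intro mult_left_mono le' cG) auto
    finally show ?thesis using le'[OF assms, of c] False by (simp add: norm_divide)
  qed
qed

lemma forms_zero: "(\<lambda>S T. 0) \<in> forms p"
  by (rule formsI[where K = 0]) auto

lemma form_norm_eq_0:
  assumes "G \<in> forms p"
  shows "form_norm p G = 0 \<longleftrightarrow> G = (\<lambda>S T. 0)"
proof
  assume 0: "form_norm p G = 0"
  have "G S T = 0" for S T
  proof (cases "(S, T) \<in> form_dom p")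
    case True
    then obtain c S' T' where "(S', T') \<in> form_ball p" "G S T = c * G S' T'" using form_rescale assms by blast
    then show ?thesis using form_norm_upper[OF assms] 0 by (metis mult_zero_right norm_le_zero_iff)
  qed (rule formsD(1)[OF assms])
  then show "G = (\<lambda>S T. 0)" by blast
next
  assume "G = (\<lambda>S T. 0)"
  then show "form_norm p G = 0"
    using form_norm_least[of p G 0] form_norm_nonneg[OF assms] by simp
qed

lemma forms_complete:
  assumes \<sigma>: "\<And>n::nat. \<sigma> n \<in> forms p"
    and cauchy: "\<And>e::real. e > 0 \<Longrightarrow> \<exists>N. \<forall>m\<ge>N. \<forall>n\<ge>N. form_norm p (\<lambda>S T. \<sigma> m S T + (- 1) * \<sigma> n S T) < e"
  shows "\<exists>G\<in>forms p. (\<lambda>n. form_norm p (\<lambda>S T. \<sigma> n S T + (- 1) * G S T)) \<longlonglongrightarrow> 0"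
proof -
  have df: "(\<lambda>S T. \<sigma> m S T + (- 1) * \<sigma> n S T) \<in> forms p" for m n
    by (intro forms_add forms_scale \<sigma>)
  have uc: "\<exists>N. \<forall>m\<ge>N. \<forall>n\<ge>N. \<forall>(S, T)\<in>form_ball p. cmod (\<sigma> m S T - \<sigma> n S T) < e" if e: "e > 0" for e
  proof -
    obtain N where N: "\<And>m n. m \<ge> N \<Longrightarrow> n \<ge> N \<Longrightarrow> form_norm p (\<lambda>S T. \<sigma> m S T + (- 1) * \<sigma> n S T) < e"
      using cauchy[OF e] by blast
    have "cmod (\<sigma> m S T - \<sigma> n S T) < e" if "m \<ge> N" "n \<ge> N" "(S, T) \<in> form_ball p" for m n S T
      using form_norm_upper[OF df[of m n] that(3)] N[OF that(1,2)] by simp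
    then show ?thesis by (intro exI[of _ N]) auto
  qed
  have "\<exists>l. (\<lambda>n. \<sigma> n S T) \<longlonglongrightarrow> l" for S T
  proof (cases "(S, T) \<in> form_dom p")
    case True
    then obtain c S' T' where 1: "(S', T') \<in> form_ball p" "\<forall>G\<in>forms p. G S T = c * G S' T'"
      using form_rescale by blast
    have "Cauchy (\<lambda>n. \<sigma> n S' T')"
      by (rule metric_CauchyI) (use uc 1(1) in \<open>fastforce simp: dist_norm\<close>)
    then obtain l where "(\<lambda>n. \<sigma> n S' T') \<longlonglongrightarrow> l" using Cauchy_convergent convergent_def by blast
    then have "(\<lambda>n. c * \<sigma> n S' T') \<longlonglongrightarrow> c * l" by (intro tendsto_intros)
    then show ?thesis using 1(2) \<sigma> by auto
  next
    case False
    then show ?thesis using formsD(1)[OF \<sigma> False] by auto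
  qed
  then obtain G where G: "\<And>S T. (\<lambda>n. \<sigma> n S T) \<longlonglongrightarrow> G S T" by metis
  have err: "\<exists>N. \<forall>n\<ge>N. \<forall>(S, T)\<in>form_ball p. cmod (\<sigma> n S T - G S T) \<le> e" if e: "e > 0" for e
  proof -
    obtain N where N: "\<forall>m\<ge>N. \<forall>n\<ge>N. \<forall>(S, T)\<in>form_ball p. cmod (\<sigma> m S T - \<sigma> n S T) < e"
      using uc[OF e] by blast
    have "cmod (\<sigma> n S T - G S T) \<le> e" if "n \<ge> N" "(S, T) \<in> form_ball p" for n S T
    proof (rule LIMSEQ_le_const2)
      show "(\<lambda>m. cmod (\<sigma> n S T - \<sigma> m S T)) \<longlonglongrightarrow> cmod (\<sigma> n S T - G S T)" by (intro tendsto_intros G)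
      show "\<exists>N. \<forall>m\<ge>N. cmod (\<sigma> n S T - \<sigma> m S T) \<le> e" using N that by (intro exI[of _ N]) (fastforce intro: less_imp_le)
    qed
    then show ?thesis by (intro exI[of _ N]) auto
  qed
  \<comment> \<open>A member of the sequence within distance 1 of the limit supplies a bound for the
    limit.\<close>
  obtain N1 where N1: "\<forall>n\<ge>N1. \<forall>(S, T)\<in>form_ball p. cmod (\<sigma> n S T - G S T) \<le> 1" using err[of 1] by auto
  have GF: "G \<in> forms p"
  proof (rule formsI)
    fix S T :: "'a \<Rightarrow> 'a" assume "(S, T) \<notin> form_dom p"
    then show "G S T = 0" using LIMSEQ_unique[OF G[of S T]] formsD(1)[OF \<sigma>] by simp
  next
    fix S T R :: "'a \<Rightarrow> 'a" assume "R \<in> insert id (weak_class p)" "S \<in> weak_class p" "T \<in> weak_class p"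
    note * = formsD(2,3)[OF \<sigma> this]
    show "G (op_add S T) R = G S R + G T R"
      using LIMSEQ_unique[OF G[of "op_add S T" R]] tendsto_add[OF G[of S R] G[of T R]] by (simp add: *)
    show "G R (op_add S T) = G R S + G R T"
      using LIMSEQ_unique[OF G[of R "op_add S T"]] tendsto_add[OF G[of R S] G[of R T]] by (simp add: *)
  next
    fix S R :: "'a \<Rightarrow> 'a" and c assume "R \<in> insert id (weak_class p)" "S \<in> weak_class p"
    note * = formsD(4,5)[OF \<sigma> this]
    show "G (op_scale c S) R = c * G S R"
      using LIMSEQ_unique[OF G[of "op_scale c S" R]] tendsto_mult[OF tendsto_const G[of S R]] by (simp add: *)
    show "G R (op_scale c S) = c * G R S"
      using LIMSEQ_unique[OF G[of R "op_scale c S"]] tendsto_mult[OF tendsto_const G[of R S]] by (simp add: *)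
  next
    fix S T :: "'a \<Rightarrow> 'a" assume b: "(S, T) \<in> form_ball p"
    have "cmod (\<sigma> N1 S T - G S T) \<le> 1" using N1 b by auto
    then show "cmod (G S T) \<le> form_norm p (\<sigma> N1) + 1"
      using form_norm_upper[OF \<sigma>[of N1] b] norm_triangle_sub[of "G S T" "\<sigma> N1 S T"]
      by (simp add: norm_minus_commute)
  qed
  have "(\<lambda>n. form_norm p (\<lambda>S T. \<sigma> n S T + (- 1) * G S T)) \<longlonglongrightarrow> 0"
  proof (rule LIMSEQ_I)
    fix e :: real assume "e > 0"
    then obtain N where N: "\<forall>n\<ge>N. \<forall>(S, T)\<in>form_ball p. cmod (\<sigma> n S T - G S T) \<le> e / 2"
      using err[of "e/2"] by auto
    have "norm (form_norm p (\<lambda>S T. \<sigma> n S T + (- 1) * G S T) - 0) < e" if "n \<ge> N" for n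
    proof -
      have "form_norm p (\<lambda>S T. \<sigma> n S T + (- 1) * G S T) \<le> e / 2"
        by (rule form_norm_least) (use N that in auto)
      moreover have "0 \<le> form_norm p (\<lambda>S T. \<sigma> n S T + (- 1) * G S T)"
        by (intro form_norm_nonneg forms_add forms_scale \<sigma> GF)
      ultimately show ?thesis using \<open>e > 0\<close> by simp
    qed
    then show "\<exists>N. \<forall>n\<ge>N. norm (form_norm p (\<lambda>S T. \<sigma> n S T + (- 1) * G S T) - 0) < e" by blast
  qed
  then show ?thesis using GF by blast
qed

lemma complex_banach_space_form_module: "complex_banach_space (form_module p)"
  by unfold_locales
    (auto simp: form_module_def vdiff_def forms_zero forms_add forms_scale form_norm_nonneg
      form_norm_eq_0 algebra_simps intro!: forms_complete[simplified])

section \<open>The module actions on forms\<close>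

lemma weak_ball_comp:
  assumes a: "a \<in> weak_ball p r" and S: "S \<in> insert id (weak_ball p 1)"
    and ne: "onb \<noteq> ({} :: 'h::complex_hilbert_space set)"
  shows "(a :: 'h \<Rightarrow> 'h) \<circ> S \<in> weak_ball p r" and "S \<circ> a \<in> weak_ball p r"
proof -
  have "a \<circ> S \<in> weak_ball p r \<and> S \<circ> a \<in> weak_ball p r" if S: "S \<in> weak_ball p 1"
    using weak_ball_comp_right[OF a weak_ballD(1)[OF S], of 1] weak_ball_comp_left[OF a weak_ballD(1)[OF S], of 1]
      weak_ball_norm_le[OF S ne] by simp
  then show "a \<circ> S \<in> weak_ball p r" "S \<circ> a \<in> weak_ball p r" using S a by auto
qed

lemma weak_class_comp:
  assumes a: "a \<in> weak_class p" and S: "S \<in> insert id (weak_class p)"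
  shows "(a :: 'h::complex_hilbert_space \<Rightarrow> 'h) \<circ> S \<in> weak_class p" and "S \<circ> a \<in> weak_class p"
proof -
  obtain r where r: "a \<in> weak_ball p r" using a by (auto simp: weak_class_def)
  have "a \<circ> S \<in> weak_class p \<and> S \<circ> a \<in> weak_class p" if S: "S \<in> weak_class p"
  proof -
    have b: "bounded_clinear S" by (rule weak_class_boundedI[OF S])
    have le: "norm (S x) \<le> (onorm S + 1) * norm x" for x
      using bounded_clinearD(8)[OF b, of x] norm_ge_zero[of x] unfolding distrib_right by linarith
    have "0 < onorm S + 1" using onorm_nonneg[OF b] by simp
    then show ?thesis
      using weak_ball_comp_right[OF r b le] weak_ball_comp_left[OF r b le] weak_ball_subset_class by blast
  qed
  then show "a \<circ> S \<in> weak_class p" "S \<circ> a \<in> weak_class p" using S a by auto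
qed

lemma form_dom_comp:
  assumes "a \<in> weak_class p" "(S, T) \<in> form_dom p"
  shows "(S, T \<circ> a) \<in> form_dom p" "(a \<circ> S, T) \<in> form_dom p"
proof -
  have "S \<in> insert id (weak_class p)" "T \<in> insert id (weak_class p)" using assms by (auto simp: form_dom_def)
  then show "(S, T \<circ> a) \<in> form_dom p" "(a \<circ> S, T) \<in> form_dom p"
    using weak_class_comp[OF assms(1)] by (auto intro: form_domI)
qed

lemma op_comp_linear:
  "T \<in> insert id (weak_class p) \<Longrightarrow> T \<circ> op_add a b = op_add (T \<circ> a) (T \<circ> b)"
  "op_add a b \<circ> T = op_add (a \<circ> T) (b \<circ> T)"
  "T \<in> insert id (weak_class p) \<Longrightarrow> T \<circ> op_scale c a = op_scale c (T \<circ> a)"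
  "op_scale c a \<circ> T = op_scale c (a \<circ> T)"
  by (auto simp: op_add_def op_scale_def fun_eq_iff bounded_clinearD[OF weak_class_boundedI])

lemma form_module_simps [simp]:
  "vcarrier (form_module p) = forms p"
  "vadd (form_module p) = (\<lambda>G G' S T. G S T + G' S T)"
  "vzero (form_module p) = (\<lambda>S T. 0)"
  "vscale (form_module p) = (\<lambda>c G S T. c * G S T)"
  "vnorm (form_module p) = form_norm p"
  "lact (form_module p) = (\<lambda>a G S T. if (S, T) \<in> form_dom p then G S (T \<circ> a) else 0)"
  "ract (form_module p) = (\<lambda>G a S T. if (S, T) \<in> form_dom p then G (a \<circ> S) T else 0)"
  by (simp_all add: form_module_def)

lemma schatten_algebra_simps [simp]:
  "vcarrier (schatten_algebra p) = schatten_class p"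
  "vadd (schatten_algebra p) = op_add"
  "vscale (schatten_algebra p) = op_scale"
  "vnorm (schatten_algebra p) = schatten_norm p"
  "amult (schatten_algebra p) = (\<circ>)"
  by (simp_all add: schatten_algebra_def op_add_def op_scale_def fun_eq_iff)

lemma form_actions:
  fixes a :: "'h::complex_hilbert_space \<Rightarrow> 'h"
  assumes a: "a \<in> weak_ball p r" and r: "0 < r" and G: "G \<in> forms p"
    and ne: "onb \<noteq> ({} :: 'h::complex_hilbert_space set)"
  shows "lact (form_module p) a G \<in> forms p" "form_norm p (lact (form_module p) a G) \<le> r * form_norm p G"
    and "ract (form_module p) G a \<in> forms p" "form_norm p (ract (form_module p) G a) \<le> r * form_norm p G"
proof -
  have av: "a \<in> weak_class p" by (rule weak_ball_subset_class[OF a])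
  have le: "cmod (lact (form_module p) a G S T) \<le> r * form_norm p G"
    "cmod (ract (form_module p) G a S T) \<le> r * form_norm p G" if b: "(S, T) \<in> form_ball p" for S T
  proof -
    have d: "(S, T) \<in> form_dom p" using b form_ball_subset_dom by blast
    have ST: "S \<in> insert id (weak_ball p 1)" "T \<in> insert id (weak_ball p 1)" using b by (auto simp: form_ball_def)
    show "cmod (lact (form_module p) a G S T) \<le> r * form_norm p G"
      using form_bound(2)[OF G r ST(1) weak_ball_comp(2)[OF a ST(2) ne]] d by simp
    show "cmod (ract (form_module p) G a S T) \<le> r * form_norm p G"
      using form_bound(1)[OF G r weak_ball_comp(1)[OF a ST(1) ne] ST(2)] d by simp
  qed
  show "form_norm p (lact (form_module p) a G) \<le> r * form_norm p G"
    "form_norm p (ract (form_module p) G a) \<le> r * form_norm p G"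
    by (rule form_norm_least, erule le)+
  note wc = weak_class_comp[OF av] weak_class_op form_domI op_comp_linear(2,4)
    op_comp_linear(1,3)[OF insertI2[OF av]] formsD[OF G]
  show "lact (form_module p) a G \<in> forms p"
    by (rule formsI[OF _ _ _ _ _ le(1)]) (simp_all add: wc)
  show "ract (form_module p) G a \<in> forms p"
    by (rule formsI[OF _ _ _ _ _ le(2)]) (simp_all add: wc)
qed

text \<open>Schatten operators are known to lie in \<open>weak_ball\<close> only for radii strictly
  above their norm; letting the radius decrease recovers estimates with the norm itself.\<close>

lemma le_mult_from_greater:
  fixes x y s :: real
  assumes "\<And>r. s < r \<Longrightarrow> x \<le> r * y"
  shows "x \<le> s * y"
proof (rule tendsto_lowerbound[of "\<lambda>r. r * y" _ "at_right s"])
  show "((\<lambda>r. r * y) \<longlongrightarrow> s * y) (at_right s)" by (intro tendsto_intros)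
  show "\<forall>\<^sub>F r in at_right s. x \<le> r * y" using assms by (auto simp: eventually_at_right_field intro: exI[of _ "s + 1"])
qed simp

lemma schatten_actions:
  fixes a :: "'h::complex_hilbert_space \<Rightarrow> 'h"
  assumes p: "1 \<le> p" and a: "a \<in> schatten_class p" and G: "G \<in> forms p"
    and ne: "onb \<noteq> ({} :: 'h::complex_hilbert_space set)"
  shows "lact (form_module p) a G \<in> forms p"
    "form_norm p (lact (form_module p) a G) \<le> schatten_norm p a * form_norm p G"
    and "ract (form_module p) G a \<in> forms p"
    "form_norm p (ract (form_module p) G a) \<le> schatten_norm p a * form_norm p G"
proof -
  have r: "a \<in> weak_ball p r" "0 < r" if "schatten_norm p a < r" for r
    using schatten_subset_weak_ball[OF p a that] that schatten_norm_nonneg[of p a] by auto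
  have "schatten_norm p a < schatten_norm p a + 1" by simp
  note r1 = r[OF this]
  show "lact (form_module p) a G \<in> forms p" "ract (form_module p) G a \<in> forms p"
    by (rule form_actions[OF r1 G ne])+
  show "form_norm p (lact (form_module p) a G) \<le> schatten_norm p a * form_norm p G"
    by (rule le_mult_from_greater) (rule form_actions(2)[OF r G ne])
  show "form_norm p (ract (form_module p) G a) \<le> schatten_norm p a * form_norm p G"
    by (rule le_mult_from_greater) (rule form_actions(4)[OF r G ne])
qed

lemma banach_bimodule_form_module:
  assumes p: "1 \<le> p" and ne: "onb \<noteq> ({} :: 'h::complex_hilbert_space set)"
  shows "banach_bimodule (schatten_algebra p :: ('h \<Rightarrow> 'h) algebra_structure) (form_module p)"
proof -
  interpret complex_banach_space "form_module p :: ('h \<Rightarrow> 'h, _) bimodule_structure"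
    by (rule complex_banach_space_form_module)
  let ?X = "form_module p :: ('h \<Rightarrow> 'h, _) bimodule_structure"
  note act = schatten_actions[OF p _ _ ne]
  have wc: "a \<in> weak_class p" if "a \<in> schatten_class p" for a :: "'h \<Rightarrow> 'h"
    using schatten_subset_weak_class[OF p] that by blast
  have leg: "S \<in> insert id (weak_class p)" "T \<in> insert id (weak_class p)"
    if "(S, T) \<in> form_dom p" for S T :: "'h \<Rightarrow> 'h"
    using that by (auto simp: form_dom_def)
  show ?thesis
  proof
    fix a b :: "'h \<Rightarrow> 'h" and G :: "('h \<Rightarrow> 'h) \<Rightarrow> ('h \<Rightarrow> 'h) \<Rightarrow> complex"
    assume "a \<in> vcarrier (schatten_algebra p)" "b \<in> vcarrier (schatten_algebra p)" "G \<in> vcarrier ?X"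
    then have a: "a \<in> weak_class p" "b \<in> weak_class p" using wc by auto
    show "lact ?X a (lact ?X b G) = lact ?X (amult (schatten_algebra p) a b) G"
      "ract ?X (ract ?X G a) b = ract ?X G (amult (schatten_algebra p) a b)"
      "lact ?X a (ract ?X G b) = ract ?X (lact ?X a G) b"
      using form_dom_comp[OF a(1)] form_dom_comp[OF a(2)] by (auto simp: fun_eq_iff o_assoc)
  next
    fix a :: "'h \<Rightarrow> 'h" assume "a \<in> vcarrier (schatten_algebra p)"
    then show "linear_between ?X ?X (lact ?X a)" "linear_between ?X ?X (\<lambda>x. ract ?X x a)"
      using act(1,3)[of a] unfolding linear_between_def by (auto simp: fun_eq_iff)
  next
    fix G assume "G \<in> vcarrier ?X"
    then have G: "G \<in> forms p" by simp
    show "linear_between (schatten_algebra p) ?X (\<lambda>a. lact ?X a G)"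
      unfolding linear_between_def
    proof (intro conjI ballI allI)
      fix a :: "'h \<Rightarrow> 'h" assume "a \<in> vcarrier (schatten_algebra p)"
      then have a: "a \<in> schatten_class p" by simp
      show "lact ?X a G \<in> vcarrier ?X" using act(1)[OF a G] by simp
      show "lact ?X (vscale (schatten_algebra p) c a) G = vscale ?X c (lact ?X a G)" for c
      proof (intro ext)
        fix S T
        show "lact ?X (vscale (schatten_algebra p) c a) G S T = vscale ?X c (lact ?X a G) S T"
          using leg[of S T] by (auto simp: op_comp_linear(1,3)[where p = p] op_comp_linear(2,4) formsD[OF G] weak_class_comp[OF wc[OF a]])
      qed
      fix b :: "'h \<Rightarrow> 'h" assume "b \<in> vcarrier (schatten_algebra p)"
      then have b: "b \<in> schatten_class p" by simp
      show "lact ?X (vadd (schatten_algebra p) a b) G = vadd ?X (lact ?X a G) (lact ?X b G)"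
      proof (intro ext)
        fix S T
        show "lact ?X (vadd (schatten_algebra p) a b) G S T = vadd ?X (lact ?X a G) (lact ?X b G) S T"
          using leg[of S T]
          by (auto simp: op_comp_linear(1,3)[where p = p] op_comp_linear(2,4) formsD[OF G] weak_class_comp[OF wc[OF a]] weak_class_comp[OF wc[OF b]])
      qed
    qed
    show "linear_between (schatten_algebra p) ?X (ract ?X G)"
      unfolding linear_between_def
    proof (intro conjI ballI allI)
      fix a :: "'h \<Rightarrow> 'h" assume "a \<in> vcarrier (schatten_algebra p)"
      then have a: "a \<in> schatten_class p" by simp
      show "ract ?X G a \<in> vcarrier ?X" using act(3)[OF a G] by simp
      show "ract ?X G (vscale (schatten_algebra p) c a) = vscale ?X c (ract ?X G a)" for c
      proof (intro ext)
        fix S T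
        show "ract ?X G (vscale (schatten_algebra p) c a) S T = vscale ?X c (ract ?X G a) S T"
          using leg[of S T] by (auto simp: op_comp_linear(1,3)[where p = p] op_comp_linear(2,4) formsD[OF G] weak_class_comp[OF wc[OF a]])
      qed
      fix b :: "'h \<Rightarrow> 'h" assume "b \<in> vcarrier (schatten_algebra p)"
      then have b: "b \<in> schatten_class p" by simp
      show "ract ?X G (vadd (schatten_algebra p) a b) = vadd ?X (ract ?X G a) (ract ?X G b)"
      proof (intro ext)
        fix S T
        show "ract ?X G (vadd (schatten_algebra p) a b) S T = vadd ?X (ract ?X G a) (ract ?X G b) S T"
          using leg[of S T]
          by (auto simp: op_comp_linear(1,3)[where p = p] op_comp_linear(2,4) formsD[OF G] weak_class_comp[OF wc[OF a]] weak_class_comp[OF wc[OF b]])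
      qed
    qed
  next
    show "\<exists>C. \<forall>a\<in>vcarrier (schatten_algebra p). \<forall>x\<in>vcarrier ?X.
        vnorm ?X (lact ?X a x) \<le> C * vnorm (schatten_algebra p) a * vnorm ?X x"
      using act(2) by (intro exI[of _ 1]) simp
    show "\<exists>C. \<forall>a\<in>vcarrier (schatten_algebra p). \<forall>x\<in>vcarrier ?X.
        vnorm ?X (ract ?X x a) \<le> C * vnorm (schatten_algebra p) a * vnorm ?X x"
      using act(4) by (intro exI[of _ 1]) simp
  qed
qed

section \<open>The dual bimodule and the derivation\<close>

lemma dual_bimodule_simps [simp]:
  "vcarrier (dual_bimodule X) = {f. continuous_linear_between X complex_numbers f \<and> (\<forall>x. x \<notin> vcarrier X \<longrightarrow> f x = 0)}"
  "vadd (dual_bimodule X) = (\<lambda>f g x. f x + g x)"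
  "vscale (dual_bimodule X) = (\<lambda>c f x. c * f x)"
  "vnorm (dual_bimodule X) = (\<lambda>f. SUP x\<in>{x \<in> vcarrier X. vnorm X x \<le> 1}. cmod (f x))"
  "lact (dual_bimodule X) = (\<lambda>a f x. if x \<in> vcarrier X then f (ract X x a) else 0)"
  "ract (dual_bimodule X) = (\<lambda>f a x. if x \<in> vcarrier X then f (lact X a x) else 0)"
  by (simp_all add: dual_bimodule_def)

lemma complex_numbers_simps [simp]:
  "vcarrier complex_numbers = UNIV" "vadd complex_numbers = (+)" "vscale complex_numbers = (*)"
  "vnorm complex_numbers = cmod"
  by (simp_all add: complex_numbers_def)

definition unit_derivation ::
  "real \<Rightarrow> ('h \<Rightarrow> 'h) \<Rightarrow> (('h::complex_hilbert_space \<Rightarrow> 'h) \<Rightarrow> ('h \<Rightarrow> 'h) \<Rightarrow> complex) \<Rightarrow> complex" where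
  "unit_derivation p a G = (if G \<in> forms p then G a id - G id a else 0)"

text \<open>In tensor notation the product rule reads a (b \<otimes> 1 - 1 \<otimes> b) + (a
  \<otimes> 1 - 1 \<otimes> a) b = a b \<otimes> 1 - 1 \<otimes> a b: the terms a \<otimes> b
  cancel, and 1 \<otimes> 1 never occurs.\<close>

lemma continuous_derivation_unit_derivation:
  assumes p: "1 \<le> p" and ne: "onb \<noteq> ({} :: 'h::complex_hilbert_space set)"
  shows "continuous_derivation (schatten_algebra p :: ('h \<Rightarrow> 'h) algebra_structure)
    (dual_bimodule (form_module p)) (unit_derivation p)"
proof -
  let ?D = "unit_derivation p :: ('h \<Rightarrow> 'h) \<Rightarrow> _"
  have wc: "a \<in> weak_class p" if "a \<in> schatten_class p" for a :: "'h \<Rightarrow> 'h"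
    using schatten_subset_weak_class[OF p] that by blast
  have le: "cmod (?D a G) \<le> (2 * schatten_norm p a) * form_norm p G"
    if a: "a \<in> schatten_class p" and G: "G \<in> forms p" for a G
  proof -
    have "cmod (?D a G) \<le> r * (2 * form_norm p G)" if "schatten_norm p a < r" for r
    proof -
      have b: "a \<in> weak_ball p r" and r: "0 < r"
        using schatten_subset_weak_ball[OF p a that] that schatten_norm_nonneg[of p a] by auto
      have "cmod (G a id) \<le> r * form_norm p G" "cmod (G id a) \<le> r * form_norm p G"
        using form_bound[OF G r] b by auto
      then show ?thesis using norm_triangle_ineq4[of "G a id" "G id a"] G by (simp add: unit_derivation_def)
    qed
    then have "cmod (?D a G) \<le> schatten_norm p a * (2 * form_norm p G)" by (rule le_mult_from_greater)
    then show ?thesis by simp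
  qed
  have carrier: "?D a \<in> vcarrier (dual_bimodule (form_module p))" if a: "a \<in> schatten_class p" for a
    using le[OF a]
    by (auto simp: continuous_linear_between_def linear_between_def unit_derivation_def forms_add forms_scale
        right_diff_distrib)
  show ?thesis
    unfolding continuous_derivation_def continuous_linear_between_def[of "schatten_algebra p"]
      linear_between_def[of "schatten_algebra p"]
  proof (intro conjI ballI allI)
    show "\<exists>C. \<forall>a\<in>vcarrier (schatten_algebra p).
        vnorm (dual_bimodule (form_module p)) (?D a) \<le> C * vnorm (schatten_algebra p) a"
    proof (intro exI[of _ 2] ballI)
      fix a :: "'h \<Rightarrow> 'h" assume "a \<in> vcarrier (schatten_algebra p)"
      then have a: "a \<in> schatten_class p" by simp
      have "(SUP G\<in>{G \<in> forms p. form_norm p G \<le> 1}. cmod (?D a G)) \<le> 2 * schatten_norm p a"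
      proof (rule cSUP_least)
        have "form_norm p (\<lambda>(S :: 'h \<Rightarrow> 'h) (T :: 'h \<Rightarrow> 'h). 0) = 0" using form_norm_eq_0[OF forms_zero] by blast
        then show "{G \<in> forms p. form_norm p G \<le> 1} \<noteq> ({} :: (('h \<Rightarrow> 'h) \<Rightarrow> _) set)"
          using forms_zero by (metis (mono_tags, lifting) empty_iff mem_Collect_eq zero_le_one)
        fix G :: "('h \<Rightarrow> 'h) \<Rightarrow> ('h \<Rightarrow> 'h) \<Rightarrow> complex" assume "G \<in> {G \<in> forms p. form_norm p G \<le> 1}"
        then have "cmod (?D a G) \<le> (2 * schatten_norm p a) * form_norm p G"
          "(2 * schatten_norm p a) * form_norm p G \<le> (2 * schatten_norm p a) * 1"
          using le[OF a] schatten_norm_nonneg[of p a] by (blast, intro mult_left_mono) auto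
        then show "cmod (?D a G) \<le> 2 * schatten_norm p a" by simp
      qed
      then show "vnorm (dual_bimodule (form_module p)) (?D a) \<le> 2 * vnorm (schatten_algebra p) a" by simp
    qed
  next
    fix a :: "'h \<Rightarrow> 'h" assume "a \<in> vcarrier (schatten_algebra p)"
    then have a: "a \<in> schatten_class p" by simp
    show "?D a \<in> vcarrier (dual_bimodule (form_module p))" by (rule carrier[OF a])
    show "?D (vscale (schatten_algebra p) c a) = vscale (dual_bimodule (form_module p)) c (?D a)" for c
      using wc[OF a] by (auto simp: fun_eq_iff unit_derivation_def formsD right_diff_distrib)
    fix b :: "'h \<Rightarrow> 'h" assume "b \<in> vcarrier (schatten_algebra p)"
    then have b: "b \<in> schatten_class p" by simp
    show "?D (vadd (schatten_algebra p) a b) = vadd (dual_bimodule (form_module p)) (?D a) (?D b)"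
      using wc[OF a] wc[OF b] by (auto simp: fun_eq_iff unit_derivation_def formsD)
    show "?D (amult (schatten_algebra p) a b) = vadd (dual_bimodule (form_module p))
        (lact (dual_bimodule (form_module p)) a (?D b)) (ract (dual_bimodule (form_module p)) (?D a) b)"
    proof
      fix G
      show "?D (amult (schatten_algebra p) a b) G = vadd (dual_bimodule (form_module p))
        (lact (dual_bimodule (form_module p)) a (?D b)) (ract (dual_bimodule (form_module p)) (?D a) b) G"
        using schatten_actions(1)[OF p b _ ne, of G] schatten_actions(3)[OF p a _ ne, of G] wc[OF a] wc[OF b]
        by (simp add: unit_derivation_def form_domI)
    qed
  qed
qed

text \<open>A proper filter satisfies finitely many eventual conditions at a common point, so a and
  b share one y. Most of the proof shows that the supremum in the dual norm runs over a bounded set;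
  only then does the norm dominate each single value.\<close>

lemma approximately_inner_pair:
  fixes X :: "('a, 'x) bimodule_structure" and A :: "('a, 'm) algebra_structure_scheme"
  assumes X: "banach_bimodule A X" and D: "continuous_derivation A (dual_bimodule X) D"
    and inner: "approximately_inner A (dual_bimodule X) D"
    and ab: "a \<in> vcarrier A" "b \<in> vcarrier A" and \<epsilon>: "\<epsilon> > 0"
  obtains y where "y \<in> vcarrier (dual_bimodule X)"
    "\<And>c x. c \<in> {a, b} \<Longrightarrow> x \<in> vcarrier X \<Longrightarrow> vnorm X x \<le> 1 \<Longrightarrow>
      cmod (D c x - (y (ract X x c) - y (lact X c x))) < \<epsilon>"
proof -
  interpret banach_bimodule A X by fact
  let ?Y = "dual_bimodule X"
  let ?d = "\<lambda>c y. vdiff ?Y (D c) (vdiff ?Y (lact ?Y c y) (ract ?Y y c))"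
  obtain F where F: "F \<noteq> bot" "\<forall>\<^sub>F y in F. y \<in> vcarrier ?Y"
    "\<And>c. c \<in> vcarrier A \<Longrightarrow> ((\<lambda>y. vnorm ?Y (?d c y)) \<longlongrightarrow> 0) F"
    using inner unfolding approximately_inner_def by blast
  have "\<forall>\<^sub>F y in F. y \<in> vcarrier ?Y \<and> vnorm ?Y (?d a y) < \<epsilon> \<and> vnorm ?Y (?d b y) < \<epsilon>"
    by (intro eventually_conj F(2) order_tendstoD(2)[OF F(3)] ab \<epsilon>)
  then obtain y where y: "y \<in> vcarrier ?Y" and lt: "\<And>c. c \<in> {a, b} \<Longrightarrow> vnorm ?Y (?d c y) < \<epsilon>"
    using eventually_happens'[OF F(1)] by blast
  have "cmod (D c x - (y (ract X x c) - y (lact X c x))) < \<epsilon>"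
    if c: "c \<in> {a, b}" and x: "x \<in> vcarrier X" "vnorm X x \<le> 1" for c x
  proof -
    have cA: "c \<in> vcarrier A" using c ab by auto
    have ev: "?d c y x = D c x - (y (ract X x c) - y (lact X c x))" if "x \<in> vcarrier X" for x
      using that by (simp add: vdiff_def)
    have "D c \<in> vcarrier ?Y"
      using D cA unfolding continuous_derivation_def continuous_linear_between_def linear_between_def by blast
    then obtain C1 where C1: "\<And>x. x \<in> vcarrier X \<Longrightarrow> cmod (D c x) \<le> C1 * vnorm X x"
      by (auto simp: continuous_linear_between_def)
    obtain C2 where C2: "\<And>x. x \<in> vcarrier X \<Longrightarrow> cmod (y x) \<le> C2 * vnorm X x"
      using y by (auto simp: continuous_linear_between_def)
    obtain C3 where C3: "\<And>x. x \<in> vcarrier X \<Longrightarrow> vnorm X (lact X c x) \<le> C3 * vnorm X x"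
      using lact_bounded cA by blast
    obtain C4 where C4: "\<And>x. x \<in> vcarrier X \<Longrightarrow> vnorm X (ract X x c) \<le> C4 * vnorm X x"
      using ract_bounded cA by blast
    have cl: "lact X c x \<in> vcarrier X" "ract X x c \<in> vcarrier X" if "x \<in> vcarrier X" for x
      using that lact_linear[OF cA] ract_linear[OF cA] by (auto simp: linear_between_def)
    have bd: "K * vnorm X x \<le> \<bar>K\<bar>" if "x \<in> vcarrier X" "vnorm X x \<le> 1" for K x
    proof -
      have "K * vnorm X x \<le> \<bar>K\<bar> * 1" using that norm_nonneg by (intro mult_mono) auto
      then show ?thesis by simp
    qed
    have bd2: "cmod (y z) \<le> \<bar>C2\<bar> * \<bar>K\<bar>"
      if "x \<in> vcarrier X" "vnorm X x \<le> 1" "z \<in> vcarrier X" "vnorm X z \<le> K * vnorm X x" for x z K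
    proof -
      have "cmod (y z) \<le> \<bar>C2\<bar> * vnorm X z"
        using C2[OF that(3)] norm_nonneg[OF that(3)] by (smt (verit) mult_right_mono)
      also have "\<dots> \<le> \<bar>C2\<bar> * \<bar>K\<bar>" using that bd[OF that(1,2), of K] by (intro mult_left_mono) auto
      finally show ?thesis .
    qed
    have "bdd_above ((\<lambda>x. cmod (?d c y x)) ` {x \<in> vcarrier X. vnorm X x \<le> 1})"
    proof (rule bdd_aboveI2)
      fix x assume "x \<in> {x \<in> vcarrier X. vnorm X x \<le> 1}"
      then have x: "x \<in> vcarrier X" "vnorm X x \<le> 1" by auto
      have "cmod (?d c y x) \<le> cmod (D c x) + (cmod (y (ract X x c)) + cmod (y (lact X c x)))"
        unfolding ev[OF x(1)] by (rule order_trans[OF norm_triangle_ineq4 add_left_mono[OF norm_triangle_ineq4]])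
      also have "\<dots> \<le> \<bar>C1\<bar> + (\<bar>C2\<bar> * \<bar>C4\<bar> + \<bar>C2\<bar> * \<bar>C3\<bar>)"
        by (intro add_mono bd2[OF x] cl C3 C4 x order_trans[OF C1 bd])
      finally show "cmod (?d c y x) \<le> \<bar>C1\<bar> + (\<bar>C2\<bar> * \<bar>C4\<bar> + \<bar>C2\<bar> * \<bar>C3\<bar>)" .
    qed
    then have "cmod (?d c y x) \<le> vnorm ?Y (?d c y)"
      unfolding dual_bimodule_simps(4) using x by (intro cSUP_upper) auto
    then show ?thesis using lt[OF c] unfolding ev[OF x(1)] by linarith
  qed
  then show ?thesis using that y by blast
qed

section \<open>Diagonal operators and test forms\<close>

text \<open>The operator is the sum of \<open>\<delta> k\<close> times the projection onto the span
  of \<open>B k\<close>. Summability of \<delta> makes this series converge absolutely at every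
  vector; the weighted sum of p-th powers is the sum of all eigenvalues of c^p and gives membership
  in S_p.\<close>

lemma ex_schatten_diagonal:
  fixes B :: "nat \<Rightarrow> 'h::complex_hilbert_space set" and \<delta> :: "nat \<Rightarrow> real"
  assumes p: "1 \<le> p" and B: "\<And>k. finite (B k)" "\<And>k. B k \<subseteq> onb" and disj: "disjoint_family B"
    and \<delta>: "\<And>k. 0 \<le> \<delta> k" "summable \<delta>" "summable (\<lambda>k. real (card (B k)) * \<delta> k powr p)"
  shows "\<exists>c\<in>schatten_class p. positive_op c \<and> (\<forall>k. \<forall>e\<in>B k. c e = \<delta> k *\<^sub>R e)"
proof -
  define f where "f k x = \<delta> k *\<^sub>R onb_proj (B k) x" for k x
  define c where "c x = (\<Sum>k. f k x)" for x
  note P = bounded_clinearD[OF bounded_clinear_onb_proj]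
  have nf: "norm (f k x) \<le> \<delta> k * norm x" for k x
    using norm_onb_proj_le[OF B(2,1), of k x] \<delta>(1) by (simp add: f_def mult_left_mono)
  have sn: "summable (\<lambda>k. norm (f k x))" for x
    using nf by (intro summable_comparison_test'[OF summable_mult2[OF \<delta>(2), of "norm x"]]) auto
  have sf: "summable (\<lambda>k. f k x)" for x by (rule summable_norm_cancel[OF sn])
  have cs: "(\<lambda>k. f k x) sums c x" for x unfolding c_def by (rule summable_sums[OF sf])
  have c1: "bounded_clinear c"
  proof (rule bounded_clinearI)
    show "c (x + y) = c x + c y" for x y
      using sums_unique2[OF cs[of "x + y"]] sums_add[OF cs[of x] cs[of y]] by (simp add: f_def P scaleR_add_right)
    show "c (a *\<^sub>C x) = a *\<^sub>C c x" for a x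
      using sums_unique2[OF cs[of "a *\<^sub>C x"]] bounded_linear.sums[OF scaleC.bounded_linear_right cs[of x], of a]
      by (simp add: f_def P scaleR_scaleC scaleC_scaleC mult.commute)
    show "norm (c x) \<le> suminf \<delta> * norm x" for x
    proof -
      have "norm (c x) \<le> (\<Sum>k. norm (f k x))" unfolding c_def by (rule summable_norm[OF sn])
      also have "\<dots> \<le> (\<Sum>k. \<delta> k * norm x)" by (rule suminf_le[OF nf sn summable_mult2[OF \<delta>(2)]])
      also have "\<dots> = suminf \<delta> * norm x" by (rule suminf_mult2[OF \<delta>(2), symmetric])
      finally show ?thesis .
    qed
  qed
  have pos: "positive_op c"
  proof (rule positive_opI[OF c1])
    fix x
    define g where "g k = \<delta> k * (\<Sum>e\<in>B k. (cmod (cinner x e))\<^sup>2)" for k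
    have "cinner (f k x) x = of_real (g k)" for k
      by (simp add: f_def g_def cinner_scaleR_left norm_onb_proj(2)[OF B(2,1)] scaleR_conv_of_real)
    then have s: "(\<lambda>k. of_real (g k)) sums cinner (c x) x"
      using bounded_linear.sums[OF cinner.bounded_linear_left cs[of x], of x] by simp
    have "g sums Re (cinner (c x) x)" using sums_Re[OF s] by simp
    moreover have "0 \<le> g k" for k unfolding g_def by (intro mult_nonneg_nonneg sum_nonneg \<delta>(1)) auto
    ultimately show "0 \<le> Re (cinner (c x) x)" by (metis sums_le sums_zero)
    have "(\<lambda>k. 0) sums Im (cinner (c x) x)" using sums_Im[OF s] by simp
    then show "Im (cinner (c x) x) = 0" using sums_unique2 sums_zero by blast
  qed
  have out: "f k e = 0" if "e \<in> onb" "e \<notin> B k" for e k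
  proof -
    have "onb_proj (B k) e = (\<Sum>b\<in>B k. 0)" unfolding onb_proj_def
      using that B(2)[of k] by (intro sum.cong) (auto simp: onb_cinner subset_iff)
    then show ?thesis by (simp add: f_def)
  qed
  have eig: "c e = \<delta> j *\<^sub>R e" if e: "e \<in> B j" for j e
  proof -
    have "f k e = (if k = j then \<delta> j *\<^sub>R e else 0)" for k
    proof (cases "k = j")
      case True
      then show ?thesis using span_onb_proj[OF B(1,2) scaleC.span_base[OF e]] by (simp add: f_def)
    next
      case False
      then have "e \<notin> B k" using disj e by (auto simp: disjoint_family_on_def)
      then show ?thesis using False out e B(2) by auto
    qed
    then have "(\<lambda>k. f k e) sums (\<delta> j *\<^sub>R e)" using sums_single[of j "\<lambda>k. \<delta> j *\<^sub>R e"] by simp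
    then show ?thesis using cs sums_unique2 by blast
  qed
  \<comment> \<open>The eigenvalue at a single basis vector. Disjointness of the blocks makes the
    index unique.\<close>
  define d where "d e = (if \<exists>k. e \<in> B k then \<delta> (THE k. e \<in> B k) else 0)" for e
  have d: "d e = \<delta> k" if "e \<in> B k" for e k
  proof -
    have "(THE k. e \<in> B k) = k"
      using disj that by (intro the_equality) (auto simp: disjoint_family_on_def)
    then show ?thesis using that by (auto simp: d_def)
  qed
  have "c \<in> schatten_class p"
  proof (rule schatten_class_diagonal[OF pos _ _ p])
    show "c e = d e *\<^sub>R e" if "e \<in> onb" for e
    proof (cases "\<exists>k. e \<in> B k")
      case True
      then show ?thesis using eig d by auto
    next
      case False
      then have "(\<lambda>k. f k e) = (\<lambda>k. 0)" using out that by auto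
      then have "c e = 0" using cs[of e] sums_unique2 sums_zero by metis
      then show ?thesis using False by (simp add: d_def)
    qed
    show "0 \<le> d e" for e using \<delta>(1) by (simp add: d_def)
    fix F :: "'h set" assume F: "finite F" "F \<subseteq> onb"
    \<comment> \<open>\<open>F\<close> may meet blocks only in part and may contain vectors of no
      block, where d = 0. Every block that it meets has index below \<open>N\<close>, so its sum is
      at most a partial sum over whole blocks.\<close>
    define N where "N = (SOME n. \<forall>e\<in>F. (\<exists>k. e \<in> B k) \<longrightarrow> (\<exists>k<n. e \<in> B k))"
    have "\<exists>n. \<forall>e\<in>F. (\<exists>k. e \<in> B k) \<longrightarrow> (\<exists>k<n. e \<in> B k)"
      using F(1)
    proof (induction F)
      case (insert e F)
      then obtain n where n: "\<forall>e\<in>F. (\<exists>k. e \<in> B k) \<longrightarrow> (\<exists>k<n. e \<in> B k)" by blast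
      show ?case
      proof (cases "\<exists>k. e \<in> B k")
        case True
        then obtain k where "e \<in> B k" by blast
        then show ?thesis using n by (intro exI[of _ "max n (Suc k)"]) (metis insertE less_max_iff_disj lessI)
      qed (use n in auto)
    qed simp
    then have N: "\<forall>e\<in>F. (\<exists>k. e \<in> B k) \<longrightarrow> (\<exists>k<N. e \<in> B k)" unfolding N_def by (rule someI_ex)
    have "(\<Sum>e\<in>F. d e powr p) = (\<Sum>e\<in>F \<inter> (\<Union>k<N. B k). d e powr p)"
      by (rule sum.mono_neutral_right[OF F(1)]) (use N in \<open>auto simp: d_def\<close>)
    also have "\<dots> \<le> (\<Sum>e\<in>(\<Union>k<N. B k). d e powr p)" using B(1) by (intro sum_mono2) auto
    also have "\<dots> = (\<Sum>k<N. \<Sum>e\<in>B k. d e powr p)"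
      using B(1) disj by (intro sum.UNION_disjoint) (auto simp: disjoint_family_on_def)
    also have "\<dots> = (\<Sum>k<N. real (card (B k)) * \<delta> k powr p)" by (intro sum.cong) (auto simp: d)
    also have "\<dots> \<le> (\<Sum>k. real (card (B k)) * \<delta> k powr p)" by (intro sum_le_suminf \<delta>(3)) auto
    finally show "(\<Sum>e\<in>F. d e powr p) \<le> (\<Sum>k. real (card (B k)) * \<delta> k powr p)" .
  qed
  then show ?thesis using pos eig by blast
qed

text \<open>The functional \<phi> of the overview: for card B = n^p the factor is n^(1-p). It
  cancels the growth card(B)^(1 - 1/p) that \<open>weak_ball\<close> permits.\<close>

definition block_trace :: "real \<Rightarrow> 'h set \<Rightarrow> ('h::complex_hilbert_space \<Rightarrow> 'h) \<Rightarrow> complex" where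
  "block_trace p B S = of_real (real (card B) powr (1 / p - 1)) * (\<Sum>e\<in>B. cinner (S e) e)"

lemma block_trace_le:
  assumes "finite B" "B \<subseteq> onb" "B \<noteq> {}" "S \<in> weak_ball p r"
  shows "cmod (block_trace p B S) \<le> r"
proof -
  have N: "0 < real (card B)" using assms by (simp add: card_gt_0_iff)
  have "cmod (\<Sum>e\<in>B. cinner (S (id e)) (id e)) \<le> r * real (card B) powr (1 - 1 / p)"
    by (rule weak_ballD(2)[OF assms(4) assms(1,2) contraction_id contraction_id])
  then have "cmod (block_trace p B S) \<le> real (card B) powr (1 / p - 1) * (r * real (card B) powr (1 - 1 / p))"
    by (simp add: block_trace_def norm_mult mult_left_mono)
  also have "\<dots> = r" using N by (simp add: powr_add[symmetric])
  finally show ?thesis .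
qed

lemma block_trace_linear:
  "block_trace p B (op_add S T) = block_trace p B S + block_trace p B T"
  "block_trace p B (op_scale c S) = c * block_trace p B S"
  by (simp_all add: block_trace_def op_add_def op_scale_def cinner_add_left cinner_scaleC_left
      sum.distrib sum_distrib_left algebra_simps)

lemma block_trace_eigen:
  assumes c: "positive_op c" "\<And>e. e \<in> B \<Longrightarrow> c e = d *\<^sub>R e"
  shows "block_trace p B (c \<circ> S) = of_real d * block_trace p B S"
    and "bounded_clinear S \<Longrightarrow> block_trace p B (S \<circ> c) = of_real d * block_trace p B S"
proof -
  have "(\<Sum>e\<in>B. cinner (c (S e)) e) = of_real d * (\<Sum>e\<in>B. cinner (S e) e)"
    unfolding sum_distrib_left
    by (rule sum.cong) (auto simp: positive_op_symmetric[OF c(1)] c(2) cinner_scaleR_right scaleR_conv_of_real)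
  then show "block_trace p B (c \<circ> S) = of_real d * block_trace p B S" by (simp add: block_trace_def)
  assume "bounded_clinear S"
  then have "(\<Sum>e\<in>B. cinner (S (c e)) e) = of_real d * (\<Sum>e\<in>B. cinner (S e) e)"
    unfolding sum_distrib_left
    by (intro sum.cong) (auto simp: c(2) bounded_clinearD(7) cinner_scaleR_left scaleR_conv_of_real)
  then show "block_trace p B (S \<circ> c) = of_real d * block_trace p B S" by (simp add: block_trace_def)
qed

text \<open>The plain trace is d card(B); the normalisation leaves card(B)^(1/p), the formal value
  of the functional at the identity.\<close>

lemma block_trace_eigen_self:
  assumes "finite B" "B \<subseteq> onb" "B \<noteq> {}" "\<And>e. e \<in> B \<Longrightarrow> c e = d *\<^sub>R e"
  shows "block_trace p B c = of_real (d * real (card B) powr (1 / p))"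
proof -
  have N: "0 < real (card B)" using assms by (simp add: card_gt_0_iff)
  have "(\<Sum>e\<in>B. cinner (c e) e) = (\<Sum>e\<in>B. of_real d)"
    using assms(2) by (intro sum.cong) (auto simp: assms(4) cinner_scaleR_left onb_cinner subset_iff scaleR_conv_of_real)
  then have "block_trace p B c = of_real (d * (real (card B) powr (1 / p - 1) * real (card B)))"
    by (simp add: block_trace_def mult_ac)
  also have "real (card B) powr (1 / p - 1) * real (card B) = real (card B) powr (1 / p)"
    using N powr_add[of "real (card B)" "1 / p - 1" 1] by simp
  finally show ?thesis .
qed

text \<open>\<open>left_form\<close> and \<open>right_form\<close> are the forms g_k and h_l of the
  overview, while \<open>tensor_form\<close> is \<phi>_B \<otimes> \<phi>_C. They live on disjoint
  kinds of pairs, since \<open>id\<close> is not in the class.\<close>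

definition left_form :: "real \<Rightarrow> 'h set \<Rightarrow> ('h::complex_hilbert_space \<Rightarrow> 'h) \<Rightarrow> ('h \<Rightarrow> 'h) \<Rightarrow> complex" where
  "left_form p B S T = (if S \<in> weak_class p \<and> T = id then block_trace p B S else 0)"

definition right_form :: "real \<Rightarrow> 'h set \<Rightarrow> ('h::complex_hilbert_space \<Rightarrow> 'h) \<Rightarrow> ('h \<Rightarrow> 'h) \<Rightarrow> complex" where
  "right_form p B S T = (if S = id \<and> T \<in> weak_class p then block_trace p B T else 0)"

definition tensor_form ::
  "real \<Rightarrow> 'h set \<Rightarrow> 'h set \<Rightarrow> ('h::complex_hilbert_space \<Rightarrow> 'h) \<Rightarrow> ('h \<Rightarrow> 'h) \<Rightarrow> complex" where
  "tensor_form p B C S T =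
     (if S \<in> weak_class p \<and> T \<in> weak_class p then block_trace p B S * block_trace p C T else 0)"

context
  fixes p :: real and B C :: "'h::complex_hilbert_space set"
  assumes p: "1 \<le> p" and inf: "infinite (onb :: 'h set)"
    and B: "finite B" "B \<subseteq> onb" "B \<noteq> {}" and C: "finite C" "C \<subseteq> onb" "C \<noteq> {}"
begin

lemma test_forms:
  "left_form p B \<in> forms p" "form_norm p (left_form p B) \<le> 1"
  "right_form p B \<in> forms p" "form_norm p (right_form p B) \<le> 1"
  "tensor_form p B C \<in> forms p" "form_norm p (tensor_form p B C) \<le> 1"
proof -
  note id = id_notin_weak_class[OF p inf]
  have 0: "(\<lambda>x. 0) \<in> weak_ball p 1" by (rule weak_ball_zero) simp
  have ne: "S \<noteq> id" if "S \<in> weak_class p" for S :: "'h \<Rightarrow> 'h" using id that by blast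
  have le: "cmod (left_form p B S T) \<le> 1" "cmod (right_form p B S T) \<le> 1" "cmod (tensor_form p B C S T) \<le> 1"
    if "(S, T) \<in> form_ball p" for S T
  proof -
    have S: "S \<in> weak_class p \<Longrightarrow> S \<in> weak_ball p 1" and T: "T \<in> weak_class p \<Longrightarrow> T \<in> weak_ball p 1"
      using that id by (auto simp: form_ball_def)
    show "cmod (left_form p B S T) \<le> 1" using block_trace_le[OF B S] by (auto simp: left_form_def)
    show "cmod (right_form p B S T) \<le> 1" using block_trace_le[OF B T] by (auto simp: right_form_def)
    show "cmod (tensor_form p B C S T) \<le> 1" using block_trace_le[OF B S] block_trace_le[OF C T]
      by (auto simp: tensor_form_def norm_mult intro!: mult_le_one)
  qed
  show "left_form p B \<in> forms p"
    by (rule formsI[OF _ _ _ _ _ le(1)])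
      (use id ne in \<open>auto simp: left_form_def weak_class_op block_trace_linear form_dom_def dest: weak_class_op\<close>)
  show "right_form p B \<in> forms p"
    by (rule formsI[OF _ _ _ _ _ le(2)])
      (use id ne in \<open>auto simp: right_form_def weak_class_op block_trace_linear form_dom_def dest: weak_class_op\<close>)
  show "tensor_form p B C \<in> forms p"
    by (rule formsI[OF _ _ _ _ _ le(3)])
      (use id ne in \<open>auto simp: tensor_form_def weak_class_op block_trace_linear form_dom_def algebra_simps\<close>)
  show "form_norm p (left_form p B) \<le> 1" "form_norm p (right_form p B) \<le> 1" "form_norm p (tensor_form p B C) \<le> 1"
    by (rule form_norm_least, erule le)+
qed

text \<open>Acting with c turns a pair (id, T), where \<open>tensor_form\<close> vanishes, into (c,
  T), where its value is \<phi>_B(c) \<phi>_C(T); likewise (S, id) becomes (S, c). This creates the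
  terms in \<open>right_form\<close> and \<open>left_form\<close>, the only coupling between the two
  blocks. The equal eigenvalues make the multiples of \<open>tensor_form\<close> agree, so they
  cancel in the commutator.\<close>

lemma test_form_actions:
  assumes c: "positive_op c" "c \<in> weak_class p"
    and eigen: "\<forall>e\<in>B. c e = d *\<^sub>R e" "\<forall>e\<in>C. c e = d *\<^sub>R e"
  shows "ract (form_module p) (left_form p B) c = (\<lambda>S T. of_real d * left_form p B S T)"
    "lact (form_module p) c (left_form p B) = (\<lambda>S T. 0)"
    "ract (form_module p) (tensor_form p B C) c =
      (\<lambda>S T. of_real d * tensor_form p B C S T + of_real (d * real (card B) powr (1 / p)) * right_form p C S T)"
    "lact (form_module p) c (tensor_form p B C) =
      (\<lambda>S T. of_real d * tensor_form p B C S T + of_real (d * real (card C) powr (1 / p)) * left_form p B S T)"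
    "unit_derivation p c (left_form p B) = of_real (d * real (card B) powr (1 / p))"
    "unit_derivation p c (tensor_form p B C) = 0"
proof -
  note id = id_notin_weak_class[OF p inf]
  have ne: "S \<noteq> id" if "S \<in> weak_class p" for S :: "'h \<Rightarrow> 'h" using id that by blast
  have comp: "c \<circ> S \<in> weak_class p" "S \<circ> c \<in> weak_class p" if "S \<in> insert id (weak_class p)" for S
    using weak_class_comp[OF c(2) that] by auto
  have cases: "(S, T) \<in> form_dom p \<longleftrightarrow>
      (S \<in> weak_class p \<and> T \<in> weak_class p \<or> S \<in> weak_class p \<and> T = id \<or> S = id \<and> T \<in> weak_class p)"
    for S T :: "'h \<Rightarrow> 'h" by (auto simp: form_dom_def)
  note d = eigen[rule_format]
  note simps = left_form_def right_form_def tensor_form_def comp id cases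
    block_trace_eigen(1)[OF c(1) d(1)] block_trace_eigen(2)[OF c(1) d(1) weak_class_boundedI]
    block_trace_eigen(1)[OF c(1) d(2)] block_trace_eigen(2)[OF c(1) d(2) weak_class_boundedI]
    block_trace_eigen_self[OF B d(1)] block_trace_eigen_self[OF C d(2)]
  show "ract (form_module p) (left_form p B) c = (\<lambda>S T. of_real d * left_form p B S T)"
    by (intro ext) (use id in \<open>auto simp: simps\<close>)
  show "lact (form_module p) c (left_form p B) = (\<lambda>S T. 0)"
  proof (intro ext)
    fix S T
    \<comment> \<open>The composition with \<open>c\<close> stays in the class, so it never reaches
      the support of \<open>left_form\<close>.\<close>
    have "(S, T) \<in> form_dom p \<Longrightarrow> T \<circ> c \<noteq> id" using comp(2)[of T] ne by (auto simp: cases)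
    then show "lact (form_module p) c (left_form p B) S T = 0" by (simp add: left_form_def)
  qed
  show "ract (form_module p) (tensor_form p B C) c =
      (\<lambda>S T. of_real d * tensor_form p B C S T + of_real (d * real (card B) powr (1 / p)) * right_form p C S T)"
    by (intro ext) (use id in \<open>auto simp: simps c(2)\<close>)
  show "lact (form_module p) c (tensor_form p B C) =
      (\<lambda>S T. of_real d * tensor_form p B C S T + of_real (d * real (card C) powr (1 / p)) * left_form p B S T)"
    by (intro ext) (use id in \<open>auto simp: simps c(2)\<close>)
  show "unit_derivation p c (left_form p B) = of_real (d * real (card B) powr (1 / p))"
    using test_forms(1) by (simp add: unit_derivation_def simps c(2))
  show "unit_derivation p c (tensor_form p B C) = 0"
    using test_forms(5) by (simp add: unit_derivation_def simps c(2))
qed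

end

text \<open>An injective sequence in \<open>onb\<close>, indexed by pairs through
  \<open>prod_encode\<close>, splits into infinitely many disjoint rows; each block is an initial
  segment of its row.\<close>

lemma ex_blocks:
  fixes N :: "nat \<Rightarrow> nat"
  assumes "infinite (onb :: 'h::complex_hilbert_space set)"
  shows "\<exists>B :: nat \<Rightarrow> 'h set. disjoint_family B \<and> (\<forall>k. finite (B k) \<and> B k \<subseteq> onb \<and> card (B k) = N k)"
proof -
  obtain f :: "nat \<Rightarrow> 'h" where f: "inj f" "range f \<subseteq> onb" using infinite_countable_subset[OF assms] by blast
  define B where "B k = (\<lambda>i. f (prod_encode (k, i))) ` {..<N k}" for k
  have eq: "f (prod_encode (k, i)) = f (prod_encode (l, j)) \<longleftrightarrow> k = l \<and> i = j" for k i l j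
    using f(1) by (simp add: inj_eq)
  have "card (B k) = N k" for k unfolding B_def by (subst card_image) (auto simp: inj_on_def eq)
  moreover have "disjoint_family B" by (auto simp: disjoint_family_on_def B_def eq)
  moreover have "finite (B k)" "B k \<subseteq> onb" for k using f(2) by (auto simp: B_def)
  ultimately show ?thesis by blast
qed

section \<open>Contradiction along the chain of blocks\<close>

theorem theorem2p1:
  fixes p :: real
  assumes "1 \<le> p"
    and infinite_dimensional:
      "\<nexists>B :: 'h::complex_hilbert_space set. finite B \<and> module.span (*\<^sub>C) B = UNIV"
  shows "\<not> approximately_amenable TYPE(('h \<Rightarrow> 'h) \<Rightarrow> ('h \<Rightarrow> 'h) \<Rightarrow> complex)
           (schatten_algebra p :: ('h \<Rightarrow> 'h) algebra_structure)"
proof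
  assume am: "approximately_amenable TYPE(('h \<Rightarrow> 'h) \<Rightarrow> ('h \<Rightarrow> 'h) \<Rightarrow> complex)
    (schatten_algebra p :: ('h \<Rightarrow> 'h) algebra_structure)"
  note p = assms(1)
  have inf: "infinite (onb :: 'h set)" by (rule infinite_onb[OF infinite_dimensional])
  then have ne: "onb \<noteq> ({} :: 'h set)" by auto
  let ?X = "form_module p :: ('h \<Rightarrow> 'h, _) bimodule_structure"
  have X: "banach_bimodule (schatten_algebra p :: ('h \<Rightarrow> 'h) algebra_structure) ?X"
    by (rule banach_bimodule_form_module[OF p ne])
  note D = continuous_derivation_unit_derivation[OF p ne]
  have inner: "approximately_inner (schatten_algebra p :: ('h \<Rightarrow> 'h) algebra_structure) (dual_bimodule ?X) (unit_derivation p)"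
    using am X D unfolding approximately_amenable_def by blast
  \<comment> \<open>Block sizes must be integers, so \<open>K\<close> is chosen before L: the blocks
    have size K^k, and L = K^(1/p) \<ge> 4 satisfies (L^k)^p = K^k exactly.\<close>
  obtain K :: nat where K: "4 powr p \<le> real K" using real_arch_simple by blast
  define L where "L = real K powr (1 / p)"
  have K0: "0 < real K" using K by (metis less_le_trans powr_gt_zero zero_neq_numeral)
  have "(4 powr p) powr (1 / p) \<le> L" unfolding L_def using K p by (intro powr_mono2) auto
  then have L: "4 \<le> L" using p by (simp add: powr_powr)
  have LK: "L powr p = real K" using p K0 by (simp add: L_def powr_powr)
  obtain B :: "nat \<Rightarrow> 'h set" where B: "disjoint_family B" "\<And>k. finite (B k)" "\<And>k. B k \<subseteq> onb" "\<And>k. card (B k) = K ^ k"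
    using ex_blocks[OF inf, of "\<lambda>k. K ^ k"] by blast
  have Bne: "B k \<noteq> {}" for k using B(4)[of k] K0 by auto
  note Bk = B(2) B(3) Bne
  have n: "real (card (B k)) powr (1 / p) = L ^ k" for k
    using K0 by (simp add: B(4) L_def powr_power powr_powr powr_realpow[symmetric] mult.commute)
  \<comment> \<open>The factor 2 in 2 L buys summability: K^k times the p-th power of the eigenvalue
    is at most 2^(-p k). Since L \<ge> 4, the ratio L / 2 \<ge> 2 still leaves geometric growth for
    \<open>gap\<close>.\<close>
  have op: "\<exists>c\<in>schatten_class p. positive_op c \<and> (\<forall>k. \<forall>e\<in>B k. c e = (1 / (2 * L) ^ m k) *\<^sub>R e)"
    if m: "\<And>k. k \<le> m k" for m :: "nat \<Rightarrow> nat"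
  proof (rule ex_schatten_diagonal[OF p B(2,3,1)])
    have le: "1 / (2 * L) ^ m k \<le> (1 / (2 * L)) ^ k" for k
      using power_increasing[OF m[of k], of "2 * L"] L by (simp add: power_one_over frac_le)
    show "0 \<le> 1 / (2 * L) ^ m k" for k using L by simp
    have "summable (\<lambda>k. (1 / (2 * L)) ^ k)" using L by (intro summable_geometric) auto
    then show "summable (\<lambda>k. 1 / (2 * L) ^ m k)"
      by (rule summable_comparison_test'[where N = 0]) (use le L in auto)
    have "summable (\<lambda>k. (1 / 2 :: real) ^ k)" by (intro summable_geometric) auto
    then show "summable (\<lambda>k. real (card (B k)) * (1 / (2 * L) ^ m k) powr p)"
    proof (rule summable_comparison_test'[where N = 0])
      fix k :: nat
      have "(1 / (2 * L) ^ m k) powr p \<le> ((1 / (2 * L)) ^ k) powr p" using le L p by (intro powr_mono2) auto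
      also have "\<dots> = ((1 / (2 * L)) powr p) ^ k"
        using L by (simp add: powr_realpow[symmetric] powr_powr mult.commute)
      also have "\<dots> = (1 / (2 powr p * K)) ^ k" using L by (simp add: powr_divide powr_mult LK)
      finally have "real (card (B k)) * (1 / (2 * L) ^ m k) powr p \<le> real K ^ k * (1 / (2 powr p * K)) ^ k"
        by (simp add: B(4) mult_left_mono)
      also have "\<dots> = (1 / 2 powr p) ^ k" using K0 by (simp add: power_mult_distrib[symmetric])
      also have "\<dots> \<le> (1 / 2) ^ k"
        using powr_mono[OF p, of 2] by (intro power_mono) (auto simp: frac_le)
      finally show "norm (real (card (B k)) * (1 / (2 * L) ^ m k) powr p) \<le> (1 / 2) ^ k" by simp
    qed
  qed
  \<comment> \<open>The exponents are 0, 2, 2, 4, 4, ... for i = 0 and 1, 1, 3, 3, ... for i = 1: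
    constant on {2j-1, 2j} and on {2j, 2j+1}. They exceed k by at most one, which limits the loss in
    \<open>gap\<close>.\<close>
  define m where "m i k = (if i = (0::nat) then 2 * ((k + 1) div 2) else 2 * (k div 2) + 1)" for i k :: nat
  have m: "k \<le> m i k" "m i k \<le> k + 1" for i k by (auto simp: m_def)
  have m_step: "m (if even k then 1 else 0) k = m (if even k then 1 else 0) (Suc k)" for k
    by (auto simp: m_def)
  have "\<forall>i. \<exists>c. c \<in> schatten_class p \<and> positive_op c \<and> (\<forall>k. \<forall>e\<in>B k. c e = (1 / (2 * L) ^ m i k) *\<^sub>R e)"
  proof
    fix i
    show "\<exists>c. c \<in> schatten_class p \<and> positive_op c \<and> (\<forall>k. \<forall>e\<in>B k. c e = (1 / (2 * L) ^ m i k) *\<^sub>R e)"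
      using op[of "m i"] m(1) by blast
  qed
  then obtain c where "\<forall>i. c i \<in> schatten_class p \<and> positive_op (c i) \<and>
      (\<forall>k. \<forall>e\<in>B k. c i e = (1 / (2 * L) ^ m i k) *\<^sub>R e)"
    unfolding choice_iff by blast
  then have c: "\<And>i. c i \<in> schatten_class p" "\<And>i. positive_op (c i)"
    "\<And>i k e. e \<in> B k \<Longrightarrow> c i e = (1 / (2 * L) ^ m i k) *\<^sub>R e"
    by blast+
  have cw: "c i \<in> weak_class p" for i using c(1) schatten_subset_weak_class[OF p] by blast
  have c01: "c 0 \<in> vcarrier (schatten_algebra p)" "c 1 \<in> vcarrier (schatten_algebra p)" using c(1) by simp_all
  \<comment> \<open>Error budget: 1/10 at the start, 2/5 along the chain and 1/10 at the end, in
    total less than 1.\<close>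
  have "(0::real) < 1 / 10" by simp
  then obtain y where y: "y \<in> vcarrier (dual_bimodule ?X)"
    and y01: "\<And>a x. a \<in> {c 0, c 1} \<Longrightarrow> x \<in> vcarrier ?X \<Longrightarrow> vnorm ?X x \<le> 1 \<Longrightarrow>
      cmod (unit_derivation p a x - (y (ract ?X x a) - y (lact ?X a x))) < 1 / 10"
    using approximately_inner_pair[OF X D inner c01] by blast
  have yc: "cmod (unit_derivation p (c i) x - (y (ract ?X x (c i)) - y (lact ?X (c i) x))) < 1 / 10"
    if "x \<in> forms p" "form_norm p x \<le> 1" "i = 0 \<or> i = 1" for i x
    by (rule y01) (use that in auto)
  have y_add: "y (\<lambda>S T. G S T + G' S T) = y G + y G'" if "G \<in> forms p" "G' \<in> forms p" for G G'
    using y that by (auto simp: continuous_linear_between_def linear_between_def)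
  have y_scale: "y (\<lambda>S T. a * G S T) = a * y G" if "G \<in> forms p" for a G
    using y that by (auto simp: continuous_linear_between_def linear_between_def)
  have y0: "y (\<lambda>S T. 0) = 0" using y_scale[OF forms_zero, of 0] by simp
  obtain M0 where "\<And>x. x \<in> forms p \<Longrightarrow> cmod (y x) \<le> M0 * form_norm p x"
    using y by (auto simp: continuous_linear_between_def)
  then have M: "cmod (y x) \<le> \<bar>M0\<bar>" if "x \<in> forms p" "form_norm p x \<le> 1" for x
    using that form_norm_nonneg[OF that(1)]
    by (smt (verit, best) mult_left_le mult_right_mono)
  note tf = test_forms[OF p inf Bk Bk]
  define U where "U k = y (left_form p (B k)) / of_real (L ^ k)" for k
  define V where "V k = y (right_form p (B k)) / of_real (L ^ k)" for k
  \<comment> \<open>\<open>k\<close> is the left and \<open>l\<close> the right block of the tensor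
    form, and \<open>j\<close> is the smaller index. Both orders occur: the chain takes U at even
    and V at odd indices, so the even block always stands on the left.\<close>
  have gap: "cmod (V l - U k) \<le> 1 / 5 * (1 / 2) ^ j"
    if i: "i = 0 \<or> i = 1" and eq: "m i k = m i l" and kl: "k = j \<and> l = Suc j \<or> k = Suc j \<and> l = j" for i j k l
  proof -
    define d where "d = 1 / (2 * L) ^ m i k"
    have ek: "\<forall>e\<in>B k. c i e = d *\<^sub>R e" and el: "\<forall>e\<in>B l. c i e = d *\<^sub>R e"
      using c(3) by (auto simp: d_def eq)
    note act = test_form_actions[OF p inf Bk[of k] Bk[of l] c(2) cw ek el, unfolded n]
    note tkl = tf(5)[of k l] tf(6)[of k l]
    have "y (ract ?X (tensor_form p (B k) (B l)) (c i)) - y (lact ?X (c i) (tensor_form p (B k) (B l)))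
        = of_real (d * L ^ k) * y (right_form p (B l)) - of_real (d * L ^ l) * y (left_form p (B k))"
      unfolding act by (simp add: y_add y_scale tf forms_scale)
    also have "\<dots> = of_real (d * L ^ k * L ^ l) * (V l - U k)"
      using L by (simp add: U_def V_def algebra_simps)
    finally have "cmod (of_real (d * L ^ k * L ^ l) * (V l - U k)) < 1 / 10"
      using yc[OF tkl i] unfolding act by (simp add: norm_minus_commute)
    moreover have "0 < d * L ^ k * L ^ l" using L by (simp add: d_def)
    ultimately have 1: "d * L ^ k * L ^ l * cmod (V l - U k) < 1 / 10" by (simp only: norm_mult norm_of_real abs_of_pos)
    \<comment> \<open>The exponent is common to both blocks, so it can be estimated at the one with
      index j.\<close>
    have "m i k \<le> Suc j" using kl m(2)[of i k] m(2)[of i l] eq by auto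
    then have "1 / (2 * L) ^ Suc j \<le> d" unfolding d_def using L by (intro divide_left_mono power_increasing) auto
    moreover have "L ^ k * L ^ l = L ^ Suc j * L ^ j" using kl by (auto simp: mult.commute)
    ultimately have "1 / (2 * L) ^ Suc j * (L ^ Suc j * L ^ j) \<le> d * (L ^ k * L ^ l)"
      using L by (simp only:) (intro mult_right_mono, auto)
    also have "1 / (2 * L) ^ Suc j * (L ^ Suc j * L ^ j) = L ^ j / 2 ^ Suc j"
      using L by (simp add: power_mult_distrib)
    finally have "L ^ j / 2 ^ Suc j \<le> d * (L ^ k * L ^ l)" .
    \<comment> \<open>Now d n_k n_l \<ge> 2^j / 2, so the error 1/10 becomes 1/5 times 2^-j.\<close>
    moreover have "4 ^ j / 2 ^ Suc j \<le> L ^ j / 2 ^ Suc j" using L by (intro divide_right_mono power_mono) auto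
    moreover have "4 ^ j / 2 ^ Suc j = (2 ^ j / 2 :: real)"
      using power_mult_distrib[of "2 :: real" 2 j] by simp
    ultimately have "2 ^ j / 2 \<le> d * L ^ k * L ^ l" by (simp add: mult.assoc)
    then have "2 ^ j / 2 * cmod (V l - U k) \<le> 1 / 10" using 1 by (smt (verit) mult_right_mono norm_ge_zero)
    then show ?thesis by (simp add: field_simps power_one_over)
  qed
  define W where "W k = (if even k then U k else V k)" for k
  have step: "cmod (W (Suc k) - W k) \<le> 1 / 5 * (1 / 2) ^ k" for k
  proof (cases "even k")
    case True
    then show ?thesis using gap[of 1 k "Suc k" k] m_step[of k] by (simp add: W_def)
  next
    case False
    then show ?thesis using gap[of 0 "Suc k" k k] m_step[of k] by (simp add: W_def norm_minus_commute)
  qed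
  \<comment> \<open>The exact partial sum of the geometric series is kept, so that the induction
    closes; only the limit 2/5 is used.\<close>
  have tele: "cmod (W k - W 0) \<le> 2 / 5 - 2 / 5 * (1 / 2) ^ k" for k
  proof (induction k)
    case (Suc k)
    have "cmod (W (Suc k) - W 0) \<le> cmod (W (Suc k) - W k) + cmod (W k - W 0)"
      using norm_triangle_ineq[of "W (Suc k) - W k" "W k - W 0"] by simp
    then show ?case using Suc step[of k] by simp
  qed simp
  \<comment> \<open>\<open>B 0\<close> is a single vector and \<open>m 0 0 = 0\<close>, so
    \<open>c 0\<close> has eigenvalue 1 there. The right action fixes
    \<open>left_form p (B 0)\<close>, the left action annihilates it, and the derivation takes the
    value 1 on it.\<close>
  have W0: "cmod (1 - W 0) < 1 / 10"
  proof -
    have e0: "\<forall>e\<in>B 0. c 0 e = 1 *\<^sub>R e" using c(3)[of _ 0 0] by (simp add: m_def)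
    note act = test_form_actions[OF p inf Bk[of 0] Bk[of 0] c(2) cw e0 e0, unfolded n]
    have "cmod (1 - y (left_form p (B 0))) < 1 / 10"
      using yc[OF tf(1,2), of 0 0] unfolding act by (simp add: y0)
    then show ?thesis by (simp add: W_def U_def)
  qed
  \<comment> \<open>Here the boundedness of \<open>y\<close> enters: the test forms have norm at
    most 1, so |W k| \<le> |M0| / L^k.\<close>
  obtain k where k: "10 * \<bar>M0\<bar> < 4 ^ k" using real_arch_pow[of 4 "10 * \<bar>M0\<bar>"] by auto
  have "cmod (W k) \<le> \<bar>M0\<bar> / L ^ k"
    using M[OF tf(1,2), of k] M[OF tf(3,4), of k] L
    by (auto simp: W_def U_def V_def norm_divide norm_power divide_right_mono)
  also have "\<dots> \<le> \<bar>M0\<bar> / 4 ^ k" using L by (intro divide_left_mono power_mono) auto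
  also have "\<dots> \<le> 1 / 10" using k by (simp add: field_simps)
  finally have "cmod (W k) \<le> 1 / 10" .
  moreover have "cmod (W k - W 0) \<le> 2 / 5" using tele[of k] by (smt (verit) zero_le_power divide_nonneg_nonneg mult_nonneg_nonneg)
  moreover have "1 \<le> cmod (1 - W 0) + cmod (W k - W 0) + cmod (W k)"
    using norm_triangle_ineq[of "1 - W 0" "W 0 - W k"] norm_triangle_ineq[of "1 - W k" "W k"]
    by (simp add: norm_minus_commute)
  ultimately show False using W0 by linarith
qed

end
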